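(* Let $n\ge1$. The identity functor induces a Quillen equivalence between the model categories $\mathcal L(\Theta_nSp)^{\mathbf\Delta^{op}}_{disc,f}$ and $\mathcal L(\Theta_nSp)^{\mathbf\Delta^{op}}_{disc,c}$, the identity functor $\mathcal L(\Theta_nSp)^{\mathbf\Delta^{op}}_{disc,f}\to\mathcal L(\Theta_nSp)^{\mathbf\Delta^{op}}_{disc,c}$ being the left adjoint.
   Context: **The model category $\Theta_nSp$.** $\mathbf\Delta$ is the category of ordered sets $[m]=\{0<\dots<m\}$, and $\mathcal{SS}ets$ is the category of simplicial sets. For a small category $\mathcal C$, $\Theta\mathcal C$ has objects $[m](c_1,\dots,c_m)$ with $[m]\in\mathbf\Delta$ and $c_i\in\mathcal C$; a morphism $[m](c_1,\dots,c_m)\to[q](d_1,\dots,d_q)$ is a map $\delta\colon[m]\to[q]$ in $\mathbf\Delta$ together with morphisms $f_{ij}\colon c_i\to d_j$ of $\mathcal C$ for all $1\le i\le m$ and $\delta(i-1)<j\le\delta(i)$. $\Theta_0$ is the terminal category and $\Theta_n=\Theta(\Theta_{n-1})$, so $\Theta_1=\mathbf\Delta$. $\Theta[m](c_1,\dots,c_m)$ is the presheaf on $\Theta_n$ represented by $[m](c_1,\dots,c_m)$, regarded as a levelwise discrete functor $\Theta_n^{op}\to\mathcal{SS}ets$. For $m\ge2$, $G[m](c_1,\dots,c_m)=\mathrm{colim}(\Theta[1](c_1)\leftarrow\Theta[0]\to\Theta[1](c_2)\leftarrow\cdots\to\Theta[1](c_m))$, gluing the last vertex of each piece to the first vertex of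 the next, and $Se_{\Theta_n}$ is the set of inclusions $G[m](c_1,\dots,c_m)\to\Theta[m](c_1,\dots,c_m)$, $m\ge 2$. $E$ is the nerve of the category with two objects and a single isomorphism between them, regarded as a levelwise discrete simplicial space; $T\colon\mathbf\Delta\to\Theta_n$ is $[q]\mapsto[q]([0],\dots,[0])$ (the identity if $n=1$), $T_\#$ is the left adjoint of restriction along $T$, and $Cpt_{\Theta_n}=\{T_\#E\to T_\#\Delta[0]\}$ (with $\Delta[0]$ levelwise discrete). For $A\colon\Theta_{n-1}^{op}\to\mathcal{SS}ets$, $V[1](A)([q](c_1,\dots,c_q))=\coprod_{\delta\in\mathrm{Hom}_{\mathbf\Delta}([q],[1])}\ \prod_{i:\,\delta(i-1)=0,\,\delta(i)=1}A(c_i)$. Put $\mathcal T_1=Se_{\Theta_1}\cup Cpt_{\Theta_1}$ and $\mathcal T_n=Se_{\Theta_n}\cup Cpt_{\Theta_n}\cup V[1](\mathcal T_{n-1})$ for $n\ge2$. $\Theta_nSp$ is the category of functors $\Theta_n^{op}\to\mathcal{SS}ets$ with the left Bousfield localization at $\mathcal T_n$ of the injective (equivalently Reedy) model structure, i.e. the one with levelwise weak equivalences and monomorphisms as cofibrations. It is a cartesian model category. An object of $\Theta_nSp$ is *discrete* if it is a constant diagram at a set. Generating cofibrations of $\Theta_nSp$: the maps $\partial\Delta[m]\times\Theta[q](c_1,\dots,c_q)\cup\Delta[m]\times\partial\Theta[q](c_1,\dots,c_q)\to\Delta[m]\times\Theta[q](c_1,\dots,c_q)$ for $m,q\ge0$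 and $c_i\in\Theta_{n-1}$, where $\Delta[m],\partial\Delta[m]$ are constant diagrams of simplicial sets and $\partial\Theta[q](c_1,\dots,c_q)$ is the boundary (largest proper subpresheaf) of the representable. **Segal precategories.** A $\Theta_nSp$-Segal precategory is a functor $X\colon\mathbf\Delta^{op}\to\Theta_nSp$ with $X_0$ discrete; these form a full subcategory of the functor category. It is a $\Theta_nSp$-Segal category if the Segal maps $X_k\to X_1\times_{X_0}\cdots\times_{X_0}X_1$ ($k$ factors) are weak equivalences in $\Theta_nSp$ for all $k\ge2$. $\mathcal L_S(\Theta_nSp)^{\mathbf\Delta^{op}}$ denotes the left Bousfield localization of the Reedy model structure on functors $\mathbf\Delta^{op}\to\Theta_nSp$ whose fibrant objects are the Reedy fibrant functors all of whose Segal maps are weak equivalences. **Dwyer-Kan equivalences.** $L$ is a functor (built by the small object argument) on $\Theta_nSp$-Segal precategories, with a natural map $X\to LX$ which is the identity in simplicial degree $0$ and a weak equivalence in $\mathcal L_S(\Theta_nSp)^{\mathbf\Delta^{op}}$, such that $LX$ is a Reedy fibrant $\Theta_nSp$-Segal category. For a Reedy fibrant $\Theta_nSp$-Segal category $W$ and $x,y\in W_0$, $\mathrm{map}_W(x,y)$ is the fiber of $(d_1,d_0)\colon W_1\to W_0\times W_0$ over $(x,y)$; $\mathrm{Ho}(W)$ is the category with object set $W_0$, $\mathrm{Hom}_{\mathrm{Ho}(W)}(x,y)=\mathrm{Hom}_{\mathrm{Ho}(\Theta_nSp)}(1,\mathrm{map}_W(x,y))$ ($1$ the terminal object), and composition induced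 by the Segal map $W_2\simeq W_1\times_{W_0}W_1$ and $d_1\colon W_2\to W_1$. A map $f\colon X\to Y$ of $\Theta_nSp$-Segal precategories is a *Dwyer-Kan equivalence* if $\mathrm{map}_{LX}(x,y)\to\mathrm{map}_{LY}(fx,fy)$ is a weak equivalence in $\Theta_nSp$ for all $x,y\in X_0$ and $\mathrm{Ho}(LX)\to\mathrm{Ho}(LY)$ is an equivalence of categories. **The set $I_f$.** Regard $\Delta[p]$ as the functor $\mathbf\Delta^{op}\to\Theta_nSp$ sending $[k]$ to the discrete object $\Delta[p]_k$, and $A\in\Theta_nSp$ as a constant functor $\mathbf\Delta^{op}\to\Theta_nSp$; $(\Delta[p])_0$ also denotes the constant functor at the discrete set of vertices of $\Delta[p]$. For $A\in\Theta_nSp$ and $p\ge0$, $A_{[p]}$ is the pushout of $(\Delta[p])_0\leftarrow A\times(\Delta[p])_0\to A\times\Delta[p]$, with the convention $\varnothing_{[0]}=\varnothing$. Then $I_f=\{A_{[p]}\to B_{[p]}\mid p\ge0,\ A\to B\text{ a generating cofibration in }\Theta_nSp\}$. **The two model structures.** Both are on the category of $\Theta_nSp$-Segal precategories, with weak equivalences the Dwyer-Kan equivalences. In $\mathcal L(\Theta_nSp)^{\mathbf\Delta^{op}}_{disc,c}$ the cofibrations are the monomorphisms; in $\mathcal L(\Theta_nSp)^{\mathbf\Delta^{op}}_{disc,f}$ the cofibrations are the retracts of transfinite compositions of pushouts of maps in $I_f$. *)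

theory Defs
  imports "HOL-Library.FuncSet"
begin

section \<open>Categories, functors, limits\<close>

text \<open>Composition is written in the usual order: \<open>Cmp C g f\<close> is \<open>g\<close> after \<open>f\<close>.\<close>

record ('o, 'a) cat =
  Obj :: "'o set"
  Arr :: "'a set"
  Dom :: "'a \<Rightarrow> 'o"
  Cod :: "'a \<Rightarrow> 'o"
  Ide :: "'o \<Rightarrow> 'a"
  Cmp :: "'a \<Rightarrow> 'a \<Rightarrow> 'a"

definition Hom :: "('o, 'a) cat \<Rightarrow> 'o \<Rightarrow> 'o \<Rightarrow> 'a set" where
  "Hom C x y = {f \<in> Arr C. Dom C f = x \<and> Cod C f = y}"

definition opp :: "('o, 'a) cat \<Rightarrow> ('o, 'a) cat" where
  "opp C = \<lparr>Obj = Obj C, Arr = Arr C, Dom = Cod C, Cod = Dom C, Ide = Ide C,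
            Cmp = (\<lambda>g f. Cmp C f g)\<rparr>"

definition full_sub :: "('o, 'a) cat \<Rightarrow> ('o \<Rightarrow> bool) \<Rightarrow> ('o, 'a) cat" where
  "full_sub C P = C\<lparr>Obj := {x \<in> Obj C. P x}, Arr := {f \<in> Arr C. P (Dom C f) \<and> P (Cod C f)}\<rparr>"

definition isomorphic :: "('o, 'a) cat \<Rightarrow> 'o \<Rightarrow> 'o \<Rightarrow> bool" where
  "isomorphic C x y \<longleftrightarrow>
     (\<exists>f \<in> Hom C x y. \<exists>g \<in> Hom C y x. Cmp C g f = Ide C x \<and> Cmp C f g = Ide C y)"

definition is_mono :: "('o, 'a) cat \<Rightarrow> 'a \<Rightarrow> bool" where
  "is_mono C f \<longleftrightarrow> f \<in> Arr C \<and>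
     (\<forall>w. \<forall>g \<in> Hom C w (Dom C f). \<forall>h \<in> Hom C w (Dom C f). Cmp C f g = Cmp C f h \<longrightarrow> g = h)"

definition is_initial :: "('o, 'a) cat \<Rightarrow> 'o \<Rightarrow> bool" where
  "is_initial C x \<longleftrightarrow> x \<in> Obj C \<and> (\<forall>y \<in> Obj C. \<exists>!f. f \<in> Hom C x y)"

record ('o, 'a, 'p, 'b) func =
  fob :: "'o \<Rightarrow> 'p"
  far :: "'a \<Rightarrow> 'b"

text \<open>Functors and transformations are extensional (undefined off the source category), so that
  equality of records is equality of functors.\<close>

definition is_functor ::
  "('o, 'a) cat \<Rightarrow> ('p, 'b) cat \<Rightarrow> ('o, 'a, 'p, 'b) func \<Rightarrow> bool" where
  "is_functor C D F \<longleftrightarrow>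
     fob F \<in> Obj C \<rightarrow>\<^sub>E Obj D \<and> far F \<in> extensional (Arr C) \<and>
     (\<forall>f \<in> Arr C. far F f \<in> Hom D (fob F (Dom C f)) (fob F (Cod C f))) \<and>
     (\<forall>x \<in> Obj C. far F (Ide C x) = Ide D (fob F x)) \<and>
     (\<forall>f \<in> Arr C. \<forall>g \<in> Arr C. Cod C f = Dom C g \<longrightarrow>
        far F (Cmp C g f) = Cmp D (far F g) (far F f))"

record ('o, 'a, 'p, 'b) ntr =
  nsrc :: "('o, 'a, 'p, 'b) func"
  ntgt :: "('o, 'a, 'p, 'b) func"
  ncmp :: "'o \<Rightarrow> 'b"

definition is_ntr ::
  "('o, 'a) cat \<Rightarrow> ('p, 'b) cat \<Rightarrow> ('o, 'a, 'p, 'b) ntr \<Rightarrow> bool" where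
  "is_ntr C D t \<longleftrightarrow>
     is_functor C D (nsrc t) \<and> is_functor C D (ntgt t) \<and> ncmp t \<in> extensional (Obj C) \<and>
     (\<forall>x \<in> Obj C. ncmp t x \<in> Hom D (fob (nsrc t) x) (fob (ntgt t) x)) \<and>
     (\<forall>f \<in> Arr C. Cmp D (far (ntgt t) f) (ncmp t (Dom C f))
                 = Cmp D (ncmp t (Cod C f)) (far (nsrc t) f))"

definition fun_cat :: "('o, 'a) cat \<Rightarrow> ('p, 'b) cat \<Rightarrow>
    (('o, 'a, 'p, 'b) func, ('o, 'a, 'p, 'b) ntr) cat" where
  "fun_cat C D = \<lparr>Obj = {F. is_functor C D F}, Arr = {t. is_ntr C D t}, Dom = nsrc, Cod = ntgt,
     Ide = (\<lambda>F. \<lparr>nsrc = F, ntgt = F, ncmp = (\<lambda>x \<in> Obj C. Ide D (fob F x))\<rparr>),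
     Cmp = (\<lambda>u t. \<lparr>nsrc = nsrc t, ntgt = ntgt u,
                   ncmp = (\<lambda>x \<in> Obj C. Cmp D (ncmp u x) (ncmp t x))\<rparr>)\<rparr>"

definition fid :: "('o, 'a) cat \<Rightarrow> ('o, 'a, 'o, 'a) func" where
  "fid C = \<lparr>fob = (\<lambda>x \<in> Obj C. x), far = (\<lambda>f \<in> Arr C. f)\<rparr>"

text \<open>\<open>fcomp C G F\<close> is \<open>G\<close> after \<open>F\<close>, for \<open>F\<close> with source \<open>C\<close>; \<open>whisk_post\<close> is the
  transformation \<open>G t\<close> and \<open>whisk_pre\<close> the transformation \<open>t F\<close>.\<close>

definition fcomp :: "('o, 'a) cat \<Rightarrow> ('p, 'b, 'q, 'c) func \<Rightarrow> ('o, 'a, 'p, 'b) func \<Rightarrow>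
    ('o, 'a, 'q, 'c) func" where
  "fcomp C G F = \<lparr>fob = (\<lambda>x \<in> Obj C. fob G (fob F x)), far = (\<lambda>f \<in> Arr C. far G (far F f))\<rparr>"

definition whisk_post :: "('o, 'a) cat \<Rightarrow> ('p, 'b, 'q, 'c) func \<Rightarrow> ('o, 'a, 'p, 'b) ntr \<Rightarrow>
    ('o, 'a, 'q, 'c) ntr" where
  "whisk_post C G t = \<lparr>nsrc = fcomp C G (nsrc t), ntgt = fcomp C G (ntgt t),
     ncmp = (\<lambda>x \<in> Obj C. far G (ncmp t x))\<rparr>"

definition whisk_pre :: "('o, 'a) cat \<Rightarrow> ('p, 'b, 'q, 'c) ntr \<Rightarrow> ('o, 'a, 'p, 'b) func \<Rightarrow>
    ('o, 'a, 'q, 'c) ntr" where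
  "whisk_pre C t F = \<lparr>nsrc = fcomp C (nsrc t) F, ntgt = fcomp C (ntgt t) F,
     ncmp = (\<lambda>x \<in> Obj C. ncmp t (fob F x))\<rparr>"

definition const_ob :: "('o, 'a) cat \<Rightarrow> ('p, 'b) cat \<Rightarrow> 'p \<Rightarrow> ('o, 'a, 'p, 'b) func" where
  "const_ob C D d = \<lparr>fob = (\<lambda>x \<in> Obj C. d), far = (\<lambda>f \<in> Arr C. Ide D d)\<rparr>"

definition const_ar :: "('o, 'a) cat \<Rightarrow> ('p, 'b) cat \<Rightarrow> 'b \<Rightarrow> ('o, 'a, 'p, 'b) ntr" where
  "const_ar C D g = \<lparr>nsrc = const_ob C D (Dom D g), ntgt = const_ob C D (Cod D g),
     ncmp = (\<lambda>x \<in> Obj C. g)\<rparr>"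

definition diag :: "('o, 'a) cat \<Rightarrow> ('p, 'b) cat \<Rightarrow>
    ('p, 'b, ('o, 'a, 'p, 'b) func, ('o, 'a, 'p, 'b) ntr) func" where
  "diag C D = \<lparr>fob = (\<lambda>d \<in> Obj D. const_ob C D d), far = (\<lambda>g \<in> Arr D. const_ar C D g)\<rparr>"

definition is_cat_equivalence ::
  "('o, 'a) cat \<Rightarrow> ('p, 'b) cat \<Rightarrow> ('o, 'a, 'p, 'b) func \<Rightarrow> bool" where
  "is_cat_equivalence C D F \<longleftrightarrow> is_functor C D F \<and>
     (\<exists>G. is_functor D C G \<and>
        isomorphic (fun_cat C C) (fcomp C G F) (fid C) \<and>
        isomorphic (fun_cat D D) (fcomp D F G) (fid D))"

text \<open>A diagram in \<open>C\<close> is given by a set \<open>N\<close> of nodes, objects \<open>X i\<close> for \<open>i \<in> N\<close>, and a set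
  \<open>E\<close> of edges \<open>(i, a, j)\<close> with \<open>a\<close> an arrow from \<open>X i\<close> to \<open>X j\<close>.\<close>

definition is_cone :: "('o, 'a) cat \<Rightarrow> 'i set \<Rightarrow> ('i \<Rightarrow> 'o) \<Rightarrow> ('i \<times> 'a \<times> 'i) set \<Rightarrow>
    'o \<Rightarrow> ('i \<Rightarrow> 'a) \<Rightarrow> bool" where
  "is_cone C N X E l p \<longleftrightarrow> l \<in> Obj C \<and> (\<forall>i \<in> N. p i \<in> Hom C l (X i)) \<and>
     (\<forall>(i, a, j) \<in> E. Cmp C a (p i) = p j)"

definition is_limit :: "('o, 'a) cat \<Rightarrow> 'i set \<Rightarrow> ('i \<Rightarrow> 'o) \<Rightarrow> ('i \<times> 'a \<times> 'i) set \<Rightarrow>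
    'o \<Rightarrow> ('i \<Rightarrow> 'a) \<Rightarrow> bool" where
  "is_limit C N X E l p \<longleftrightarrow> is_cone C N X E l p \<and>
     (\<forall>w q. is_cone C N X E w q \<longrightarrow>
        (\<exists>!h. h \<in> Hom C w l \<and> (\<forall>i \<in> N. Cmp C (p i) h = q i)))"

definition is_cocone :: "('o, 'a) cat \<Rightarrow> 'i set \<Rightarrow> ('i \<Rightarrow> 'o) \<Rightarrow> ('i \<times> 'a \<times> 'i) set \<Rightarrow>
    'o \<Rightarrow> ('i \<Rightarrow> 'a) \<Rightarrow> bool" where
  "is_cocone C N X E l p \<longleftrightarrow> l \<in> Obj C \<and> (\<forall>i \<in> N. p i \<in> Hom C (X i) l) \<and>
     (\<forall>(i, a, j) \<in> E. Cmp C (p j) a = p i)"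

definition is_colimit :: "('o, 'a) cat \<Rightarrow> 'i set \<Rightarrow> ('i \<Rightarrow> 'o) \<Rightarrow> ('i \<times> 'a \<times> 'i) set \<Rightarrow>
    'o \<Rightarrow> ('i \<Rightarrow> 'a) \<Rightarrow> bool" where
  "is_colimit C N X E l p \<longleftrightarrow> is_cocone C N X E l p \<and>
     (\<forall>w q. is_cocone C N X E w q \<longrightarrow>
        (\<exists>!h. h \<in> Hom C l w \<and> (\<forall>i \<in> N. Cmp C h (p i) = q i)))"

text \<open>The arrow from \<open>x\<close> to a limit of the diagram with components \<open>q\<close> belongs to \<open>S\<close>
  (independent of the chosen limit when \<open>S\<close> is closed under composition with isomorphisms).\<close>

definition to_limit_in :: "('o, 'a) cat \<Rightarrow> 'i set \<Rightarrow> ('i \<Rightarrow> 'o) \<Rightarrow> ('i \<times> 'a \<times> 'i) set \<Rightarrow>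
    'o \<Rightarrow> ('i \<Rightarrow> 'a) \<Rightarrow> 'a set \<Rightarrow> bool" where
  "to_limit_in C N X E x q S \<longleftrightarrow>
     (\<exists>l p h. is_limit C N X E l p \<and> h \<in> Hom C x l \<and> (\<forall>i \<in> N. Cmp C (p i) h = q i) \<and> h \<in> S)"

definition prod_cone :: "('o, 'a) cat \<Rightarrow> 'o \<Rightarrow> 'o \<Rightarrow> 'o \<times> (bool \<Rightarrow> 'a)" where
  "prod_cone C x y = (SOME (l, p). is_limit C UNIV (\<lambda>i. if i then y else x) {} l p)"

definition prod_ob :: "('o, 'a) cat \<Rightarrow> 'o \<Rightarrow> 'o \<Rightarrow> 'o" where
  "prod_ob C x y = fst (prod_cone C x y)"

definition prod_ar :: "('o, 'a) cat \<Rightarrow> 'a \<Rightarrow> 'a \<Rightarrow> 'a" where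
  "prod_ar C f g = (THE h.
     h \<in> Hom C (prod_ob C (Dom C f) (Dom C g)) (prod_ob C (Cod C f) (Cod C g)) \<and>
     Cmp C (snd (prod_cone C (Cod C f) (Cod C g)) False) h
       = Cmp C f (snd (prod_cone C (Dom C f) (Dom C g)) False) \<and>
     Cmp C (snd (prod_cone C (Cod C f) (Cod C g)) True) h
       = Cmp C g (snd (prod_cone C (Dom C f) (Dom C g)) True))"

text \<open>\<open>is_pushout C f g P u v\<close>: \<open>P\<close> with \<open>u\<close> (opposite \<open>g\<close>) and \<open>v\<close> (opposite \<open>f\<close>) is a
  pushout of the span \<open>(f, g)\<close>.\<close>

definition is_pushout :: "('o, 'a) cat \<Rightarrow> 'a \<Rightarrow> 'a \<Rightarrow> 'o \<Rightarrow> 'a \<Rightarrow> 'a \<Rightarrow> bool" where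
  "is_pushout C f g P u v \<longleftrightarrow>
     f \<in> Arr C \<and> g \<in> Arr C \<and> Dom C f = Dom C g \<and> P \<in> Obj C \<and>
     u \<in> Hom C (Cod C f) P \<and> v \<in> Hom C (Cod C g) P \<and> Cmp C u f = Cmp C v g \<and>
     (\<forall>Q. \<forall>u' \<in> Hom C (Cod C f) Q. \<forall>v' \<in> Hom C (Cod C g) Q. Cmp C u' f = Cmp C v' g \<longrightarrow>
        (\<exists>!h. h \<in> Hom C P Q \<and> Cmp C h u = u' \<and> Cmp C h v = v'))"


section \<open>Small sets\<close>

text \<open>The universe of small sets: the type \<open>'u\<close> is assumed to have (strongly) inaccessible
  cardinality, and a set is small if it has fewer elements than \<open>'u\<close>. Up to bijection, the
  small subsets of \<open>'u\<close> are then the sets of a Grothendieck universe.\<close>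

definition inaccessible :: "'u itself \<Rightarrow> bool" where
  "inaccessible _ \<longleftrightarrow>
     (natLeq, card_of (UNIV :: 'u set)) \<in> ordLess \<and>
     regularCard (card_of (UNIV :: 'u set)) \<and>
     (\<forall>A :: 'u set. (card_of A, card_of (UNIV :: 'u set)) \<in> ordLess \<longrightarrow>
        (card_of (Pow A), card_of (UNIV :: 'u set)) \<in> ordLess)"

definition small :: "'u set \<Rightarrow> bool" where
  "small A \<longleftrightarrow> (card_of A, card_of (UNIV :: 'u set)) \<in> ordLess"

record 'u sar =
  sdom :: "'u set"
  scod :: "'u set"
  sfun :: "'u \<Rightarrow> 'u"

definition SetC :: "('u set, 'u sar) cat" where
  "SetC = \<lparr>Obj = {A. small A},
     Arr = {f. small (sdom f) \<and> small (scod f) \<and> sfun f \<in> sdom f \<rightarrow>\<^sub>E scod f},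
     Dom = sdom, Cod = scod, Ide = (\<lambda>A. \<lparr>sdom = A, scod = A, sfun = (\<lambda>x \<in> A. x)\<rparr>),
     Cmp = (\<lambda>g f. \<lparr>sdom = sdom f, scod = scod g, sfun = compose (sdom f) (sfun g) (sfun f)\<rparr>)\<rparr>"

text \<open>Sets of arrows, pairs, etc. are moved into \<open>'u\<close> along a chosen injection. \<open>setfun C S act\<close>
  is the functor \<open>c \<mapsto> S c\<close> to sets with action \<open>act\<close>, and \<open>setnat\<close> the transformation between
  two such; \<open>bifun\<close>, \<open>binat\<close> are their two-variable versions, with values in \<open>fun_cat D SetC\<close>.\<close>

definition enc :: "'x set \<Rightarrow> 'x \<Rightarrow> 'u" where
  "enc S = (SOME e. inj_on e S)"

definition cset :: "'x set \<Rightarrow> 'u set" where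
  "cset S = enc S ` S"

definition carr :: "'x set \<Rightarrow> 'y set \<Rightarrow> ('x \<Rightarrow> 'y) \<Rightarrow> 'u sar" where
  "carr S T f = \<lparr>sdom = cset S, scod = cset T,
     sfun = (\<lambda>u \<in> cset S. enc T (f (inv_into S (enc S) u)))\<rparr>"

definition setfun :: "('o, 'a) cat \<Rightarrow> ('o \<Rightarrow> 'x set) \<Rightarrow> ('a \<Rightarrow> 'x \<Rightarrow> 'x) \<Rightarrow>
    ('o, 'a, 'u set, 'u sar) func" where
  "setfun C S act = \<lparr>fob = (\<lambda>c \<in> Obj C. cset (S c)),
     far = (\<lambda>a \<in> Arr C. carr (S (Dom C a)) (S (Cod C a)) (act a))\<rparr>"

definition setnat :: "('o, 'a) cat \<Rightarrow> ('o \<Rightarrow> 'x set) \<Rightarrow> ('a \<Rightarrow> 'x \<Rightarrow> 'x) \<Rightarrow>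
    ('o \<Rightarrow> 'y set) \<Rightarrow> ('a \<Rightarrow> 'y \<Rightarrow> 'y) \<Rightarrow> ('o \<Rightarrow> 'x \<Rightarrow> 'y) \<Rightarrow> ('o, 'a, 'u set, 'u sar) ntr" where
  "setnat C S actS T actT \<phi> = \<lparr>nsrc = setfun C S actS, ntgt = setfun C T actT,
     ncmp = (\<lambda>c \<in> Obj C. carr (S c) (T c) (\<phi> c))\<rparr>"

definition bifun :: "('o, 'a) cat \<Rightarrow> ('p, 'b) cat \<Rightarrow> ('o \<Rightarrow> 'p \<Rightarrow> 'x set) \<Rightarrow>
    ('a \<Rightarrow> 'p \<Rightarrow> 'x \<Rightarrow> 'x) \<Rightarrow> ('o \<Rightarrow> 'b \<Rightarrow> 'x \<Rightarrow> 'x) \<Rightarrow>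
    ('o, 'a, ('p, 'b, 'u set, 'u sar) func, ('p, 'b, 'u set, 'u sar) ntr) func" where
  "bifun C D S act1 act2 = \<lparr>fob = (\<lambda>c \<in> Obj C. setfun D (S c) (act2 c)),
     far = (\<lambda>a \<in> Arr C. setnat D (S (Dom C a)) (act2 (Dom C a))
                              (S (Cod C a)) (act2 (Cod C a)) (act1 a))\<rparr>"

definition binat :: "('o, 'a) cat \<Rightarrow> ('p, 'b) cat \<Rightarrow>
    ('o \<Rightarrow> 'p \<Rightarrow> 'x set) \<Rightarrow> ('a \<Rightarrow> 'p \<Rightarrow> 'x \<Rightarrow> 'x) \<Rightarrow> ('o \<Rightarrow> 'b \<Rightarrow> 'x \<Rightarrow> 'x) \<Rightarrow>
    ('o \<Rightarrow> 'p \<Rightarrow> 'y set) \<Rightarrow> ('a \<Rightarrow> 'p \<Rightarrow> 'y \<Rightarrow> 'y) \<Rightarrow> ('o \<Rightarrow> 'b \<Rightarrow> 'y \<Rightarrow> 'y) \<Rightarrow>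
    ('o \<Rightarrow> 'p \<Rightarrow> 'x \<Rightarrow> 'y) \<Rightarrow>
    ('o, 'a, ('p, 'b, 'u set, 'u sar) func, ('p, 'b, 'u set, 'u sar) ntr) ntr" where
  "binat C D S act1 act2 T bct1 bct2 \<phi> =
     \<lparr>nsrc = bifun C D S act1 act2, ntgt = bifun C D T bct1 bct2,
      ncmp = (\<lambda>c \<in> Obj C. setnat D (S c) (act2 c) (T c) (bct2 c) (\<phi> c))\<rparr>"

definition yo_ob :: "('o, 'a) cat \<Rightarrow> 'o \<Rightarrow> ('o, 'a, 'u set, 'u sar) func" where
  "yo_ob C c = setfun (opp C) (\<lambda>x. Hom C x c) (\<lambda>b a. Cmp C a b)"

definition yo :: "('o, 'a) cat \<Rightarrow>
    ('o, 'a, ('o, 'a, 'u set, 'u sar) func, ('o, 'a, 'u set, 'u sar) ntr) func" where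
  "yo C = \<lparr>fob = (\<lambda>c \<in> Obj C. yo_ob C c),
     far = (\<lambda>f \<in> Arr C. setnat (opp C)
        (\<lambda>x. Hom C x (Dom C f)) (\<lambda>b a. Cmp C a b)
        (\<lambda>x. Hom C x (Cod C f)) (\<lambda>b a. Cmp C a b) (\<lambda>x a. Cmp C f a))\<rparr>"

text \<open>The largest proper subpresheaf of the representable at \<open>c\<close>, as a set of arrows into \<open>c\<close>:
  the union of all proper sieves on \<open>c\<close>.\<close>

definition bdry :: "('o, 'a) cat \<Rightarrow> 'o \<Rightarrow> 'a set" where
  "bdry C c = \<Union>{S. S \<subset> {a \<in> Arr C. Cod C a = c} \<and>
     (\<forall>a \<in> S. \<forall>b \<in> Arr C. Cod C b = Dom C a \<longrightarrow> Cmp C a b \<in> S)}"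


section \<open>The simplex category and the categories \<open>\<Theta>\<^sub>n\<close>\<close>

text \<open>\<open>DA m q \<delta>\<close> is the monotone map \<open>\<delta>\<close> from \<open>[m] = {0..m}\<close> to \<open>[q]\<close>.\<close>

datatype dar = DA (ddom: nat) (dcod: nat) (dfun: "nat \<Rightarrow> nat")

definition Delta :: "(nat, dar) cat" where
  "Delta = \<lparr>Obj = UNIV,
     Arr = {d. dfun d \<in> {..ddom d} \<rightarrow>\<^sub>E {..dcod d} \<and> mono_on {..ddom d} (dfun d)},
     Dom = ddom, Cod = dcod, Ide = (\<lambda>m. DA m m (\<lambda>i \<in> {..m}. i)),
     Cmp = (\<lambda>e d. DA (ddom d) (dcod e) (compose {..ddom d} (dfun e) (dfun d)))\<rparr>"

text \<open>The map to \<open>[k]\<close> with the given nonempty list of values.\<close>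

definition sq :: "nat \<Rightarrow> nat list \<Rightarrow> dar" where
  "sq k vs = DA (length vs - 1) k (\<lambda>i \<in> {..length vs - 1}. vs ! i)"

text \<open>\<open>Tree [c\<^sub>1, \<dots>, c\<^sub>m]\<close> is the object \<open>[m](c\<^sub>1, \<dots>, c\<^sub>m)\<close>. The object of the terminal category
  \<open>\<Theta>\<^sub>0\<close> is \<open>Tree []\<close> and its arrow is \<open>Pt\<close>. In \<open>TMor \<theta> \<theta>' \<delta> f\<close> the component \<open>f i j\<close> is the
  arrow \<open>f\<^sub>i\<^sub>j\<close>; lists are indexed from \<open>0\<close>, so that \<open>c\<^sub>i\<close> is \<open>sub \<theta> ! (i - 1)\<close>.\<close>

datatype tree = Tree (sub: "tree list")

datatype tmor = Pt | TMor (tsrc: tree) (ttgt: tree) (tdel: dar) (tcmp: "nat \<Rightarrow> nat \<Rightarrow> tmor")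

definition tidx :: "dar \<Rightarrow> (nat \<times> nat) set" where
  "tidx d = {(i, j). 1 \<le> i \<and> i \<le> ddom d \<and> dfun d (i - 1) < j \<and> j \<le> dfun d i}"

definition Theta :: "(tree, tmor) cat \<Rightarrow> (tree, tmor) cat" where
  "Theta C = \<lparr>Obj = {\<theta>. set (sub \<theta>) \<subseteq> Obj C},
     Arr = {TMor \<theta> \<theta>' d f | \<theta> \<theta>' d f.
        set (sub \<theta>) \<subseteq> Obj C \<and> set (sub \<theta>') \<subseteq> Obj C \<and>
        d \<in> Hom Delta (length (sub \<theta>)) (length (sub \<theta>')) \<and>
        (\<forall>i j. if (i, j) \<in> tidx d then f i j \<in> Hom C (sub \<theta> ! (i - 1)) (sub \<theta>' ! (j - 1))
               else f i j = undefined)},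
     Dom = tsrc, Cod = ttgt,
     Ide = (\<lambda>\<theta>. TMor \<theta> \<theta> (Ide Delta (length (sub \<theta>)))
        (\<lambda>i j. if (i, j) \<in> tidx (Ide Delta (length (sub \<theta>))) then Ide C (sub \<theta> ! (i - 1))
               else undefined)),
     Cmp = (\<lambda>g f. TMor (tsrc f) (ttgt g) (Cmp Delta (tdel g) (tdel f))
        (\<lambda>i k. if (i, k) \<in> tidx (Cmp Delta (tdel g) (tdel f))
               then (let j = (THE j. (i, j) \<in> tidx (tdel f) \<and> (j, k) \<in> tidx (tdel g))
                     in Cmp C (tcmp g j k) (tcmp f i j))
               else undefined))\<rparr>"

primrec theta :: "nat \<Rightarrow> (tree, tmor) cat" where
  "theta 0 = \<lparr>Obj = {Tree []}, Arr = {Pt}, Dom = (\<lambda>_. Tree []), Cod = (\<lambda>_. Tree []),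
              Ide = (\<lambda>_. Pt), Cmp = (\<lambda>_ _. Pt)\<rparr>"
| "theta (Suc n) = Theta (theta n)"

text \<open>The functor \<open>T\<close> from \<open>\<Delta>\<close> to \<open>\<Theta>\<^sub>n\<close>, \<open>[q] \<mapsto> [q]([0], \<dots>, [0])\<close>, for \<open>n \<ge> 1\<close>. Since
  \<open>Tree []\<close> is both the object of \<open>\<Theta>\<^sub>0\<close> and \<open>[0]\<close> in \<open>\<Theta>\<^sub>n\<close> for \<open>n \<ge> 1\<close>, this formula also
  covers the canonical identification of \<open>\<Delta>\<close> with \<open>\<Theta>\<^sub>1\<close>.\<close>

definition Tfun :: "nat \<Rightarrow> (nat, dar, tree, tmor) func" where
  "Tfun n = \<lparr>fob = (\<lambda>q. Tree (replicate q (Tree []))),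
     far = (\<lambda>d \<in> Arr Delta. TMor (Tree (replicate (ddom d) (Tree [])))
        (Tree (replicate (dcod d) (Tree []))) d
        (\<lambda>i j. if (i, j) \<in> tidx d then Ide (theta (n - 1)) (Tree []) else undefined))\<rparr>"


section \<open>Model structures\<close>

text \<open>The three classes of maps of a model structure. \<open>mk_model\<close> is the structure with given weak
  equivalences and cofibrations; the fibrations are then determined by lifting.\<close>

record 'a model =
  WE :: "'a set"
  Cof :: "'a set"
  Fib :: "'a set"

definition rlp :: "('o, 'a) cat \<Rightarrow> 'a set \<Rightarrow> 'a set" where
  "rlp C S = {p \<in> Arr C. \<forall>i \<in> S. \<forall>u \<in> Hom C (Dom C i) (Dom C p). \<forall>v \<in> Hom C (Cod C i) (Cod C p).
     Cmp C p u = Cmp C v i \<longrightarrow>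
     (\<exists>h \<in> Hom C (Cod C i) (Dom C p). Cmp C h i = u \<and> Cmp C p h = v)}"

definition mk_model :: "('o, 'a) cat \<Rightarrow> 'a set \<Rightarrow> 'a set \<Rightarrow> 'a model" where
  "mk_model C W K = \<lparr>WE = W, Cof = K, Fib = rlp C (K \<inter> W)\<rparr>"

definition is_terminal :: "('o, 'a) cat \<Rightarrow> 'o \<Rightarrow> bool" where
  "is_terminal C t \<longleftrightarrow> t \<in> Obj C \<and> (\<forall>x \<in> Obj C. \<exists>!f. f \<in> Hom C x t)"

definition cofibrant :: "('o, 'a) cat \<Rightarrow> 'a model \<Rightarrow> 'o \<Rightarrow> bool" where
  "cofibrant C M x \<longleftrightarrow> x \<in> Obj C \<and> (\<forall>e. is_initial C e \<longrightarrow> Hom C e x \<subseteq> Cof M)"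

definition fibrant :: "('o, 'a) cat \<Rightarrow> 'a model \<Rightarrow> 'o \<Rightarrow> bool" where
  "fibrant C M x \<longleftrightarrow> x \<in> Obj C \<and> (\<forall>t. is_terminal C t \<longrightarrow> Hom C x t \<subseteq> Fib M)"

text \<open>An adjunction, given by its bijections \<open>\<phi> x y\<close> from \<open>Hom(F x, y)\<close> to \<open>Hom(x, G y)\<close>.\<close>

definition is_adjunction :: "('o, 'a) cat \<Rightarrow> ('p, 'b) cat \<Rightarrow> ('o, 'a, 'p, 'b) func \<Rightarrow>
    ('p, 'b, 'o, 'a) func \<Rightarrow> ('o \<Rightarrow> 'p \<Rightarrow> 'b \<Rightarrow> 'a) \<Rightarrow> bool" where
  "is_adjunction C D F G \<phi> \<longleftrightarrow> is_functor C D F \<and> is_functor D C G \<and>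
     (\<forall>x \<in> Obj C. \<forall>y \<in> Obj D. bij_betw (\<phi> x y) (Hom D (fob F x) y) (Hom C x (fob G y))) \<and>
     (\<forall>x \<in> Obj C. \<forall>x' \<in> Obj C. \<forall>y \<in> Obj D. \<forall>y' \<in> Obj D.
        \<forall>u \<in> Hom C x' x. \<forall>g \<in> Hom D (fob F x) y. \<forall>v \<in> Hom D y y'.
        \<phi> x' y' (Cmp D v (Cmp D g (far F u))) = Cmp C (far G v) (Cmp C (\<phi> x y g) u))"

definition is_Quillen_equivalence :: "('o, 'a) cat \<Rightarrow> 'a model \<Rightarrow> ('p, 'b) cat \<Rightarrow> 'b model \<Rightarrow>
    ('o, 'a, 'p, 'b) func \<Rightarrow> ('p, 'b, 'o, 'a) func \<Rightarrow> ('o \<Rightarrow> 'p \<Rightarrow> 'b \<Rightarrow> 'a) \<Rightarrow> bool" where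
  "is_Quillen_equivalence C M D N F G \<phi> \<longleftrightarrow> is_adjunction C D F G \<phi> \<and>
     (\<forall>f \<in> Cof M. far F f \<in> Cof N) \<and>
     (\<forall>f \<in> Cof M \<inter> WE M. far F f \<in> Cof N \<inter> WE N) \<and>
     (\<forall>x y. cofibrant C M x \<longrightarrow> fibrant D N y \<longrightarrow>
        (\<forall>g \<in> Hom D (fob F x) y. g \<in> WE N \<longleftrightarrow> \<phi> x y g \<in> WE M))"

text \<open>\<open>r\<close> is (the well-order of) an ordinal, \<open>X\<close> with \<open>t\<close> a colimit-preserving functor on it,
  with \<open>t i j\<close> in \<open>S\<close> whenever \<open>j\<close> is the successor of \<open>i\<close>.\<close>

definition is_seq :: "('o, 'a) cat \<Rightarrow> 'a set \<Rightarrow> ('i \<times> 'i) set \<Rightarrow> ('i \<Rightarrow> 'o) \<Rightarrow>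
    ('i \<Rightarrow> 'i \<Rightarrow> 'a) \<Rightarrow> bool" where
  "is_seq C S r X t \<longleftrightarrow> Well_order r \<and> Field r \<noteq> {} \<and>
     (\<forall>i \<in> Field r. X i \<in> Obj C \<and> t i i = Ide C (X i)) \<and>
     (\<forall>(i, j) \<in> r. t i j \<in> Hom C (X i) (X j)) \<and>
     (\<forall>i j k. (i, j) \<in> r \<longrightarrow> (j, k) \<in> r \<longrightarrow> Cmp C (t j k) (t i j) = t i k) \<and>
     (\<forall>j \<in> Field r. underS r j \<noteq> {} \<longrightarrow> (\<forall>i \<in> underS r j. \<exists>i' \<in> underS r j. i \<in> underS r i') \<longrightarrow>
        is_colimit C (underS r j) X {(i, t i i', i') | i i'. (i, i') \<in> r \<and> i' \<in> underS r j}
          (X j) (\<lambda>i. t i j)) \<and>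
     (\<forall>i j. i \<in> underS r j \<longrightarrow> (\<nexists>k. i \<in> underS r k \<and> k \<in> underS r j) \<longrightarrow> t i j \<in> S)"

definition transfinite_comps :: "'u itself \<Rightarrow> ('o, 'a) cat \<Rightarrow> 'a set \<Rightarrow> 'a set" where
  "transfinite_comps _ C S = {c i | r X t l c i. is_seq C S (r :: ('u \<times> 'u) set) X t \<and>
     small (Field r) \<and> is_colimit C (Field r) X {(i, t i j, j) | i j. (i, j) \<in> r} l c \<and>
     i \<in> Field r \<and> underS r i = {}}"

definition pushouts_of :: "('o, 'a) cat \<Rightarrow> 'a set \<Rightarrow> 'a set" where
  "pushouts_of C S = {v. \<exists>i \<in> S. \<exists>g P u. is_pushout C i g P u v}"

definition retracts_of :: "('o, 'a) cat \<Rightarrow> 'a set \<Rightarrow> 'a set" where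
  "retracts_of C S = {f \<in> Arr C. \<exists>g \<in> S. g \<in> Arr C \<and>
     (\<exists>i \<in> Hom C (Dom C f) (Dom C g). \<exists>r \<in> Hom C (Dom C g) (Dom C f).
      \<exists>i' \<in> Hom C (Cod C f) (Cod C g). \<exists>r' \<in> Hom C (Cod C g) (Cod C f).
        Cmp C r i = Ide C (Dom C f) \<and> Cmp C r' i' = Ide C (Cod C f) \<and>
        Cmp C g i = Cmp C i' f \<and> Cmp C f r = Cmp C r' g)}"


section \<open>Simplicial sets\<close>

type_synonym 'u sset = "(nat, dar, 'u set, 'u sar) func"
type_synonym 'u ssmap = "(nat, dar, 'u set, 'u sar) ntr"

definition SSets :: "('u sset, 'u ssmap) cat" where
  "SSets = fun_cat (opp Delta) SetC"

definition horn :: "nat \<Rightarrow> nat \<Rightarrow> 'u ssmap" where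
  "horn m k = setnat (opp Delta)
     (\<lambda>j. {a \<in> Hom Delta j m. \<not> {..m} - {k} \<subseteq> dfun a ` {..j}}) (\<lambda>b a. Cmp Delta a b)
     (\<lambda>j. Hom Delta j m) (\<lambda>b a. Cmp Delta a b) (\<lambda>j a. a)"

definition Kan :: "'u sset \<Rightarrow> bool" where
  "Kan K \<longleftrightarrow> K \<in> Obj SSets \<and> (\<forall>m \<ge> 1. \<forall>k \<le> m. \<forall>g \<in> Hom SSets (nsrc (horn m k)) K.
     \<exists>h \<in> Hom SSets (yo_ob Delta m) K. Cmp SSets h (horn m k) = g)"

definition pi0_rel :: "'u sset \<Rightarrow> ('u \<times> 'u) set" where
  "pi0_rel P = (let e = {(sfun (far P (sq 1 [0])) s, sfun (far P (sq 1 [1])) s) | s. s \<in> fob P 1}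
     in (e \<union> e\<inverse>)\<^sup>* \<inter> fob P 0 \<times> fob P 0)"

definition pi0_bij :: "'u ssmap \<Rightarrow> bool" where
  "pi0_bij f \<longleftrightarrow> bij_betw (\<lambda>c. pi0_rel (ntgt f) `` (sfun (ncmp f 0) ` c))
     (fob (nsrc f) 0 // pi0_rel (nsrc f)) (fob (ntgt f) 0 // pi0_rel (ntgt f))"

text \<open>Simplicial mapping spaces \<open>Map(A, Z)\<^sub>m = Hom(A \<times> \<kappa>[m], Z)\<close> in a category \<open>C\<close> with a
  cosimplicial object \<open>\<kappa>\<close>; below \<open>\<kappa>[m]\<close> is always the constant diagram at \<open>\<Delta>[m]\<close>.
  \<open>Map_pre C \<kappa> f Z\<close> is the map from \<open>Map(B, Z)\<close> to \<open>Map(A, Z)\<close> induced by \<open>f\<close> from \<open>A\<close> to \<open>B\<close>.\<close>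

definition Map_S :: "('o, 'a) cat \<Rightarrow> (nat, dar, 'o, 'a) func \<Rightarrow> 'o \<Rightarrow> 'o \<Rightarrow> nat \<Rightarrow> 'a set" where
  "Map_S C \<kappa> A Z m = Hom C (prod_ob C A (fob \<kappa> m)) Z"

definition Map_act :: "('o, 'a) cat \<Rightarrow> (nat, dar, 'o, 'a) func \<Rightarrow> 'o \<Rightarrow> dar \<Rightarrow> 'a \<Rightarrow> 'a" where
  "Map_act C \<kappa> A \<alpha> g = Cmp C g (prod_ar C (Ide C A) (far \<kappa> \<alpha>))"

definition Map_pre :: "('o, 'a) cat \<Rightarrow> (nat, dar, 'o, 'a) func \<Rightarrow> 'a \<Rightarrow> 'o \<Rightarrow> 'u ssmap" where
  "Map_pre C \<kappa> f Z = setnat (opp Delta)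
     (Map_S C \<kappa> (Cod C f) Z) (Map_act C \<kappa> (Cod C f))
     (Map_S C \<kappa> (Dom C f) Z) (Map_act C \<kappa> (Dom C f))
     (\<lambda>m g. Cmp C g (prod_ar C f (Ide C (fob \<kappa> m))))"

text \<open>Weak homotopy equivalences: maps inducing a bijection on \<open>\<pi>\<^sub>0 Map(\<hyphen>, K)\<close> for every Kan
  complex \<open>K\<close>.\<close>

definition sset_we :: "'u ssmap set" where
  "sset_we = {f \<in> Arr SSets. \<forall>K. Kan K \<longrightarrow> pi0_bij (Map_pre SSets (yo Delta) f K :: 'u ssmap)}"

text \<open>Weak equivalences of the left Bousfield localization (of a simplicial model structure in
  which every object is cofibrant) whose fibrant objects are those in \<open>P\<close>, and the left Bousfield
  localization at a class \<open>T\<close> of maps.\<close>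

definition local_equivs :: "('o, 'a) cat \<Rightarrow> (nat, dar, 'o, 'a) func \<Rightarrow> 'u itself \<Rightarrow> 'o set \<Rightarrow>
    'a set" where
  "local_equivs C \<kappa> _ P =
     {f \<in> Arr C. \<forall>Z \<in> P. (Map_pre C \<kappa> f Z :: 'u ssmap) \<in> sset_we}"

definition local_objs :: "('o, 'a) cat \<Rightarrow> (nat, dar, 'o, 'a) func \<Rightarrow> 'u itself \<Rightarrow> 'a model \<Rightarrow>
    'a set \<Rightarrow> 'o set" where
  "local_objs C \<kappa> _ M T =
     {Z. fibrant C M Z \<and> (\<forall>f \<in> T. (Map_pre C \<kappa> f Z :: 'u ssmap) \<in> sset_we)}"

definition Bousfield :: "('o, 'a) cat \<Rightarrow> (nat, dar, 'o, 'a) func \<Rightarrow> 'u itself \<Rightarrow> 'a model \<Rightarrow>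
    'a set \<Rightarrow> 'a model" where
  "Bousfield C \<kappa> U M T = mk_model C (local_equivs C \<kappa> U (local_objs C \<kappa> U M T)) (Cof M)"


section \<open>The model category \<open>\<Theta>\<^sub>nSp\<close>\<close>

type_synonym 'u tsp = "(tree, tmor, 'u sset, 'u ssmap) func"
type_synonym 'u tspmap = "(tree, tmor, 'u sset, 'u ssmap) ntr"

definition ThetaSp :: "nat \<Rightarrow> ('u tsp, 'u tspmap) cat" where
  "ThetaSp n = fun_cat (opp (theta n)) SSets"

definition injective_model :: "nat \<Rightarrow> 'u tspmap model" where
  "injective_model n = mk_model (ThetaSp n)
     {f \<in> Arr (ThetaSp n). \<forall>\<theta> \<in> Obj (theta n). ncmp f \<theta> \<in> sset_we}
     {f. is_mono (ThetaSp n) f}"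

definition kappa :: "nat \<Rightarrow> (nat, dar, 'u tsp, 'u tspmap) func" where
  "kappa n = fcomp Delta (diag (opp (theta n)) SSets) (yo Delta)"

text \<open>Sets as discrete objects.\<close>

definition disc :: "nat \<Rightarrow> ('u set, 'u sar, 'u tsp, 'u tspmap) func" where
  "disc n = fcomp SetC (diag (opp (theta n)) SSets) (diag (opp Delta) SetC)"

definition rep :: "nat \<Rightarrow> (tree, tmor, 'u tsp, 'u tspmap) func" where
  "rep n = \<lparr>fob = (\<lambda>\<theta> \<in> Obj (theta n).
              fcomp (opp (theta n)) (diag (opp Delta) SetC) (fob (yo (theta n)) \<theta>)),
     far = (\<lambda>f \<in> Arr (theta n).
              whisk_post (opp (theta n)) (diag (opp Delta) SetC) (far (yo (theta n)) f))\<rparr>"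

text \<open>For \<open>n \<ge> 1\<close>: the arrow of \<open>\<Theta>\<^sub>n\<close> from \<open>[0]\<close> to \<open>\<theta>\<close> at the vertex \<open>v\<close>, and the one from
  \<open>[1](c\<^sub>i)\<close> to \<open>\<theta> = [m](c\<^sub>1, \<dots>, c\<^sub>m)\<close> with \<open>0 \<mapsto> i - 1\<close>, \<open>1 \<mapsto> i\<close>.\<close>

definition tvert :: "tree \<Rightarrow> nat \<Rightarrow> tmor" where
  "tvert \<theta> v = TMor (Tree []) \<theta> (sq (length (sub \<theta>)) [v]) (\<lambda>_ _. undefined)"

definition tedge :: "nat \<Rightarrow> tree \<Rightarrow> nat \<Rightarrow> tmor" where
  "tedge n \<theta> i = TMor (Tree [sub \<theta> ! (i - 1)]) \<theta> (sq (length (sub \<theta>)) [i - 1, i])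
     (\<lambda>k j. if k = 1 \<and> j = i then Ide (theta (n - 1)) (sub \<theta> ! (i - 1)) else undefined)"

text \<open>\<open>G[m](c\<^sub>1, \<dots>, c\<^sub>m)\<close> is the colimit of the diagram with nodes \<open>Inl i\<close> for \<open>\<Theta>[1](c\<^sub>i)\<close> and
  \<open>Inr i\<close> for the copy of \<open>\<Theta>[0]\<close> between \<open>\<Theta>[1](c\<^sub>i)\<close> and \<open>\<Theta>[1](c\<^sub>i\<^sub>+\<^sub>1)\<close>.\<close>

definition is_G :: "nat \<Rightarrow> tree \<Rightarrow> 'u tsp \<Rightarrow> (nat + nat \<Rightarrow> 'u tspmap) \<Rightarrow> bool" where
  "is_G n \<theta> G \<iota> \<longleftrightarrow> (let m = length (sub \<theta>); c = (\<lambda>i. Tree [sub \<theta> ! (i - 1)]) in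
     is_colimit (ThetaSp n) (Inl ` {1..m} \<union> Inr ` {1..<m})
       (\<lambda>s. case s of Inl i \<Rightarrow> fob (rep n) (c i) | Inr i \<Rightarrow> fob (rep n) (Tree []))
       ({(Inr i, far (rep n) (tvert (c i) 1), Inl i) | i. i \<in> {1..<m}} \<union>
        {(Inr i, far (rep n) (tvert (c (i + 1)) 0), Inl (i + 1)) | i. i \<in> {1..<m}}) G \<iota>)"

definition Se :: "nat \<Rightarrow> 'u tspmap set" where
  "Se n = {f. \<exists>\<theta> \<in> Obj (theta n). length (sub \<theta>) \<ge> 2 \<and> (\<exists>G \<iota>. is_G n \<theta> G \<iota> \<and>
     f \<in> Hom (ThetaSp n) G (fob (rep n) \<theta>) \<and>
     (\<forall>i \<in> {1..length (sub \<theta>)}. Cmp (ThetaSp n) f (\<iota> (Inl i)) = far (rep n) (tedge n \<theta> i)))}"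

text \<open>Nerves: \<open>ordc k\<close> is \<open>[k]\<close> as a category.\<close>

definition ordc :: "nat \<Rightarrow> (nat, nat \<times> nat) cat" where
  "ordc k = \<lparr>Obj = {..k}, Arr = {(i, j). i \<le> j \<and> j \<le> k}, Dom = fst, Cod = snd,
     Ide = (\<lambda>i. (i, i)), Cmp = (\<lambda>g f. (fst f, snd g))\<rparr>"

definition ordf :: "dar \<Rightarrow> (nat, nat \<times> nat, nat, nat \<times> nat) func" where
  "ordf d = \<lparr>fob = (\<lambda>i \<in> Obj (ordc (ddom d)). dfun d i),
     far = (\<lambda>(i, j) \<in> Arr (ordc (ddom d)). (dfun d i, dfun d j))\<rparr>"

definition nerve :: "('o, 'a) cat \<Rightarrow> 'u sset" where
  "nerve C = setfun (opp Delta) (\<lambda>k. {F. is_functor (ordc k) C F})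
     (\<lambda>d F. fcomp (ordc (ddom d)) F (ordf d))"

definition free_iso :: "(bool, bool \<times> bool) cat" where
  "free_iso = \<lparr>Obj = UNIV, Arr = UNIV, Dom = fst, Cod = snd, Ide = (\<lambda>i. (i, i)),
     Cmp = (\<lambda>g f. (fst f, snd g))\<rparr>"

text \<open>Simplicial spaces; \<open>lev_disc\<close> regards a simplicial set as a levelwise discrete one.\<close>

type_synonym 'u sspace = "(nat, dar, 'u sset, 'u ssmap) func"
type_synonym 'u sspmap = "(nat, dar, 'u sset, 'u ssmap) ntr"

definition SSpaces :: "('u sspace, 'u sspmap) cat" where
  "SSpaces = fun_cat (opp Delta) SSets"

definition lev_disc :: "'u sset \<Rightarrow> 'u sspace" where
  "lev_disc K = fcomp (opp Delta) (diag (opp Delta) SetC) K"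

text \<open>\<open>B\<close> with unit \<open>u\<close> is a value at \<open>A\<close> of the left adjoint of restriction along \<open>T\<close>.\<close>

definition is_Tsharp :: "nat \<Rightarrow> 'u sspace \<Rightarrow> 'u tsp \<Rightarrow> 'u sspmap \<Rightarrow> bool" where
  "is_Tsharp n A B u \<longleftrightarrow> B \<in> Obj (ThetaSp n) \<and>
     u \<in> Hom SSpaces A (fcomp (opp Delta) B (Tfun n)) \<and>
     (\<forall>B' \<in> Obj (ThetaSp n). \<forall>v \<in> Hom SSpaces A (fcomp (opp Delta) B' (Tfun n)).
        \<exists>!h. h \<in> Hom (ThetaSp n) B B' \<and> Cmp SSpaces (whisk_pre (opp Delta) h (Tfun n)) u = v)"

definition Cpt :: "nat \<Rightarrow> 'u tspmap set" where
  "Cpt n = {h. \<exists>B u B' u'. is_Tsharp n (lev_disc (nerve free_iso)) B u \<and>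
     is_Tsharp n (lev_disc (yo_ob Delta 0)) B' u' \<and> h \<in> Hom (ThetaSp n) B B' \<and>
     (\<exists>e \<in> Hom SSpaces (lev_disc (nerve free_iso)) (lev_disc (yo_ob Delta 0)).
        Cmp SSpaces (whisk_pre (opp Delta) h (Tfun n)) u = Cmp SSpaces u' e)}"

text \<open>\<open>V[1]\<close>, from functors on \<open>\<Theta>\<^sub>n\<close> to functors on \<open>\<Theta>\<^sub>n\<^sub>+\<^sub>1\<close>. An \<open>m\<close>-simplex of the coproduct of
  products is a pair \<open>(\<delta>, a)\<close> with \<open>a\<close> in the product over \<open>jumps \<delta>\<close> (at most one factor). An
  arrow \<open>\<phi>\<close> with components \<open>\<phi>\<^sub>i\<^sub>j\<close> acts by precomposition on \<open>\<delta>\<close> and by \<open>A(\<phi>\<^sub>i\<^sub>j)\<close> on the factors,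
  \<open>j\<close> being the jump of \<open>\<delta>\<close> lying over the jump \<open>i\<close> of the composite.\<close>

definition jumps :: "dar \<Rightarrow> nat set" where
  "jumps d = {i \<in> {1..ddom d}. dfun d (i - 1) = 0 \<and> dfun d i = 1}"

definition V1_S :: "'u tsp \<Rightarrow> tree \<Rightarrow> nat \<Rightarrow> (dar \<times> (nat \<Rightarrow> 'u)) set" where
  "V1_S A \<theta> m = (SIGMA \<delta> : Hom Delta (length (sub \<theta>)) 1.
     \<Pi>\<^sub>E i \<in> jumps \<delta>. fob (fob A (sub \<theta> ! (i - 1))) m)"

definition V1_act1 :: "'u tsp \<Rightarrow> tmor \<Rightarrow> nat \<Rightarrow> dar \<times> (nat \<Rightarrow> 'u) \<Rightarrow> dar \<times> (nat \<Rightarrow> 'u)" where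
  "V1_act1 A \<phi> m = (\<lambda>(\<delta>, a). (Cmp Delta \<delta> (tdel \<phi>),
     \<lambda>i \<in> jumps (Cmp Delta \<delta> (tdel \<phi>)).
       let j = (THE j. (i, j) \<in> tidx (tdel \<phi>) \<and> j \<in> jumps \<delta>)
       in sfun (ncmp (far A (tcmp \<phi> i j)) m) (a j)))"

definition V1_act2 :: "'u tsp \<Rightarrow> tree \<Rightarrow> dar \<Rightarrow> dar \<times> (nat \<Rightarrow> 'u) \<Rightarrow> dar \<times> (nat \<Rightarrow> 'u)" where
  "V1_act2 A \<theta> \<alpha> = (\<lambda>(\<delta>, a).
     (\<delta>, \<lambda>i \<in> jumps \<delta>. sfun (far (fob A (sub \<theta> ! (i - 1))) \<alpha>) (a i)))"

definition V1 :: "nat \<Rightarrow> 'u tspmap \<Rightarrow> 'u tspmap" where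
  "V1 n f = binat (opp (theta (Suc n))) (opp Delta)
     (V1_S (nsrc f)) (V1_act1 (nsrc f)) (V1_act2 (nsrc f))
     (V1_S (ntgt f)) (V1_act1 (ntgt f)) (V1_act2 (ntgt f))
     (\<lambda>\<theta> m (\<delta>, a). (\<delta>, \<lambda>i \<in> jumps \<delta>. sfun (ncmp (ncmp f (sub \<theta> ! (i - 1))) m) (a i)))"

primrec loc_set :: "nat \<Rightarrow> 'u tspmap set" where
  "loc_set 0 = {}"
| "loc_set (Suc n) = Se (Suc n) \<union> Cpt (Suc n) \<union> V1 n ` loc_set n"

definition ThetaSp_model :: "nat \<Rightarrow> 'u tspmap model" where
  "ThetaSp_model n = Bousfield (ThetaSp n) (kappa n) TYPE('u) (injective_model n) (loc_set n)"

text \<open>The generating cofibrations: the inclusions of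
  \<open>\<partial>\<Delta>[m] \<times> \<Theta>[q](c\<^sub>1, \<dots>, c\<^sub>q) \<union> \<Delta>[m] \<times> \<partial>\<Theta>[q](c\<^sub>1, \<dots>, c\<^sub>q)\<close> into
  \<open>\<Delta>[m] \<times> \<Theta>[q](c\<^sub>1, \<dots>, c\<^sub>q)\<close>.\<close>

definition gencof_map :: "nat \<Rightarrow> nat \<Rightarrow> tree \<Rightarrow> 'u tspmap" where
  "gencof_map n m \<theta> = binat (opp (theta n)) (opp Delta)
     (\<lambda>\<theta>' k. {(a, g). a \<in> Hom Delta k m \<and> g \<in> Hom (theta n) \<theta>' \<theta> \<and>
                      (a \<in> bdry Delta m \<or> g \<in> bdry (theta n) \<theta>)})
     (\<lambda>f k (a, g). (a, Cmp (theta n) g f)) (\<lambda>\<theta>' b (a, g). (Cmp Delta a b, g))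
     (\<lambda>\<theta>' k. Hom Delta k m \<times> Hom (theta n) \<theta>' \<theta>)
     (\<lambda>f k (a, g). (a, Cmp (theta n) g f)) (\<lambda>\<theta>' b (a, g). (Cmp Delta a b, g))
     (\<lambda>\<theta>' k x. x)"

definition gencof :: "nat \<Rightarrow> 'u tspmap set" where
  "gencof n = {gencof_map n m \<theta> | m \<theta>. \<theta> \<in> Obj (theta n)}"


section \<open>Segal precategories\<close>

type_synonym 'u spc = "(nat, dar, 'u tsp, 'u tspmap) func"
type_synonym 'u spcmap = "(nat, dar, 'u tsp, 'u tspmap) ntr"

definition SimpThetaSp :: "nat \<Rightarrow> ('u spc, 'u spcmap) cat" where
  "SimpThetaSp n = fun_cat (opp Delta) (ThetaSp n)"

definition SegPre :: "nat \<Rightarrow> ('u spc, 'u spcmap) cat" where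
  "SegPre n = full_sub (SimpThetaSp n) (\<lambda>X. \<exists>S. small S \<and> fob X 0 = fob (disc n) S)"

definition segal :: "nat \<Rightarrow> 'u spc \<Rightarrow> bool" where
  "segal n X \<longleftrightarrow> (\<forall>k \<ge> 2. to_limit_in (ThetaSp n) (Inl ` {1..k} \<union> Inr ` {1..<k})
     (\<lambda>s. case s of Inl i \<Rightarrow> fob X 1 | Inr i \<Rightarrow> fob X 0)
     ({(Inl i, far X (sq 1 [1]), Inr i) | i. i \<in> {1..<k}} \<union>
      {(Inl (i + 1), far X (sq 1 [0]), Inr i) | i. i \<in> {1..<k}})
     (fob X k)
     (\<lambda>s. case s of Inl i \<Rightarrow> far X (sq k [i - 1, i]) | Inr i \<Rightarrow> far X (sq k [i]))
     (WE (ThetaSp_model n)))"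

text \<open>The matching object of \<open>X\<close> at \<open>k\<close> is the limit of \<open>X\<^sub>j\<close> over the injective maps from \<open>[j]\<close>
  to \<open>[k]\<close> with \<open>j < k\<close>; \<open>X\<close> is Reedy fibrant if all its matching maps are fibrations.\<close>

definition faces :: "nat \<Rightarrow> dar set" where
  "faces k = {a \<in> Arr Delta. dcod a = k \<and> ddom a < k \<and> inj_on (dfun a) {..ddom a}}"

definition Reedy_fibrant :: "nat \<Rightarrow> 'u spc \<Rightarrow> bool" where
  "Reedy_fibrant n X \<longleftrightarrow> X \<in> Obj (SimpThetaSp n) \<and>
     (\<forall>k. to_limit_in (ThetaSp n) (faces k) (\<lambda>a. fob X (ddom a))
        {(a, far X b, Cmp Delta a b) | a b. a \<in> faces k \<and> b \<in> Arr Delta \<and> dcod b = ddom a \<and>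
           Cmp Delta a b \<in> faces k}
        (fob X k) (far X) (Fib (ThetaSp_model n)))"

definition kappa' :: "nat \<Rightarrow> (nat, dar, 'u spc, 'u spcmap) func" where
  "kappa' n = fcomp Delta (diag (opp Delta) (ThetaSp n)) (kappa n)"

text \<open>Weak equivalences of \<open>L\<^sub>S(\<Theta>\<^sub>nSp)\<^sup>\<Delta>\<close>; all objects are Reedy cofibrant.\<close>

definition LS_WE :: "nat \<Rightarrow> 'u spcmap set" where
  "LS_WE n = local_equivs (SimpThetaSp n) (kappa' n) TYPE('u) {Z. Reedy_fibrant n Z \<and> segal n Z}"

text \<open>The functors \<open>L\<close>, with \<open>\<eta>\<close> the natural map from \<open>X\<close> to \<open>L X\<close>.\<close>

definition is_segal_replacement :: "nat \<Rightarrow> ('u spc, 'u spcmap, 'u spc, 'u spcmap) func \<Rightarrow>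
    ('u spc, 'u spcmap, 'u spc, 'u spcmap) ntr \<Rightarrow> bool" where
  "is_segal_replacement n L \<eta> \<longleftrightarrow>
     is_functor (SegPre n) (SegPre n) L \<and>
     \<eta> \<in> Hom (fun_cat (SegPre n) (SegPre n)) (fid (SegPre n)) L \<and>
     (\<forall>X \<in> Obj (SegPre n).
        ncmp (ncmp \<eta> X) 0 = Ide (ThetaSp n) (fob X 0) \<and> ncmp \<eta> X \<in> LS_WE n \<and>
        Reedy_fibrant n (fob L X) \<and> segal n (fob L X))"


section \<open>Dwyer-Kan equivalences\<close>

text \<open>The homotopy category of \<open>C\<close> with respect to \<open>W\<close> is the localization \<open>C[W\<^sup>-\<^sup>1]\<close>: arrows are
  classes of zigzags, where \<open>(True, f)\<close> is a step along \<open>f\<close> and \<open>(False, w)\<close> a step backwards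
  along \<open>w \<in> W\<close>.\<close>

primrec zz :: "('o, 'a) cat \<Rightarrow> 'a set \<Rightarrow> 'o \<Rightarrow> (bool \<times> 'a) list \<Rightarrow> 'o \<Rightarrow> bool" where
  "zz C W x [] y \<longleftrightarrow> x = y \<and> x \<in> Obj C"
| "zz C W x (s # l) y \<longleftrightarrow>
     (if fst s then snd s \<in> Arr C \<and> Dom C (snd s) = x \<and> zz C W (Cod C (snd s)) l y
      else snd s \<in> Arr C \<inter> W \<and> Cod C (snd s) = x \<and> zz C W (Dom C (snd s)) l y)"

inductive zz_step :: "('o, 'a) cat \<Rightarrow> 'a set \<Rightarrow> (bool \<times> 'a) list \<Rightarrow> (bool \<times> 'a) list \<Rightarrow> bool"
  for C W where
  "zz_step C W (u @ [(True, f), (True, g)] @ v) (u @ [(True, Cmp C g f)] @ v)"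
| "zz_step C W (u @ [(True, Ide C x)] @ v) (u @ v)"
| "zz_step C W (u @ [(True, w), (False, w)] @ v) (u @ v)"
| "zz_step C W (u @ [(False, w), (True, w)] @ v) (u @ v)"

definition zz_rel :: "('o, 'a) cat \<Rightarrow> 'a set \<Rightarrow> 'o \<Rightarrow> 'o \<Rightarrow>
    ((bool \<times> 'a) list \<times> (bool \<times> 'a) list) set" where
  "zz_rel C W x y = (let s = {(l, l'). zz C W x l y \<and> zz C W x l' y \<and> zz_step C W l l'}
     in (s \<union> s\<inverse>)\<^sup>* \<inter> {l. zz C W x l y} \<times> {l. zz C W x l y})"

type_synonym ('o, 'a) hoarr = "'o \<times> 'o \<times> (bool \<times> 'a) list set"

definition ho_cat :: "('o, 'a) cat \<Rightarrow> 'a set \<Rightarrow> ('o, ('o, 'a) hoarr) cat" where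
  "ho_cat C W = \<lparr>Obj = Obj C,
     Arr = {(x, y, c). x \<in> Obj C \<and> y \<in> Obj C \<and> c \<in> {l. zz C W x l y} // zz_rel C W x y},
     Dom = (\<lambda>(x, y, c). x), Cod = (\<lambda>(x, y, c). y),
     Ide = (\<lambda>x. (x, x, zz_rel C W x x `` {[]})),
     Cmp = (\<lambda>(y', z, d) (x, y, c). (x, z, zz_rel C W x z `` {l @ l' | l l'. l \<in> c \<and> l' \<in> d}))\<rparr>"

definition gam :: "('o, 'a) cat \<Rightarrow> 'a set \<Rightarrow> 'a \<Rightarrow> ('o, 'a) hoarr" where
  "gam C W f = (Dom C f, Cod C f, zz_rel C W (Dom C f) (Cod C f) `` {[(True, f)]})"

definition HoTheta :: "nat \<Rightarrow> ('u tsp, ('u tsp, 'u tspmap) hoarr) cat" where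
  "HoTheta n = ho_cat (ThetaSp n) (WE (ThetaSp_model n))"

definition gamma :: "nat \<Rightarrow> 'u tspmap \<Rightarrow> ('u tsp, 'u tspmap) hoarr" where
  "gamma n f = gam (ThetaSp n) (WE (ThetaSp_model n)) f"

text \<open>The terminal object \<open>1\<close>, and the map from \<open>1\<close> to a discrete object at an element.\<close>

definition One :: "nat \<Rightarrow> 'u tsp" where
  "One n = fob (disc n) {undefined}"

definition point :: "nat \<Rightarrow> 'u set \<Rightarrow> 'u \<Rightarrow> 'u tspmap" where
  "point n S x = far (disc n) \<lparr>sdom = {undefined}, scod = S, sfun = (\<lambda>_ \<in> {undefined}. x)\<rparr>"

text \<open>The set \<open>W\<^sub>0\<close>, and the map on it induced by a map of precategories.\<close>

definition pts :: "'u spc \<Rightarrow> 'u set" where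
  "pts W = fob (fob (fob W 0) (Tree [])) 0"

definition pts_map :: "'u spcmap \<Rightarrow> 'u \<Rightarrow> 'u" where
  "pts_map f = sfun (ncmp (ncmp (ncmp f 0) (Tree [])) 0)"

text \<open>\<open>fiber n W xs\<close> is the fiber of \<open>W\<^sub>k\<close> over \<open>xs = (x\<^sub>0, \<dots>, x\<^sub>k)\<close> in \<open>W\<^sub>0 \<times> \<cdots> \<times> W\<^sub>0\<close>, with
  its map to \<open>W\<^sub>k\<close>, as the limit of the diagram with nodes \<open>0\<close> for \<open>W\<^sub>k\<close>, \<open>1\<close> for the terminal
  object and \<open>i + 2\<close> for the \<open>i\<close>-th copy of \<open>W\<^sub>0\<close>.\<close>

definition fiber :: "nat \<Rightarrow> 'u spc \<Rightarrow> 'u list \<Rightarrow> 'u tsp \<times> 'u tspmap" where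
  "fiber n W xs = (let k = length xs - 1;
       F = (SOME (l, p). is_limit (ThetaSp n) {..k + 2}
          (\<lambda>i. if i = 0 then fob W k else if i = 1 then One n else fob W 0)
          ({(0, far W (sq k [i]), i + 2) | i. i \<le> k} \<union>
           {(1, point n (pts W) (xs ! i), i + 2) | i. i \<le> k}) l p)
     in (fst F, snd F 0))"

text \<open>The map of fibers induced by \<open>g\<close>.\<close>

definition fiber_map :: "nat \<Rightarrow> 'u tsp \<times> 'u tspmap \<Rightarrow> 'u tsp \<times> 'u tspmap \<Rightarrow> 'u tspmap \<Rightarrow>
    'u tspmap" where
  "fiber_map n F F' g = (THE h. h \<in> Hom (ThetaSp n) (fst F) (fst F') \<and>
     Cmp (ThetaSp n) (snd F') h = Cmp (ThetaSp n) g (snd F))"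

text \<open>\<open>Ho(W)\<close>. The composite of \<open>a\<close> and \<open>b\<close> is \<open>d\<^sub>1 w\<close>, for the unique arrow \<open>w\<close> from \<open>1\<close> to the
  fiber of \<open>W\<^sub>2\<close> over \<open>(x, y, z)\<close> with \<open>d\<^sub>2 w = a\<close> and \<open>d\<^sub>0 w = b\<close>.\<close>

definition HoSeg :: "nat \<Rightarrow> 'u spc \<Rightarrow> ('u, 'u \<times> 'u \<times> ('u tsp, 'u tspmap) hoarr) cat" where
  "HoSeg n W = \<lparr>Obj = pts W,
     Arr = {(x, y, a). x \<in> pts W \<and> y \<in> pts W \<and>
                       a \<in> Hom (HoTheta n) (One n) (fst (fiber n W [x, y]))},
     Dom = (\<lambda>(x, y, a). x), Cod = (\<lambda>(x, y, a). y),
     Ide = (\<lambda>x. (x, x, gamma n (THE p. p \<in> Hom (ThetaSp n) (One n) (fst (fiber n W [x, x])) \<and>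
        Cmp (ThetaSp n) (snd (fiber n W [x, x])) p
          = Cmp (ThetaSp n) (far W (sq 0 [0, 0])) (point n (pts W) x)))),
     Cmp = (\<lambda>(y', z, b) (x, y, a). (x, z, THE c.
        \<exists>w \<in> Hom (HoTheta n) (One n) (fst (fiber n W [x, y, z])).
          Cmp (HoTheta n) (gamma n
            (fiber_map n (fiber n W [x, y, z]) (fiber n W [x, y]) (far W (sq 2 [0, 1])))) w = a \<and>
          Cmp (HoTheta n) (gamma n
            (fiber_map n (fiber n W [x, y, z]) (fiber n W [y, z]) (far W (sq 2 [1, 2])))) w = b \<and>
          c = Cmp (HoTheta n) (gamma n
            (fiber_map n (fiber n W [x, y, z]) (fiber n W [x, z]) (far W (sq 2 [0, 2])))) w))\<rparr>"

definition map_fiber :: "nat \<Rightarrow> 'u spcmap \<Rightarrow> 'u \<Rightarrow> 'u \<Rightarrow> 'u tspmap" where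
  "map_fiber n f x y = fiber_map n (fiber n (nsrc f) [x, y])
     (fiber n (ntgt f) [pts_map f x, pts_map f y]) (ncmp f 1)"

definition HoSeg_map :: "nat \<Rightarrow> 'u spcmap \<Rightarrow>
    ('u, 'u \<times> 'u \<times> ('u tsp, 'u tspmap) hoarr,
     'u, 'u \<times> 'u \<times> ('u tsp, 'u tspmap) hoarr) func" where
  "HoSeg_map n f = \<lparr>fob = (\<lambda>x \<in> pts (nsrc f). pts_map f x),
     far = (\<lambda>(x, y, a) \<in> Arr (HoSeg n (nsrc f)).
       (pts_map f x, pts_map f y, Cmp (HoTheta n) (gamma n (map_fiber n f x y)) a))\<rparr>"

definition DK :: "nat \<Rightarrow> ('u spc, 'u spcmap, 'u spc, 'u spcmap) func \<Rightarrow> 'u spcmap set" where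
  "DK n L = {f \<in> Arr (SegPre n).
     (\<forall>x \<in> pts (nsrc f). \<forall>y \<in> pts (nsrc f). map_fiber n (far L f) x y \<in> WE (ThetaSp_model n)) \<and>
     is_cat_equivalence (HoSeg n (fob L (nsrc f))) (HoSeg n (fob L (ntgt f)))
       (HoSeg_map n (far L f))}"


section \<open>The set \<open>I\<^sub>f\<close> and the two model structures\<close>

definition simplex :: "nat \<Rightarrow> nat \<Rightarrow> 'u spc" where
  "simplex n p = fcomp (opp Delta) (disc n) (yo_ob Delta p)"

definition vertices :: "nat \<Rightarrow> nat \<Rightarrow> 'u spc" where
  "vertices n p = const_ob (opp Delta) (ThetaSp n) (fob (simplex n p) 0)"

text \<open>The inclusion of the vertices, by total degeneracies.\<close>

definition vertices_incl :: "nat \<Rightarrow> nat \<Rightarrow> 'u spcmap" where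
  "vertices_incl n p = \<lparr>nsrc = vertices n p, ntgt = simplex n p,
     ncmp = (\<lambda>k \<in> Obj (opp Delta). far (simplex n p) (sq 0 (replicate (k + 1) 0)))\<rparr>"

definition cst :: "nat \<Rightarrow> 'u tsp \<Rightarrow> 'u spc" where
  "cst n A = const_ob (opp Delta) (ThetaSp n) A"

definition cst_map :: "nat \<Rightarrow> 'u tspmap \<Rightarrow> 'u spcmap" where
  "cst_map n f = const_ar (opp Delta) (ThetaSp n) f"

text \<open>The second projection of the chosen product.\<close>

definition proj2 :: "('o, 'a) cat \<Rightarrow> 'o \<Rightarrow> 'o \<Rightarrow> 'a" where
  "proj2 C x y = snd (prod_cone C x y) True"

text \<open>\<open>P\<close>, with its maps \<open>j\<close> from \<open>(\<Delta>[p])\<^sub>0\<close> and \<open>q\<close> from \<open>A \<times> \<Delta>[p]\<close>, is a pushout \<open>A\<^sub>[\<^sub>p\<^sub>]\<close>.\<close>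

definition is_bracket :: "nat \<Rightarrow> nat \<Rightarrow> 'u tsp \<Rightarrow> 'u spc \<Rightarrow> 'u spcmap \<Rightarrow> 'u spcmap \<Rightarrow> bool" where
  "is_bracket n p A P j q \<longleftrightarrow> is_pushout (SimpThetaSp n)
     (proj2 (SimpThetaSp n) (cst n A) (vertices n p))
     (prod_ar (SimpThetaSp n) (Ide (SimpThetaSp n) (cst n A)) (vertices_incl n p))
     P j q"

text \<open>The second set of maps accounts for the convention \<open>\<emptyset>\<^sub>[\<^sub>0\<^sub>] = \<emptyset>\<close> (no generating cofibration
  has empty codomain).\<close>

definition I_f :: "nat \<Rightarrow> 'u spcmap set" where
  "I_f n =
     {h \<in> Arr (SegPre n). \<exists>p. \<exists>f \<in> gencof n. \<exists>P j q P' j' q'.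
        \<not> (p = 0 \<and> is_initial (ThetaSp n) (nsrc f)) \<and>
        is_bracket n p (nsrc f) P j q \<and> is_bracket n p (ntgt f) P' j' q' \<and>
        nsrc h = P \<and> ntgt h = P' \<and> Cmp (SimpThetaSp n) h j = j' \<and>
        Cmp (SimpThetaSp n) h q = Cmp (SimpThetaSp n) q'
          (prod_ar (SimpThetaSp n) (cst_map n f) (Ide (SimpThetaSp n) (simplex n p)))} \<union>
     {h \<in> Arr (SegPre n). \<exists>f \<in> gencof n. \<exists>P' j' q'.
        is_initial (ThetaSp n) (nsrc f) \<and> is_bracket n 0 (ntgt f) P' j' q' \<and>
        is_initial (SimpThetaSp n) (nsrc h) \<and> ntgt h = P'}"

definition disc_c :: "nat \<Rightarrow> ('u spc, 'u spcmap, 'u spc, 'u spcmap) func \<Rightarrow> 'u spcmap model" where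
  "disc_c n L = mk_model (SegPre n) (DK n L) {f. is_mono (SegPre n) f}"

definition disc_f :: "nat \<Rightarrow> ('u spc, 'u spcmap, 'u spc, 'u spcmap) func \<Rightarrow> 'u spcmap model" where
  "disc_f n L = mk_model (SegPre n) (DK n L)
     (retracts_of (SegPre n)
       (transfinite_comps TYPE('u) (SegPre n) (pushouts_of (SegPre n) (I_f n))))"

end

theory Submission
  imports Defs
begin

text \<open>Both model structures have the same weak equivalences, and the adjunction consists of identity
  functors. The bijections of the adjunction therefore preserve and reflect weak equivalences, and
  the assertion that remains is that every cofibration of \<open>disc_f\<close>, that is, every retract of
  a transfinite composition of pushouts of maps in \<open>I_f\<close>, is a monomorphism of Segal
  precategories.

  Colimits of Segal precategories need not be computed for this. Say that a map \<open>i\<close> extends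
  to an object \<open>Q\<close> if every map from the source of \<open>i\<close> to \<open>Q\<close> factors through
  \<open>i\<close>. By universal properties alone this condition is inherited by pushouts, transfinite
  compositions and retracts (\<open>pushouts_extend\<close>, \<open>transfinite_comps_extend\<close>,
  \<open>retracts_extend\<close>). It then suffices to find objects \<open>Q\<close> such that the maps in
  \<open>I_f\<close> extend to all of them (\<open>I_f_extends\<close>) while only monomorphisms do
  (\<open>extends_mono\<close>).

  Up to the choice of \<open>X\<^sub>0\<close> within its isomorphism class, a Segal precategory is a presheaf
  of sets on the quotient of \<open>\<Delta> \<times> \<Theta>\<^sub>n \<times> \<Delta>\<close> in which
  \<open>(a, f, b)\<close> and \<open>(a, f', b')\<close> are identified as soon as \<open>a\<close> is constant. For an
  object \<open>d\<close>, the object \<open>cofree n d\<close> sends \<open>c\<close> to the power set of the set of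
  arrows from \<open>d\<close> to \<open>c\<close> in this quotient. By the Yoneda argument, maps from a Segal
  precategory \<open>X\<close> to it are the same as subsets of \<open>X(d)\<close> (\<open>cofree_map\<close>,
  \<open>cofree_eqI\<close>). Extending the map that belongs to a one-element set \<open>{x}\<close> along
  \<open>i\<close> shows that \<open>i\<close> takes no other element of \<open>X(d)\<close> to the image of \<open>x\<close>.

  For a map from \<open>A\<^sub>[\<^sub>p\<^sub>]\<close> to \<open>B\<^sub>[\<^sub>p\<^sub>]\<close> in \<open>I_f\<close>, both brackets are pushouts of
  simplicial objects, so that a map out of them is a subset of \<open>(A \<times> \<Delta>[p])(d)\<close>,
  respectively \<open>(B \<times> \<Delta>[p])(d)\<close>, together with a compatible set of vertices. As
  \<open>A \<rightarrow> B\<close> is injective, the first kind of datum is the restriction of one of the second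
  kind (\<open>bracket_extends\<close>).\<close>

section \<open>Categories and functors\<close>

locale category =
  fixes C :: "('o, 'a) cat"
  assumes Hom_Obj: "f \<in> Hom C x y \<Longrightarrow> x \<in> Obj C \<and> y \<in> Obj C"
    and Ide_Hom: "x \<in> Obj C \<Longrightarrow> Ide C x \<in> Hom C x x"
    and Cmp_Hom: "f \<in> Hom C x y \<Longrightarrow> g \<in> Hom C y z \<Longrightarrow> Cmp C g f \<in> Hom C x z"
    and Cmp_assoc: "f \<in> Hom C x y \<Longrightarrow> g \<in> Hom C y z \<Longrightarrow> h \<in> Hom C z w \<Longrightarrow>
      Cmp C h (Cmp C g f) = Cmp C (Cmp C h g) f"
    and Cmp_Ide_left: "f \<in> Hom C x y \<Longrightarrow> Cmp C (Ide C y) f = f"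
    and Cmp_Ide_right: "f \<in> Hom C x y \<Longrightarrow> Cmp C f (Ide C x) = f"

lemma Arr_Hom: "f \<in> Arr C \<longleftrightarrow> f \<in> Hom C (Dom C f) (Cod C f)"
  by (simp add: Hom_def)

lemma Hom_Arr: "f \<in> Hom C x y \<Longrightarrow> f \<in> Arr C \<and> Dom C f = x \<and> Cod C f = y"
  by (simp add: Hom_def)

lemma opp_simps [simp]:
  "Obj (opp C) = Obj C" "Arr (opp C) = Arr C" "Dom (opp C) = Cod C" "Cod (opp C) = Dom C"
  "Ide (opp C) = Ide C" "Cmp (opp C) g f = Cmp C f g"
  by (simp_all add: opp_def)

lemma Hom_opp [simp]: "Hom (opp C) x y = Hom C y x"
  by (auto simp: Hom_def)

lemma category_opp:
  assumes "category C"
  shows "category (opp C)"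
proof -
  interpret category C by fact
  show ?thesis
    by (unfold_locales; simp; metis Hom_Obj Ide_Hom Cmp_Hom Cmp_assoc Cmp_Ide_left Cmp_Ide_right)
qed

lemma full_sub_simps [simp]:
  "Obj (full_sub C P) = {x \<in> Obj C. P x}"
  "Arr (full_sub C P) = {f \<in> Arr C. P (Dom C f) \<and> P (Cod C f)}"
  "Dom (full_sub C P) = Dom C" "Cod (full_sub C P) = Cod C"
  "Ide (full_sub C P) = Ide C" "Cmp (full_sub C P) = Cmp C"
  by (simp_all add: full_sub_def)

lemma Hom_full_sub: "f \<in> Hom (full_sub C P) x y \<longleftrightarrow> f \<in> Hom C x y \<and> P x \<and> P y"
  by (auto simp: Hom_def)

lemma category_full_sub:
  assumes "category C"
  shows "category (full_sub C P)"
proof -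
  interpret category C by fact
  show ?thesis
    by (unfold_locales; simp add: Hom_full_sub;
      metis Hom_Obj Ide_Hom Cmp_Hom Cmp_assoc Cmp_Ide_left Cmp_Ide_right)
qed

lemma is_functorI:
  assumes "fob F \<in> extensional (Obj C)" "far F \<in> extensional (Arr C)"
    and "\<And>x. x \<in> Obj C \<Longrightarrow> fob F x \<in> Obj D"
    and "\<And>f x y. f \<in> Hom C x y \<Longrightarrow> far F f \<in> Hom D (fob F x) (fob F y)"
    and "\<And>x. x \<in> Obj C \<Longrightarrow> far F (Ide C x) = Ide D (fob F x)"
    and "\<And>f g x y z. f \<in> Hom C x y \<Longrightarrow> g \<in> Hom C y z \<Longrightarrow>
      far F (Cmp C g f) = Cmp D (far F g) (far F f)"
  shows "is_functor C D F"
  using assms unfolding is_functor_def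
  by (auto simp: PiE_iff Hom_def)

lemma is_functorD:
  assumes "is_functor C D F"
  shows "fob F \<in> extensional (Obj C)" "far F \<in> extensional (Arr C)"
    and "x \<in> Obj C \<Longrightarrow> fob F x \<in> Obj D"
    and "f \<in> Hom C x y \<Longrightarrow> far F f \<in> Hom D (fob F x) (fob F y)"
    and "x \<in> Obj C \<Longrightarrow> far F (Ide C x) = Ide D (fob F x)"
    and "f \<in> Hom C x y \<Longrightarrow> g \<in> Hom C y z \<Longrightarrow>
      far F (Cmp C g f) = Cmp D (far F g) (far F f)"
  using assms unfolding is_functor_def
  by (auto simp: PiE_iff Hom_def)

lemma is_ntrI:
  assumes "is_functor C D (nsrc t)" "is_functor C D (ntgt t)" "ncmp t \<in> extensional (Obj C)"
    and "\<And>x. x \<in> Obj C \<Longrightarrow> ncmp t x \<in> Hom D (fob (nsrc t) x) (fob (ntgt t) x)"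
    and "\<And>f x y. f \<in> Hom C x y \<Longrightarrow>
      Cmp D (far (ntgt t) f) (ncmp t x) = Cmp D (ncmp t y) (far (nsrc t) f)"
  shows "is_ntr C D t"
  using assms unfolding is_ntr_def by (auto simp: Hom_def)

lemma is_ntrD:
  assumes "is_ntr C D t"
  shows "is_functor C D (nsrc t)" "is_functor C D (ntgt t)" "ncmp t \<in> extensional (Obj C)"
    and "x \<in> Obj C \<Longrightarrow> ncmp t x \<in> Hom D (fob (nsrc t) x) (fob (ntgt t) x)"
    and "f \<in> Hom C x y \<Longrightarrow>
      Cmp D (far (ntgt t) f) (ncmp t x) = Cmp D (ncmp t y) (far (nsrc t) f)"
  using assms unfolding is_ntr_def by (auto simp: Hom_def)

lemma fun_cat_simps [simp]:
  "Obj (fun_cat C D) = {F. is_functor C D F}"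
  "Arr (fun_cat C D) = {t. is_ntr C D t}" "Dom (fun_cat C D) = nsrc" "Cod (fun_cat C D) = ntgt"
  "Ide (fun_cat C D) F = \<lparr>nsrc = F, ntgt = F, ncmp = (\<lambda>x \<in> Obj C. Ide D (fob F x))\<rparr>"
  "Cmp (fun_cat C D) u t = \<lparr>nsrc = nsrc t, ntgt = ntgt u,
                   ncmp = (\<lambda>x \<in> Obj C. Cmp D (ncmp u x) (ncmp t x))\<rparr>"
  by (simp_all add: fun_cat_def)

lemma Hom_fun_cat: "t \<in> Hom (fun_cat C D) F G \<longleftrightarrow> is_ntr C D t \<and> nsrc t = F \<and> ntgt t = G"
  by (simp add: Hom_def)

lemma ntr_eqI:
  assumes "t \<in> Hom (fun_cat C D) F G" "t' \<in> Hom (fun_cat C D) F G"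
    and "\<And>x. x \<in> Obj C \<Longrightarrow> ncmp t x = ncmp t' x"
  shows "t = t'"
proof -
  have "ncmp t = ncmp t'"
    using assms by (intro extensionalityI[of _ "Obj C"]) (auto simp: Hom_fun_cat is_ntr_def)
  then show ?thesis using assms by (cases t; cases t') (auto simp: Hom_fun_cat)
qed

lemma category_fun_cat:
  assumes C: "category C" and D: "category D"
  shows "category (fun_cat C D)"
proof -
  interpret C: category C by fact
  interpret D: category D by fact
  have ide: "Ide (fun_cat C D) F \<in> Hom (fun_cat C D) F F" if "F \<in> Obj (fun_cat C D)" for F
  proof -
    have F: "is_functor C D F" using that by simp
    show ?thesis unfolding Hom_fun_cat
    proof (intro conjI is_ntrI)
      fix f x y assume f: "f \<in> Hom C x y"
      then show "Cmp D (far (ntgt (Ide (fun_cat C D) F)) f) (ncmp (Ide (fun_cat C D) F) x) =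
          Cmp D (ncmp (Ide (fun_cat C D) F) y) (far (nsrc (Ide (fun_cat C D) F)) f)"
        using C.Hom_Obj[OF f] is_functorD(4)[OF F f] D.Cmp_Ide_left D.Cmp_Ide_right by auto
    qed (use F in \<open>auto intro: D.Ide_Hom dest: is_functorD(3)\<close>)
  qed
  have cmp: "Cmp (fun_cat C D) u t \<in> Hom (fun_cat C D) F H"
    if "t \<in> Hom (fun_cat C D) F G" "u \<in> Hom (fun_cat C D) G H" for t u F G H
  proof -
    have t: "is_ntr C D t" "nsrc t = F" "ntgt t = G" and u: "is_ntr C D u" "nsrc u = G" "ntgt u = H"
      using that by (auto simp: Hom_fun_cat)
    have nat: "Cmp D (far H f) (Cmp D (ncmp u x) (ncmp t x))
        = Cmp D (Cmp D (ncmp u y) (ncmp t y)) (far F f)" if f: "f \<in> Hom C x y" for f x y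
    proof -
      have xy: "x \<in> Obj C" "y \<in> Obj C" using f C.Hom_Obj by auto
      note tx = is_ntrD(4)[OF t(1) xy(1), unfolded t] is_ntrD(4)[OF t(1) xy(2), unfolded t]
      note ux = is_ntrD(4)[OF u(1) xy(1), unfolded u] is_ntrD(4)[OF u(1) xy(2), unfolded u]
      note F = is_functorD(4)[OF is_ntrD(1)[OF t(1)] f, unfolded t]
      note G = is_functorD(4)[OF is_ntrD(2)[OF t(1)] f, unfolded t]
      note H = is_functorD(4)[OF is_ntrD(2)[OF u(1)] f, unfolded u]
      show ?thesis
        using D.Cmp_assoc[OF tx(1) ux(1) H] D.Cmp_assoc[OF tx(1) G ux(2)] D.Cmp_assoc[OF F tx(2) ux(2)]
          is_ntrD(5)[OF t(1) f] is_ntrD(5)[OF u(1) f] t u by simp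
    qed
    have "Cmp D (ncmp u x) (ncmp t x) \<in> Hom D (fob F x) (fob H x)" if "x \<in> Obj C" for x
      using D.Cmp_Hom[OF is_ntrD(4)[OF t(1) that, unfolded t] is_ntrD(4)[OF u(1) that, unfolded u]] .
    then show ?thesis unfolding Hom_fun_cat
      using t u nat is_ntrD(1)[OF t(1)] is_ntrD(2)[OF u(1)]
      by (auto intro!: is_ntrI dest: C.Hom_Obj)
  qed
  show ?thesis
  proof
    fix t F G assume t: "t \<in> Hom (fun_cat C D) F G"
    then show "F \<in> Obj (fun_cat C D) \<and> G \<in> Obj (fun_cat C D)"
      by (auto simp: Hom_fun_cat is_ntr_def)
    then have "Ide (fun_cat C D) F \<in> Hom (fun_cat C D) F F" "Ide (fun_cat C D) G \<in> Hom (fun_cat C D) G G"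
      using ide by auto
    then have "Cmp (fun_cat C D) (Ide (fun_cat C D) G) t \<in> Hom (fun_cat C D) F G"
      "Cmp (fun_cat C D) t (Ide (fun_cat C D) F) \<in> Hom (fun_cat C D) F G"
      using cmp t by blast+
    then show "Cmp (fun_cat C D) (Ide (fun_cat C D) G) t = t"
       "Cmp (fun_cat C D) t (Ide (fun_cat C D) F) = t"
      using t by (auto intro!: ntr_eqI[OF _ t] simp del: fun_cat_simps(5,6))
        (auto simp: Hom_fun_cat dest!: is_ntrD(4) intro: D.Cmp_Ide_left D.Cmp_Ide_right)
  next
    fix t u v F G H K
    assume t: "t \<in> Hom (fun_cat C D) F G" and u: "u \<in> Hom (fun_cat C D) G H"
      and v: "v \<in> Hom (fun_cat C D) H K"
    show "Cmp (fun_cat C D) v (Cmp (fun_cat C D) u t) = Cmp (fun_cat C D) (Cmp (fun_cat C D) v u) t"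
    proof (rule ntr_eqI)
      show "Cmp (fun_cat C D) v (Cmp (fun_cat C D) u t) \<in> Hom (fun_cat C D) F K"
        "Cmp (fun_cat C D) (Cmp (fun_cat C D) v u) t \<in> Hom (fun_cat C D) F K"
        using t u v cmp by blast+
      show "ncmp (Cmp (fun_cat C D) v (Cmp (fun_cat C D) u t)) x
        = ncmp (Cmp (fun_cat C D) (Cmp (fun_cat C D) v u) t) x" if "x \<in> Obj C" for x
        using t u v that D.Cmp_assoc by (fastforce simp: Hom_fun_cat dest: is_ntrD(4))
    qed
  qed (use ide cmp in blast)+
qed

lemma is_functor_fid: "category C \<Longrightarrow> is_functor C C (fid C)"
  unfolding fid_def category_def
  by (intro is_functorI) (auto simp: Hom_def)

lemma is_functor_fcomp:
  assumes "category C" "is_functor C D F" "is_functor D E G"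
  shows "is_functor C E (fcomp C G F)"
proof -
  interpret category C by fact
  note F = is_functorD[OF assms(2)] and G = is_functorD[OF assms(3)]
  show ?thesis unfolding fcomp_def
  proof (intro is_functorI)
    fix f g x y z assume f: "f \<in> Hom C x y" and g: "g \<in> Hom C y z"
    show "far \<lparr>fob = \<lambda>x\<in>Obj C. fob G (fob F x), far = \<lambda>f\<in>Arr C. far G (far F f)\<rparr> (Cmp C g f) =
       Cmp E (far \<lparr>fob = \<lambda>x\<in>Obj C. fob G (fob F x), far = \<lambda>f\<in>Arr C. far G (far F f)\<rparr> g)
        (far \<lparr>fob = \<lambda>x\<in>Obj C. fob G (fob F x), far = \<lambda>f\<in>Arr C. far G (far F f)\<rparr> f)"
      using f g Cmp_Hom[OF f g] F(4)[OF f] F(4)[OF g]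
      by (simp add: Hom_Arr F(6)[OF f g] G(6))
  qed (auto simp: F G Hom_Arr[OF Ide_Hom] dest: Hom_Obj Hom_Arr)
qed

lemma is_functor_const_ob:
  assumes "category C" "category D" "d \<in> Obj D"
  shows "is_functor C D (const_ob C D d)"
proof -
  interpret C: category C by fact
  interpret D: category D by fact
  show ?thesis unfolding const_ob_def
    using assms(3) D.Ide_Hom[OF assms(3)]
    by (intro is_functorI) (auto simp: D.Cmp_Ide_left Hom_Arr[OF C.Ide_Hom] dest: C.Hom_Obj
      Hom_Arr[OF C.Cmp_Hom] Hom_Arr)
qed

lemma const_ar_Hom:
  assumes "category C" "category D" "g \<in> Hom D d e"
  shows "const_ar C D g \<in> Hom (fun_cat C D) (const_ob C D d) (const_ob C D e)"
proof -
  interpret C: category C by fact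
  interpret D: category D by fact
  have de: "d \<in> Obj D" "e \<in> Obj D" using D.Hom_Obj[OF assms(3)] by auto
  show ?thesis unfolding Hom_fun_cat const_ar_def
    using assms(3) de is_functor_const_ob[OF assms(1,2)]
    by (auto intro!: is_ntrI simp: Hom_Arr[OF assms(3)] const_ob_def D.Cmp_Ide_left[OF assms(3)]
      D.Cmp_Ide_right[OF assms(3)] dest: C.Hom_Obj Hom_Arr)
qed

lemma is_functor_diag:
  assumes "category C" "category D"
  shows "is_functor D (fun_cat C D) (diag C D)"
proof -
  interpret C: category C by fact
  interpret D: category D by fact
  note cat = category_fun_cat[OF assms]
  show ?thesis
  proof (intro is_functorI)
    show "far (diag C D) f \<in> Hom (fun_cat C D) (fob (diag C D) x) (fob (diag C D) y)"
      if "f \<in> Hom D x y" for f x y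
      using that D.Hom_Obj[OF that] Hom_Arr[OF that] by (simp add: diag_def const_ar_Hom assms)
    show "far (diag C D) (Ide D x) = Ide (fun_cat C D) (fob (diag C D) x)" if "x \<in> Obj D" for x
      using that Hom_Arr[OF D.Ide_Hom[OF that]]
      by (auto simp: diag_def const_ar_def const_ob_def)
    show "far (diag C D) (Cmp D g f) = Cmp (fun_cat C D) (far (diag C D) g) (far (diag C D) f)"
      if "f \<in> Hom D x y" "g \<in> Hom D y z" for f g x y z
      using Hom_Arr[OF that(1)] Hom_Arr[OF that(2)] Hom_Arr[OF D.Cmp_Hom[OF that]]
      by (auto simp: diag_def const_ar_def)
  qed (auto simp: diag_def intro: is_functor_const_ob assms)
qed

section \<open>Maps that extend to an object\<close>

text \<open>This is the left lifting property with respect to the map from \<open>Q\<close> to a terminal object,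
  if there is one.\<close>

definition extends_to :: "('o, 'a) cat \<Rightarrow> 'o \<Rightarrow> 'a set" where
  "extends_to C Q = {i \<in> Arr C. \<forall>u \<in> Hom C (Dom C i) Q. \<exists>w \<in> Hom C (Cod C i) Q. Cmp C w i = u}"

context category
begin

lemma pushouts_extend:
  assumes "S \<subseteq> extends_to C Q"
  shows "pushouts_of C S \<subseteq> extends_to C Q"
proof
  fix v assume "v \<in> pushouts_of C S"
  then obtain i g P u where i: "i \<in> S" and po: "is_pushout C i g P u v"
    unfolding pushouts_of_def by auto
  have g: "g \<in> Hom C (Dom C i) (Cod C g)" and i': "i \<in> Hom C (Dom C i) (Cod C i)"
    and v: "v \<in> Hom C (Cod C g) P"
    using po by (auto simp: is_pushout_def Hom_def)
  have "\<exists>h \<in> Hom C P Q. Cmp C h v = w" if w: "w \<in> Hom C (Cod C g) Q" for w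
  proof -
    have "Cmp C w g \<in> Hom C (Dom C i) Q" using Cmp_Hom[OF g w] .
    then obtain w' where w': "w' \<in> Hom C (Cod C i) Q" "Cmp C w' i = Cmp C w g"
      using assms i unfolding extends_to_def by blast
    then show ?thesis using po w unfolding is_pushout_def by blast
  qed
  then show "v \<in> extends_to C Q"
    using v unfolding extends_to_def by (auto simp: Hom_def)
qed

text \<open>A map \<open>u\<close> on the source of a retract \<open>f\<close> of \<open>g\<close> is first restricted along the
  retraction \<open>r\<close>, then extended along \<open>g\<close>, and then pulled back along the section
  \<open>i'\<close>.\<close>

lemma retracts_extend:
  assumes "S \<subseteq> extends_to C Q"
  shows "retracts_of C S \<subseteq> extends_to C Q"
proof
  fix f assume "f \<in> retracts_of C S"
  then obtain g i r i' r' where f: "f \<in> Hom C (Dom C f) (Cod C f)"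
    and g: "g \<in> S" "g \<in> Hom C (Dom C g) (Cod C g)"
    and i: "i \<in> Hom C (Dom C f) (Dom C g)" and r: "r \<in> Hom C (Dom C g) (Dom C f)"
    and i': "i' \<in> Hom C (Cod C f) (Cod C g)"
    and ri: "Cmp C r i = Ide C (Dom C f)" and gi: "Cmp C g i = Cmp C i' f"
    unfolding retracts_of_def Arr_Hom by blast
  have "\<exists>w \<in> Hom C (Cod C f) Q. Cmp C w f = u" if u: "u \<in> Hom C (Dom C f) Q" for u
  proof -
    have "Cmp C u r \<in> Hom C (Dom C g) Q" using Cmp_Hom[OF r u] .
    then obtain e where e: "e \<in> Hom C (Cod C g) Q" "Cmp C e g = Cmp C u r"
      using assms g unfolding extends_to_def by blast
    \<comment> \<open>The extension of \<open>u\<close> along \<open>f\<close> is \<open>e\<close> after \<open>i'\<close>.\<close>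
    have "Cmp C (Cmp C e i') f = Cmp C e (Cmp C i' f)" using Cmp_assoc[OF f i' e(1)] by simp
    also have "\<dots> = Cmp C (Cmp C e g) i" using Cmp_assoc[OF i g(2) e(1)] gi by simp
    also have "\<dots> = Cmp C u (Cmp C r i)" using Cmp_assoc[OF i r u] e by simp
    also have "\<dots> = u" using ri Cmp_Ide_right[OF u] by simp
    finally show ?thesis using Cmp_Hom[OF i' e(1)] by blast
  qed
  then show "f \<in> extends_to C Q" using f unfolding extends_to_def by (auto simp: Hom_def)
qed

text \<open>A cocone from the sequence to \<open>Q\<close> is built by well-founded recursion: at a successor the map
  already found is extended along an element of \<open>S\<close>, and at a limit it is determined by the
  universal property. The recursion ends with the colimit of the whole sequence.\<close>

lemma transfinite_comps_extend:
  assumes S: "S \<subseteq> extends_to C Q"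
  shows "transfinite_comps TYPE('u) C S \<subseteq> extends_to C Q"
proof
  fix x assume "x \<in> transfinite_comps TYPE('u) C S"
  then obtain r :: "('u \<times> 'u) set" and X t l c i0 where x: "x = c i0" and seq: "is_seq C S r X t"
    and col: "is_colimit C (Field r) X {(i, t i j, j) | i j. (i, j) \<in> r} l c"
    and i0: "i0 \<in> Field r" "underS r i0 = {}"
    unfolding transfinite_comps_def by blast
  have wo: "Well_order r" and tid: "\<And>i. i \<in> Field r \<Longrightarrow> X i \<in> Obj C \<and> t i i = Ide C (X i)"
    and tH: "\<And>i j. (i, j) \<in> r \<Longrightarrow> t i j \<in> Hom C (X i) (X j)"
    and tc: "\<And>i j k. (i, j) \<in> r \<Longrightarrow> (j, k) \<in> r \<Longrightarrow> Cmp C (t j k) (t i j) = t i k"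
    using seq unfolding is_seq_def by auto
  have lim: "is_colimit C (underS r j) X {(i, t i i', i') | i i'. (i, i') \<in> r \<and> i' \<in> underS r j}
          (X j) (\<lambda>i. t i j)"
    if "j \<in> Field r" "underS r j \<noteq> {}" "\<forall>i \<in> underS r j. \<exists>i' \<in> underS r j. i \<in> underS r i'" for j
    using seq that unfolding is_seq_def by blast
  have suc: "t i j \<in> S" if "i \<in> underS r j" "\<nexists>k. i \<in> underS r k \<and> k \<in> underS r j" for i j
    using seq that unfolding is_seq_def by blast
  have lin: "Linear_order r" and wf: "wf (r - Id)" using wo by (auto simp: well_order_on_def)
  have tr: "\<And>a b c. (a, b) \<in> r \<Longrightarrow> (b, c) \<in> r \<Longrightarrow> (a, c) \<in> r"
    using lin by (metis linear_order_on_def partial_order_on_def preorder_on_def transD)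
  have asym: "\<And>a b. (a, b) \<in> r \<Longrightarrow> (b, a) \<in> r \<Longrightarrow> a = b"
    using lin by (metis linear_order_on_def partial_order_on_def antisymD)
  have rfl: "\<And>a. a \<in> Field r \<Longrightarrow> (a, a) \<in> r"
    using lin by (metis linear_order_on_def partial_order_on_def preorder_on_def refl_onD)
  have tot: "\<And>a b. a \<in> Field r \<Longrightarrow> b \<in> Field r \<Longrightarrow> a \<noteq> b \<Longrightarrow> (a, b) \<in> r \<or> (b, a) \<in> r"
    using lin by (metis linear_order_on_def total_on_def)
  have ciH: "c i0 \<in> Hom C (X i0) l"
    using col i0 unfolding is_colimit_def is_cocone_def by blast
  have "\<exists>w \<in> Hom C l Q. Cmp C w (c i0) = u" if u: "u \<in> Hom C (X i0) Q" for u
  proof -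
    \<comment> \<open>\<open>P e j h\<close> says that \<open>h\<close> is an admissible component at \<open>j\<close>, given the components
      \<open>e\<close> below \<open>j\<close>.\<close>
    define P where "P = (\<lambda>e j h. j \<in> Field r \<longrightarrow> h \<in> Hom C (X j) Q \<and>
      (\<forall>i \<in> underS r j. Cmp C h (t i j) = e i) \<and> (j = i0 \<longrightarrow> h = u))"
    have "\<exists>e. \<forall>j. P e j (e j)"
    proof (rule dependent_wf_choice[OF wf])
      fix f g :: "'u \<Rightarrow> 'a" and j h assume "\<And>z. (z, j) \<in> r - Id \<Longrightarrow> f z = g z"
      then show "P f j h = P g j h" unfolding P_def underS_def by auto
    next
      fix j e assume IH: "\<And>i. (i, j) \<in> r - Id \<Longrightarrow> P e i (e i)"
      have e: "e i \<in> Hom C (X i) Q" "\<And>i'. i' \<in> underS r i \<Longrightarrow> Cmp C (e i) (t i' i) = e i'"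
        "i = i0 \<Longrightarrow> e i = u" if "i \<in> underS r j" for i
        using IH[of i] that by (auto simp: P_def underS_def Field_def)
      have e': "Cmp C (e i) (t i' i) = e i'" if i: "i \<in> underS r j" and i': "(i', i) \<in> r" for i i'
      proof (cases "i' = i")
        case True
        then show ?thesis using Cmp_Ide_right[OF e(1)[OF i]] tid[of i] FieldI1[OF i'] by simp
      next
        case False
        then show ?thesis using e(2)[OF i] i' by (auto simp: underS_def)
      qed
      show "\<exists>h. P e j h"
      proof (cases "j \<in> Field r")
        case j: True
        have i0j: "i0 \<in> underS r j" if "j \<noteq> i0"
          using that tot[OF i0(1) j] i0(2) by (auto simp: underS_def)
        consider "underS r j = {}"
          | i where "i \<in> underS r j" "\<forall>i' \<in> underS r j. i \<notin> underS r i'"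
          | "underS r j \<noteq> {}" "\<forall>i \<in> underS r j. \<exists>i' \<in> underS r j. i \<in> underS r i'" by blast
        then show ?thesis
        proof cases
          case 1
          then have "j = i0" using i0j by blast
          then show ?thesis using u 1 unfolding P_def by blast
        next
          case (2 i)
          then have "t i j \<in> S" using suc by blast
          moreover have tij: "t i j \<in> Hom C (X i) (X j)" using 2 tH by (auto simp: underS_def)
          ultimately obtain h where h: "h \<in> Hom C (X j) Q" "Cmp C h (t i j) = e i"
            using S e(1)[OF 2(1)] unfolding extends_to_def by (fastforce simp: Hom_def)
          have "Cmp C h (t i' j) = e i'" if i': "i' \<in> underS r j" for i'
          proof -
            have le: "(i', i) \<in> r"
              using tot[of i i'] rfl[of i] 2 i' by (auto simp: underS_def Field_def)
            have "Cmp C h (t i' j) = Cmp C h (Cmp C (t i j) (t i' i))"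
              using tc[OF le] 2 by (auto simp: underS_def)
            also have "\<dots> = Cmp C (e i) (t i' i)"
              using Cmp_assoc[OF tH[OF le] tij h(1)] h(2) by simp
            finally show ?thesis using e'[OF 2(1) le] by simp
          qed
          moreover have "j \<noteq> i0" using 2 i0 by blast
          ultimately show ?thesis using h unfolding P_def by blast
        next
          case 3
          have "is_cocone C (underS r j) X {(i, t i i', i') | i i'. (i, i') \<in> r \<and> i' \<in> underS r j} Q e"
            using e(1) e' Hom_Obj[OF u] unfolding is_cocone_def by auto
          then obtain h where "h \<in> Hom C (X j) Q" "\<forall>i \<in> underS r j. Cmp C h (t i j) = e i"
            using lim[OF j 3] unfolding is_colimit_def by blast
          moreover have "j \<noteq> i0" using 3 i0 by blast
          ultimately show ?thesis unfolding P_def by blast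
        qed
      qed (simp add: P_def)
    qed
    then obtain e where e: "\<And>j. P e j (e j)" by blast
    have eH: "e i \<in> Hom C (X i) Q" if "i \<in> Field r" for i using e[of i] that by (auto simp: P_def)
    have "Cmp C (e i) (t i' i) = e i'" if "(i', i) \<in> r" for i i'
    proof (cases "i' = i")
      case True
      then show ?thesis using Cmp_Ide_right[OF eH[of i]] tid[of i] FieldI1[OF that] by simp
    next
      case False
      then show ?thesis using e[of i] that by (auto simp: underS_def P_def Field_def)
    qed
    then have "is_cocone C (Field r) X {(i, t i j, j) | i j. (i, j) \<in> r} Q e"
      using eH Hom_Obj[OF u] unfolding is_cocone_def by auto
    then obtain h where "h \<in> Hom C l Q" "\<forall>i \<in> Field r. Cmp C h (c i) = e i"
      using col unfolding is_colimit_def by blast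
    then show ?thesis using i0 e[of i0] unfolding P_def by blast
  qed
  then show "x \<in> extends_to C Q" using ciH x unfolding extends_to_def by (auto simp: Hom_def)
qed

end

section \<open>The simplex category and its iterated wreath products\<close>

lemma Delta_simps [simp]:
  "Obj Delta = UNIV" "Dom Delta = ddom" "Cod Delta = dcod"
  "Ide Delta m = DA m m (\<lambda>i \<in> {..m}. i)"
  "Cmp Delta e d = DA (ddom d) (dcod e) (compose {..ddom d} (dfun e) (dfun d))"
  by (simp_all add: Delta_def)

lemma Hom_Delta: "d \<in> Hom Delta m q \<longleftrightarrow>
    (\<exists>f. d = DA m q f \<and> f \<in> {..m} \<rightarrow>\<^sub>E {..q} \<and> mono_on {..m} f)"
  by (cases d) (auto simp: Hom_def Delta_def)

lemma category_Delta: "category Delta"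
proof
  show "Cmp Delta g f \<in> Hom Delta x z" if "f \<in> Hom Delta x y" "g \<in> Hom Delta y z" for f g x y z
    using that unfolding Hom_Delta
    by (fastforce simp: compose_def mono_on_def PiE_iff Pi_iff)
  show "Cmp Delta h (Cmp Delta g f) = Cmp Delta (Cmp Delta h g) f"
    if "f \<in> Hom Delta x y" "g \<in> Hom Delta y z" "h \<in> Hom Delta z w" for f g h x y z w
    using that unfolding Hom_Delta by (auto simp: compose_def PiE_iff)
  show "Cmp Delta (Ide Delta y) f = f" "Cmp Delta f (Ide Delta x) = f"
    if "f \<in> Hom Delta x y" for f x y
    using that unfolding Hom_Delta
    by (auto simp: compose_def PiE_iff restrict_def extensional_def fun_eq_iff)
qed (auto simp: Hom_Delta mono_on_def)

lemma finite_Hom_Delta: "finite (Hom Delta m q)"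
proof -
  have "Hom Delta m q \<subseteq> DA m q ` ({..m} \<rightarrow>\<^sub>E {..q})" by (auto simp: Hom_Delta)
  then show ?thesis by (rule finite_subset) (simp add: finite_PiE)
qed

text \<open>The constant map with value \<open>v\<close>. A map in \<open>Delta\<close> factors through \<open>[0]\<close> if and
  only if it is of this form.\<close>

definition cns :: "nat \<Rightarrow> nat \<Rightarrow> nat \<Rightarrow> dar" where
  "cns m q v = DA m q (\<lambda>i \<in> {..m}. v)"

lemma cns_Hom: "v \<le> q \<Longrightarrow> cns m q v \<in> Hom Delta m q"
  by (auto simp: Hom_Delta cns_def mono_on_def)

lemma Cmp_cns: "d \<in> Hom Delta m q \<Longrightarrow> Cmp Delta (cns q r v) d = cns m r v"
  by (auto simp: Hom_Delta cns_def compose_def PiE_iff)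

lemma Hom_Delta_0: "d \<in> Hom Delta m 0 \<Longrightarrow> d = cns m 0 0"
  by (auto simp: Hom_Delta cns_def PiE_iff extensional_def fun_eq_iff)

lemma Cmp_const: "d \<in> Hom Delta q r \<Longrightarrow> v \<le> q \<Longrightarrow> Cmp Delta d (cns m q v) = cns m r (dfun d v)"
  by (auto simp: Hom_Delta cns_def compose_def PiE_iff)

text \<open>The intervals \<open>{d (i - 1)<..d i}\<close> behave functorially: for the composite, the interval at
  \<open>i\<close> is the union of the intervals of \<open>e\<close> at the elements \<open>j\<close> of the interval of
  \<open>d\<close> at \<open>i\<close>. As the intervals of \<open>e\<close> are disjoint, the intermediate \<open>j\<close> is
  unique (\<open>tidx_unique\<close>), which makes the composition of \<open>Theta C\<close> well defined.\<close>

lemma tidx_Cmp: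
  assumes d: "d \<in> Hom Delta m q" and e: "e \<in> Hom Delta q r"
  shows "(i, k) \<in> tidx (Cmp Delta e d) \<longleftrightarrow> (\<exists>j. (i, j) \<in> tidx d \<and> (j, k) \<in> tidx e)"
proof
  obtain f g where f: "d = DA m q f" "f \<in> {..m} \<rightarrow>\<^sub>E {..q}" "mono_on {..m} f"
    and g: "e = DA q r g" "g \<in> {..q} \<rightarrow>\<^sub>E {..r}" "mono_on {..q} g"
    using d e unfolding Hom_Delta by auto
  {
    assume "(i, k) \<in> tidx (Cmp Delta e d)"
    then have ik: "1 \<le> i" "i \<le> m" "g (f (i - 1)) < k" "k \<le> g (f i)"
      using f g by (auto simp: tidx_def compose_def split: if_splits)
    \<comment> \<open>The interval of \<open>e\<close> that contains \<open>k\<close> ends at the first value of at least \<open>k\<close>.\<close>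
    define j where "j = (LEAST j. k \<le> g j)"
    have j1: "k \<le> g j" unfolding j_def by (rule LeastI[of "\<lambda>j. k \<le> g j", OF ik(4)])
    have j2: "j \<le> f i" unfolding j_def by (rule Least_le) (rule ik)
    have fi: "f i \<le> q" "f (i - 1) \<le> q" using f ik by (auto simp: PiE_iff)
    have j3: "f (i - 1) < j"
    proof (rule ccontr)
      assume "\<not> f (i - 1) < j"
      then have "g j \<le> g (f (i - 1))" using g fi by (auto simp: mono_on_def)
      then show False using ik j1 by simp
    qed
    have "g (j - 1) < k" using not_less_Least[of "j - 1" "\<lambda>j. k \<le> g j"] j3 unfolding j_def[symmetric] by auto
    then have "(i, j) \<in> tidx d \<and> (j, k) \<in> tidx e"
      using j1 j2 j3 fi ik f g by (auto simp: tidx_def)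
    then show "\<exists>j. (i, j) \<in> tidx d \<and> (j, k) \<in> tidx e" by blast
  next
    assume "\<exists>j. (i, j) \<in> tidx d \<and> (j, k) \<in> tidx e"
    then obtain j where ij: "1 \<le> i" "i \<le> m" "f (i - 1) < j" "j \<le> f i"
      and jk: "1 \<le> j" "j \<le> q" "g (j - 1) < k" "k \<le> g j"
      using f g by (auto simp: tidx_def)
    have fi: "f i \<le> q" "f (i - 1) \<le> q" using f ij by (auto simp: PiE_iff)
    have "f (i - 1) \<le> j - 1" "j - 1 \<le> q" using ij jk by auto
    then have "g (f (i - 1)) \<le> g (j - 1)" "g j \<le> g (f i)"
      using g(3) fi ij jk by (auto simp: mono_on_def)
    then show "(i, k) \<in> tidx (Cmp Delta e d)"
      using f g ij jk by (auto simp: tidx_def compose_def)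
  }
qed

lemma tidx_unique:
  assumes e: "e \<in> Hom Delta q r" and "(j, k) \<in> tidx e" "(j', k) \<in> tidx e"
  shows "j = j'"
proof -
  obtain g where g: "e = DA q r g" "mono_on {..q} g"
    using e unfolding Hom_Delta by auto
  have *: False if "j < j'" "(j, k) \<in> tidx e" "(j', k) \<in> tidx e" for j j'
  proof -
    have "j \<le> j' - 1" "j' - 1 \<le> q" using that g by (auto simp: tidx_def)
    then have "g j \<le> g (j' - 1)" using g(2) by (auto simp: mono_on_def)
    then show False using that g(1) by (auto simp: tidx_def)
  qed
  show ?thesis using *[of j j'] *[of j' j] assms by (cases j j' rule: linorder_cases) auto
qed

lemma tidx_Ide: "(i, j) \<in> tidx (Ide Delta m) \<longleftrightarrow> j = i \<and> 1 \<le> i \<and> i \<le> m"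
  by (auto simp: tidx_def)

lemma finite_tidx: "d \<in> Hom Delta m q \<Longrightarrow> finite (tidx d)"
  by (rule finite_subset[of _ "{..m} \<times> {..q}"])
    (auto simp: tidx_def Hom_Delta PiE_iff intro: order.trans)

lemma Theta_simps [simp]:
  "Obj (Theta C) = {\<theta>. set (sub \<theta>) \<subseteq> Obj C}" "Dom (Theta C) = tsrc" "Cod (Theta C) = ttgt"
  by (simp_all add: Theta_def)

lemma Hom_Theta: "h \<in> Hom (Theta C) \<theta> \<theta>' \<longleftrightarrow> (\<exists>d f. h = TMor \<theta> \<theta>' d f \<and>
    set (sub \<theta>) \<subseteq> Obj C \<and> set (sub \<theta>') \<subseteq> Obj C \<and>
    d \<in> Hom Delta (length (sub \<theta>)) (length (sub \<theta>')) \<and>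
    (\<forall>i j. (i, j) \<in> tidx d \<longrightarrow> f i j \<in> Hom C (sub \<theta> ! (i - 1)) (sub \<theta>' ! (j - 1))) \<and>
    (\<forall>i j. (i, j) \<notin> tidx d \<longrightarrow> f i j = undefined))"
proof -
  have "(\<forall>i j. if (i, j) \<in> tidx d then P i j else f i j = undefined) \<longleftrightarrow>
    (\<forall>i j. (i, j) \<in> tidx d \<longrightarrow> P i j) \<and> (\<forall>i j. (i, j) \<notin> tidx d \<longrightarrow> f i j = undefined)"
    for d and P :: "nat \<Rightarrow> nat \<Rightarrow> bool" and f :: "nat \<Rightarrow> nat \<Rightarrow> tmor" by metis
  then have "Arr (Theta C) = {TMor \<theta> \<theta>' d f | \<theta> \<theta>' d f.
        set (sub \<theta>) \<subseteq> Obj C \<and> set (sub \<theta>') \<subseteq> Obj C \<and>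
        d \<in> Hom Delta (length (sub \<theta>)) (length (sub \<theta>')) \<and>
        (\<forall>i j. (i, j) \<in> tidx d \<longrightarrow> f i j \<in> Hom C (sub \<theta> ! (i - 1)) (sub \<theta>' ! (j - 1))) \<and>
        (\<forall>i j. (i, j) \<notin> tidx d \<longrightarrow> f i j = undefined)}"
    unfolding Theta_def by simp
  then show ?thesis unfolding Hom_def[of "Theta C"] by auto
qed

lemma Ide_Theta: "Ide (Theta C) \<theta> = TMor \<theta> \<theta> (Ide Delta (length (sub \<theta>)))
  (\<lambda>i j. if (i, j) \<in> tidx (Ide Delta (length (sub \<theta>))) then Ide C (sub \<theta> ! (i - 1)) else undefined)"
  by (simp add: Theta_def)

lemma Cmp_Theta_sel: "tsrc (Cmp (Theta C) g f) = tsrc f" "ttgt (Cmp (Theta C) g f) = ttgt g"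
  "tdel (Cmp (Theta C) g f) = Cmp Delta (tdel g) (tdel f)"
  "(i, k) \<notin> tidx (Cmp Delta (tdel g) (tdel f)) \<Longrightarrow> tcmp (Cmp (Theta C) g f) i k = undefined"
  by (simp_all add: Theta_def)

lemma Cmp_Theta_tcmp:
  assumes "tdel f \<in> Hom Delta m q" "tdel g \<in> Hom Delta q r"
    and "(i, j) \<in> tidx (tdel f)" "(j, k) \<in> tidx (tdel g)"
  shows "tcmp (Cmp (Theta C) g f) i k = Cmp C (tcmp g j k) (tcmp f i j)"
proof -
  have ik: "(i, k) \<in> tidx (Cmp Delta (tdel g) (tdel f))" using tidx_Cmp[OF assms(1,2)] assms(3,4) by blast
  have "(THE j. (i, j) \<in> tidx (tdel f) \<and> (j, k) \<in> tidx (tdel g)) = j"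
    using assms(3,4) tidx_unique[OF assms(2)] by blast
  then show ?thesis using ik by (simp add: Theta_def Let_def del: Delta_simps)
qed

text \<open>Identities and associativity hold for the maps of ordinals and, after the intermediate indices have
  been identified by \<open>Cmp_Theta_tcmp\<close>, for each component separately.\<close>

lemma category_Theta:
  assumes "category C"
  shows "category (Theta C)"
proof -
  interpret C: category C by fact
  interpret Delta: category Delta by (rule category_Delta)
  have HomD: "tsrc h = \<theta>" "ttgt h = \<theta>'" "set (sub \<theta>) \<subseteq> Obj C" "set (sub \<theta>') \<subseteq> Obj C"
    "tdel h \<in> Hom Delta (length (sub \<theta>)) (length (sub \<theta>'))"
    "\<And>i j. (i, j) \<in> tidx (tdel h) \<Longrightarrow> tcmp h i j \<in> Hom C (sub \<theta> ! (i - 1)) (sub \<theta>' ! (j - 1))"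
    "\<And>i j. (i, j) \<notin> tidx (tdel h) \<Longrightarrow> tcmp h i j = undefined"
    if "h \<in> Hom (Theta C) \<theta> \<theta>'" for h \<theta> \<theta>'
    using that by (auto simp: Hom_Theta)
  have HomI: "h \<in> Hom (Theta C) \<theta> \<theta>'"
    if "tsrc h = \<theta>" "ttgt h = \<theta>'" "set (sub \<theta>) \<subseteq> Obj C" "set (sub \<theta>') \<subseteq> Obj C"
    "tdel h \<in> Hom Delta (length (sub \<theta>)) (length (sub \<theta>'))" "h \<noteq> Pt"
    "\<And>i j. (i, j) \<in> tidx (tdel h) \<Longrightarrow> tcmp h i j \<in> Hom C (sub \<theta> ! (i - 1)) (sub \<theta>' ! (j - 1))"
    "\<And>i j. (i, j) \<notin> tidx (tdel h) \<Longrightarrow> tcmp h i j = undefined" for h \<theta> \<theta>'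
    using that by (cases h) (auto simp: Hom_Theta)
  have nPt: "Cmp (Theta C) g f \<noteq> Pt" "Ide (Theta C) \<theta> \<noteq> Pt" for g f \<theta>
    by (simp_all add: Theta_def)
  have eqI: "h = h'" if "h \<in> Hom (Theta C) \<theta> \<theta>'" "h' \<in> Hom (Theta C) \<theta> \<theta>'" "tdel h = tdel h'"
    "\<And>i j. (i, j) \<in> tidx (tdel h) \<Longrightarrow> tcmp h i j = tcmp h' i j" for h h' \<theta> \<theta>'
  proof (rule tmor.expand)
    show "(h = Pt) = (h' = Pt)" using that by (auto simp: Hom_Theta)
    have "tcmp h i j = tcmp h' i j" for i j
      using that HomD(7)[OF that(1)] HomD(7)[OF that(2)] by (cases "(i, j) \<in> tidx (tdel h)") auto
    then show "h \<noteq> Pt \<Longrightarrow> h' \<noteq> Pt \<Longrightarrow>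
      tsrc h = tsrc h' \<and> ttgt h = ttgt h' \<and> tdel h = tdel h' \<and> tcmp h = tcmp h'"
      using HomD(1,2)[OF that(1)] HomD(1,2)[OF that(2)] that(3) by (simp add: fun_eq_iff)
  qed
  have cmp: "Cmp (Theta C) g f \<in> Hom (Theta C) x z"
    if f: "f \<in> Hom (Theta C) x y" and g: "g \<in> Hom (Theta C) y z" for f g x y z
  proof (rule HomI)
    note f = HomD[OF f] and g = HomD[OF g]
    show "tdel (Cmp (Theta C) g f) \<in> Hom Delta (length (sub x)) (length (sub z))"
      using Delta.Cmp_Hom[OF f(5) g(5)] by (simp only: Cmp_Theta_sel)
    show "tcmp (Cmp (Theta C) g f) i k \<in> Hom C (sub x ! (i - 1)) (sub z ! (k - 1))"
      if ik: "(i, k) \<in> tidx (tdel (Cmp (Theta C) g f))" for i k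
    proof -
      obtain j where j: "(i, j) \<in> tidx (tdel f)" "(j, k) \<in> tidx (tdel g)"
        using ik tidx_Cmp[OF f(5) g(5)] by (auto simp only: Cmp_Theta_sel)
      then show ?thesis using Cmp_Theta_tcmp[OF f(5) g(5) j, of C] C.Cmp_Hom[OF f(6) g(6)] by simp
    qed
    show "tcmp (Cmp (Theta C) g f) i k = undefined" if "(i, k) \<notin> tidx (tdel (Cmp (Theta C) g f))" for i k
      using that Cmp_Theta_sel(3,4) by metis
  qed (use HomD(1-4)[OF f] HomD(1-4)[OF g] nPt in \<open>simp_all only: Cmp_Theta_sel(1,2) simp_thms\<close>)
  have ide: "Ide (Theta C) x \<in> Hom (Theta C) x x" if x: "x \<in> Obj (Theta C)" for x
  proof -
    have "sub x ! (i - 1) \<in> Obj C" if "1 \<le> i" "i \<le> length (sub x)" for i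
    proof -
      have "sub x ! (i - 1) \<in> set (sub x)" using that by (intro nth_mem) auto
      then show ?thesis using x by auto
    qed
    then show ?thesis
      using x Delta.Ide_Hom[of "length (sub x)"] unfolding Hom_Theta Ide_Theta
      by (intro exI conjI refl) (auto simp: tidx_Ide intro!: C.Ide_Hom simp del: Delta_simps(2-5))
  qed
  have tI: "tdel (Ide (Theta C) x) = Ide Delta (length (sub x))" for x by (simp add: Ide_Theta)
  have tI2: "tcmp (Ide (Theta C) x) i i = Ide C (sub x ! (i - 1))" if "1 \<le> i" "i \<le> length (sub x)" for x i
    using that by (simp add: Ide_Theta tidx_Ide del: Delta_simps)
  have bnd: "1 \<le> i \<and> i \<le> m \<and> 1 \<le> j \<and> j \<le> q" if "(i, j) \<in> tidx d" "d \<in> Hom Delta m q" for i j d m q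
    using that by (auto simp: tidx_def Hom_Delta PiE_iff intro: order.trans)
  show ?thesis
  proof
    show "x \<in> Obj (Theta C) \<and> y \<in> Obj (Theta C)" if "f \<in> Hom (Theta C) x y" for f x y
      using that by (auto simp: Hom_Theta)
    fix f x y assume f: "f \<in> Hom (Theta C) x y"
    then have xy: "x \<in> Obj (Theta C)" "y \<in> Obj (Theta C)" by (auto simp: Hom_Theta)
    note f' = HomD[OF f]
    show "Cmp (Theta C) (Ide (Theta C) y) f = f"
    proof (rule eqI[OF cmp[OF f ide[OF xy(2)]] f])
      show del: "tdel (Cmp (Theta C) (Ide (Theta C) y) f) = tdel f"
        using Delta.Cmp_Ide_left[OF f'(5)] by (simp only: Cmp_Theta_sel tI)
      fix i j assume "(i, j) \<in> tidx (tdel (Cmp (Theta C) (Ide (Theta C) y) f))"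
      then have ij: "(i, j) \<in> tidx (tdel f)" using del by simp
      have j: "(j, j) \<in> tidx (tdel (Ide (Theta C) y))"
        using bnd[OF ij f'(5)] by (simp only: tI tidx_Ide)
      show "tcmp (Cmp (Theta C) (Ide (Theta C) y) f) i j = tcmp f i j"
        using Cmp_Theta_tcmp[OF f'(5) HomD(5)[OF ide[OF xy(2)]] ij j] bnd[OF ij f'(5)]
          C.Cmp_Ide_left[OF f'(6)[OF ij]] tI2 by simp
    qed
    show "Cmp (Theta C) f (Ide (Theta C) x) = f"
    proof (rule eqI[OF cmp[OF ide[OF xy(1)] f] f])
      show del: "tdel (Cmp (Theta C) f (Ide (Theta C) x)) = tdel f"
        using Delta.Cmp_Ide_right[OF f'(5)] by (simp only: Cmp_Theta_sel tI)
      fix i j assume "(i, j) \<in> tidx (tdel (Cmp (Theta C) f (Ide (Theta C) x)))"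
      then have ij: "(i, j) \<in> tidx (tdel f)" using del by simp
      have j: "(i, i) \<in> tidx (tdel (Ide (Theta C) x))"
        using bnd[OF ij f'(5)] by (simp only: tI tidx_Ide)
      show "tcmp (Cmp (Theta C) f (Ide (Theta C) x)) i j = tcmp f i j"
        using Cmp_Theta_tcmp[OF HomD(5)[OF ide[OF xy(1)]] f'(5) j ij] bnd[OF ij f'(5)]
          C.Cmp_Ide_right[OF f'(6)[OF ij]] tI2 by simp
    qed
    fix g h z w assume g: "g \<in> Hom (Theta C) y z" and h: "h \<in> Hom (Theta C) z w"
    note g' = HomD[OF g] and h' = HomD[OF h]
    note gf = cmp[OF f g] and hg = cmp[OF g h]
    show "Cmp (Theta C) h (Cmp (Theta C) g f) = Cmp (Theta C) (Cmp (Theta C) h g) f"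
    proof (rule eqI[OF cmp[OF gf h] cmp[OF f hg]])
      show "tdel (Cmp (Theta C) h (Cmp (Theta C) g f)) = tdel (Cmp (Theta C) (Cmp (Theta C) h g) f)"
        using Delta.Cmp_assoc[OF f'(5) g'(5) h'(5)] by (simp only: Cmp_Theta_sel)
      fix i l assume il: "(i, l) \<in> tidx (tdel (Cmp (Theta C) h (Cmp (Theta C) g f)))"
      then obtain k where k: "(i, k) \<in> tidx (tdel (Cmp (Theta C) g f))" "(k, l) \<in> tidx (tdel h)"
        using tidx_Cmp[OF HomD(5)[OF gf] h'(5)] by (auto simp only: Cmp_Theta_sel)
      then obtain j where j: "(i, j) \<in> tidx (tdel f)" "(j, k) \<in> tidx (tdel g)"
        using tidx_Cmp[OF f'(5) g'(5)] by (auto simp only: Cmp_Theta_sel)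
      have jl: "(j, l) \<in> tidx (tdel (Cmp (Theta C) h g))"
        using tidx_Cmp[OF g'(5) h'(5)] j k by (auto simp only: Cmp_Theta_sel)
      show "tcmp (Cmp (Theta C) h (Cmp (Theta C) g f)) i l = tcmp (Cmp (Theta C) (Cmp (Theta C) h g) f) i l"
        using Cmp_Theta_tcmp[OF HomD(5)[OF gf] h'(5) k, of C] Cmp_Theta_tcmp[OF f'(5) g'(5) j, of C]
          Cmp_Theta_tcmp[OF f'(5) HomD(5)[OF hg] j(1) jl, of C] Cmp_Theta_tcmp[OF g'(5) h'(5) j(2) k(2), of C]
          C.Cmp_assoc[OF f'(6)[OF j(1)] g'(6)[OF j(2)] h'(6)[OF k(2)]] by simp
    qed
  qed (use cmp ide in blast)+
qed

lemma finite_Hom_Theta: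
  assumes "\<And>x y. finite (Hom C x y)"
  shows "finite (Hom (Theta C) \<theta> \<theta>')"
proof -
  let ?H = "Hom Delta (length (sub \<theta>)) (length (sub \<theta>'))"
  let ?P = "\<lambda>d. \<Pi>\<^sub>E p \<in> tidx d. Hom C (sub \<theta> ! (fst p - 1)) (sub \<theta>' ! (snd p - 1))"
  have "Hom (Theta C) \<theta> \<theta>' \<subseteq> (\<Union>d \<in> ?H. (\<lambda>f. TMor \<theta> \<theta>' d (curry f)) ` ?P d)"
  proof
    fix h assume "h \<in> Hom (Theta C) \<theta> \<theta>'"
    then obtain d f where h: "h = TMor \<theta> \<theta>' d f" and d: "d \<in> ?H"
      and f: "\<And>i j. (i, j) \<in> tidx d \<Longrightarrow> f i j \<in> Hom C (sub \<theta> ! (i - 1)) (sub \<theta>' ! (j - 1))"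
      "\<And>i j. (i, j) \<notin> tidx d \<Longrightarrow> f i j = undefined" unfolding Hom_Theta by blast
    have "case_prod f \<in> ?P d" using f by (auto simp: PiE_iff extensional_def)
    then show "h \<in> (\<Union>d \<in> ?H. (\<lambda>f. TMor \<theta> \<theta>' d (curry f)) ` ?P d)"
      using h d by (intro UN_I[of d] image_eqI[of _ _ "case_prod f"]) auto
  qed
  moreover have "finite (?P d)" if "d \<in> ?H" for d
    by (intro finite_PiE finite_tidx[OF that] assms)
  then have "finite (\<Union>d \<in> ?H. (\<lambda>f. TMor \<theta> \<theta>' d (curry f)) ` ?P d)"
    by (intro finite_UN_I finite_Hom_Delta finite_imageI)
  ultimately show ?thesis by (rule finite_subset)
qed

lemma category_theta: "category (theta n)"
proof (induction n)
  case 0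
  show ?case by unfold_locales (auto simp: Hom_def)
qed (simp add: category_Theta)

text \<open>Finiteness is what allows sets of arrows, and sets of such sets, to be encoded in any infinite
  type.\<close>

lemma finite_Hom_theta: "finite (Hom (theta n) \<theta> \<theta>')"
proof (induction n arbitrary: \<theta> \<theta>')
  case 0
  show ?case by (rule finite_subset[of _ "{Pt}"]) (auto simp: Hom_def)
qed (simp add: finite_Hom_Theta)

text \<open>The arrow is constant at the vertex \<open>0\<close>; such an arrow has no components. This is used
  for \<open>cofree_SegPre\<close>, where the values in degree zero must not depend on the object of
  \<open>theta n\<close>.\<close>

lemma Hom_theta_nonempty:
  assumes "\<theta> \<in> Obj (theta n)" "\<theta>' \<in> Obj (theta n)"
  shows "Hom (theta n) \<theta> \<theta>' \<noteq> {}"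
proof (cases n)
  case 0
  then show ?thesis using assms by (auto simp: Hom_def)
next
  case (Suc k)
  have "TMor \<theta> \<theta>' (cns (length (sub \<theta>)) (length (sub \<theta>')) 0) (\<lambda>_ _. undefined) \<in> Hom (theta n) \<theta> \<theta>'"
    using assms Suc cns_Hom[of 0 "length (sub \<theta>')" "length (sub \<theta>)"]
    by (auto simp: Hom_Theta tidx_def cns_def)
  then show ?thesis by blast
qed

section \<open>The indexing category of simplicial objects\<close>

type_synonym site_ob = "nat \<times> tree \<times> nat"
type_synonym site_ar = "dar \<times> tmor \<times> dar"

text \<open>A functor from the opposite of \<open>Delta\<close> to \<open>ThetaSp n\<close> is a presheaf of sets on this
  category. The first coordinate is its own simplicial direction, the last one that of its values.\<close>

definition site :: "nat \<Rightarrow> (site_ob, site_ar) cat" where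
  "site n = \<lparr>Obj = UNIV \<times> Obj (theta n) \<times> UNIV, Arr = Arr Delta \<times> Arr (theta n) \<times> Arr Delta,
     Dom = (\<lambda>(a, f, b). (ddom a, Dom (theta n) f, ddom b)),
     Cod = (\<lambda>(a, f, b). (dcod a, Cod (theta n) f, dcod b)),
     Ide = (\<lambda>(k, \<theta>, m). (Ide Delta k, Ide (theta n) \<theta>, Ide Delta m)),
     Cmp = (\<lambda>(a, f, b) (a', f', b'). (Cmp Delta a a', Cmp (theta n) f f', Cmp Delta b b'))\<rparr>"

lemma site_simps [simp]:
  "Obj (site n) = UNIV \<times> Obj (theta n) \<times> UNIV"
  "Ide (site n) (k, \<theta>, m) = (Ide Delta k, Ide (theta n) \<theta>, Ide Delta m)"
  "Cmp (site n) (a, f, b) (a', f', b') = (Cmp Delta a a', Cmp (theta n) f f', Cmp Delta b b')"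
  by (simp_all add: site_def)

lemma Hom_site: "Hom (site n) (k, \<theta>, m) (k', \<theta>', m') =
    Hom Delta k k' \<times> Hom (theta n) \<theta> \<theta>' \<times> Hom Delta m m'"
  by (auto simp: Hom_def site_def)

lemma Hom_siteE:
  assumes "p \<in> Hom (site n) c c'"
  obtains k \<theta> m k' \<theta>' m' a f b where "p = (a, f, b)" "c = (k, \<theta>, m)" "c' = (k', \<theta>', m')"
    "a \<in> Hom Delta k k'" "f \<in> Hom (theta n) \<theta> \<theta>'" "b \<in> Hom Delta m m'"
  using assms by (cases c; cases c') (auto simp: Hom_site)

lemma category_site: "category (site n)"
proof -
  interpret D: category Delta by (rule category_Delta)
  interpret T: category "theta n" by (rule category_theta)
  show ?thesis
  proof
    fix f x y assume "f \<in> Hom (site n) x y"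
    then show "x \<in> Obj (site n) \<and> y \<in> Obj (site n)"
      by (elim Hom_siteE) (use T.Hom_Obj in auto)
  next
    fix x assume "x \<in> Obj (site n)"
    then show "Ide (site n) x \<in> Hom (site n) x x"
      using D.Ide_Hom T.Ide_Hom by (cases x) (simp add: Hom_site del: Delta_simps(2-))
  next
    fix f g x y z assume "f \<in> Hom (site n) x y" "g \<in> Hom (site n) y z"
    then show "Cmp (site n) g f \<in> Hom (site n) x z"
      by (elim Hom_siteE) (simp add: Hom_site D.Cmp_Hom T.Cmp_Hom del: Delta_simps)
  next
    fix f g h x y z w
    assume "f \<in> Hom (site n) x y" "g \<in> Hom (site n) y z" "h \<in> Hom (site n) z w"
    then show "Cmp (site n) h (Cmp (site n) g f) = Cmp (site n) (Cmp (site n) h g) f"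
      by (elim Hom_siteE) (simp add: D.Cmp_assoc T.Cmp_assoc del: Delta_simps)
  next
    fix f x y assume "f \<in> Hom (site n) x y"
    then show "Cmp (site n) (Ide (site n) y) f = f" "Cmp (site n) f (Ide (site n) x) = f"
      by (elim Hom_siteE, simp add: D.Cmp_Ide_left T.Cmp_Ide_left D.Cmp_Ide_right T.Cmp_Ide_right
        del: Delta_simps)+
  qed
qed

lemma finite_Hom_site: "finite (Hom (site n) c d)"
  by (cases c; cases d) (simp add: Hom_site finite_Hom_Delta finite_Hom_theta)

lemma Hom_site_nonempty:
  assumes "c \<in> Obj (site n)" "d \<in> Obj (site n)"
  shows "Hom (site n) c d \<noteq> {}"
proof -
  obtain k \<theta> m k' \<theta>' m' where "c = (k, \<theta>, m)" "d = (k', \<theta>', m')" by (cases c; cases d)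
  then show ?thesis using assms Hom_theta_nonempty[of \<theta> n \<theta>'] cns_Hom[OF le0]
    by (auto simp: Hom_site)
qed

section \<open>Set-valued functors in terms of elements\<close>

lemma SetC_simps [simp]:
  "Obj SetC = {A. small A}" "Dom SetC = sdom" "Cod SetC = scod"
  "Ide SetC A = \<lparr>sdom = A, scod = A, sfun = (\<lambda>x \<in> A. x)\<rparr>"
  "Cmp SetC g f = \<lparr>sdom = sdom f, scod = scod g, sfun = compose (sdom f) (sfun g) (sfun f)\<rparr>"
  by (simp_all add: SetC_def)

lemma Hom_SetC: "f \<in> Hom SetC A B \<longleftrightarrow> small A \<and> small B \<and> sdom f = A \<and> scod f = B \<and>
    sfun f \<in> A \<rightarrow>\<^sub>E B"
  by (auto simp: Hom_def SetC_def)

lemma sar_eqI: "f \<in> Hom SetC A B \<Longrightarrow> g \<in> Hom SetC A B \<Longrightarrow>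
    (\<And>x. x \<in> A \<Longrightarrow> sfun f x = sfun g x) \<Longrightarrow> f = g"
  by (cases f; cases g) (auto simp: Hom_SetC intro: PiE_ext)

lemma sfun_Cmp: "f \<in> Hom SetC A B \<Longrightarrow> x \<in> A \<Longrightarrow> sfun (Cmp SetC g f) x = sfun g (sfun f x)"
  by (auto simp: Hom_SetC compose_def)

lemma category_SetC: "category SetC"
  by unfold_locales (auto simp: Hom_SetC compose_def PiE_iff intro!: sar_eqI)

definition mk_sar :: "'u set \<Rightarrow> 'u set \<Rightarrow> ('u \<Rightarrow> 'u) \<Rightarrow> 'u sar" where
  "mk_sar A B g = \<lparr>sdom = A, scod = B, sfun = restrict g A\<rparr>"

lemma mk_sar_Hom: "small A \<Longrightarrow> small B \<Longrightarrow> (\<And>x. x \<in> A \<Longrightarrow> g x \<in> B) \<Longrightarrow> mk_sar A B g \<in> Hom SetC A B"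
  by (auto simp: Hom_SetC mk_sar_def)

lemma sfun_mk_sar [simp]: "x \<in> A \<Longrightarrow> sfun (mk_sar A B g) x = g x"
  by (simp add: mk_sar_def)

lemma setF_small: "is_functor C SetC F \<Longrightarrow> c \<in> Obj C \<Longrightarrow> small (fob F c)"
  using is_functorD(3)[of C SetC F] by simp

lemma setF_in: "is_functor C SetC F \<Longrightarrow> g \<in> Hom C c d \<Longrightarrow> x \<in> fob F c \<Longrightarrow> sfun (far F g) x \<in> fob F d"
  using is_functorD(4)[of C SetC F g c d] by (auto simp: Hom_SetC)

lemma setF_Ide: "is_functor C SetC F \<Longrightarrow> c \<in> Obj C \<Longrightarrow> x \<in> fob F c \<Longrightarrow> sfun (far F (Ide C c)) x = x"
  using is_functorD(5)[of C SetC F c] by simp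

lemma setF_Cmp: "is_functor C SetC F \<Longrightarrow> f \<in> Hom C b c \<Longrightarrow> g \<in> Hom C c d \<Longrightarrow> x \<in> fob F b \<Longrightarrow>
    sfun (far F (Cmp C g f)) x = sfun (far F g) (sfun (far F f) x)"
  using is_functorD(6)[of C SetC F f b c g d] sfun_Cmp[OF is_functorD(4)] by metis

lemma setN_in: "t \<in> Hom (fun_cat C SetC) F G \<Longrightarrow> c \<in> Obj C \<Longrightarrow> x \<in> fob F c \<Longrightarrow> sfun (ncmp t c) x \<in> fob G c"
  using is_ntrD(4)[of C SetC t c] by (auto simp: Hom_fun_cat Hom_SetC)

lemma setN_nat: "t \<in> Hom (fun_cat C SetC) F G \<Longrightarrow> g \<in> Hom C c d \<Longrightarrow> c \<in> Obj C \<Longrightarrow> x \<in> fob F c \<Longrightarrow>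
    sfun (far G g) (sfun (ncmp t c) x) = sfun (ncmp t d) (sfun (far F g) x)"
  using is_ntrD(5)[of C SetC t g c d] sfun_Cmp[OF is_ntrD(4)[of C SetC t c], of x "far G g"]
    sfun_Cmp[OF is_functorD(4)[of C SetC F g c d], of x "ncmp t d"] is_ntrD(1)[of C SetC t]
  by (auto simp: Hom_fun_cat simp del: SetC_simps)

lemma funN_in: "t \<in> Hom (fun_cat C D) F G \<Longrightarrow> c \<in> Obj C \<Longrightarrow> ncmp t c \<in> Hom D (fob F c) (fob G c)"
  using is_ntrD(4)[of C D t c] by (auto simp: Hom_fun_cat)

lemma ncmp_Cmp [simp]: "c \<in> Obj C \<Longrightarrow> ncmp (Cmp (fun_cat C D) u t) c = Cmp D (ncmp u c) (ncmp t c)"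
  by simp

lemma ncmp_Ide [simp]: "c \<in> Obj C \<Longrightarrow> ncmp (Ide (fun_cat C D) F) c = Ide D (fob F c)"
  by simp

lemma setN_Cmp: "t \<in> Hom (fun_cat C SetC) F G \<Longrightarrow> c \<in> Obj C \<Longrightarrow> x \<in> fob F c \<Longrightarrow>
    sfun (ncmp (Cmp (fun_cat C SetC) u t) c) x = sfun (ncmp u c) (sfun (ncmp t c) x)"
  using sfun_Cmp[OF funN_in] by (metis ncmp_Cmp)

lemma setN_Ide: "c \<in> Obj C \<Longrightarrow> x \<in> fob F c \<Longrightarrow> sfun (ncmp (Ide (fun_cat C SetC) F) c) x = x"
  by simp

lemma setN_eqI:
  assumes "t \<in> Hom (fun_cat C SetC) F G" "t' \<in> Hom (fun_cat C SetC) F G"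
    and "\<And>c x. c \<in> Obj C \<Longrightarrow> x \<in> fob F c \<Longrightarrow> sfun (ncmp t c) x = sfun (ncmp t' c) x"
  shows "t = t'"
  using assms by (intro ntr_eqI[OF assms(1,2)] sar_eqI[OF funN_in funN_in]) auto

definition mk_ntr :: "('o, 'a) cat \<Rightarrow> ('o, 'a, 'u set, 'u sar) func \<Rightarrow> ('o, 'a, 'u set, 'u sar) func \<Rightarrow>
    ('o \<Rightarrow> 'u \<Rightarrow> 'u) \<Rightarrow> ('o, 'a, 'u set, 'u sar) ntr" where
  "mk_ntr C F G \<phi> = \<lparr>nsrc = F, ntgt = G, ncmp = (\<lambda>c \<in> Obj C. mk_sar (fob F c) (fob G c) (\<phi> c))\<rparr>"

lemma sfun_mk_ntr [simp]: "c \<in> Obj C \<Longrightarrow> x \<in> fob F c \<Longrightarrow> sfun (ncmp (mk_ntr C F G \<phi>) c) x = \<phi> c x"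
  by (simp add: mk_ntr_def)

lemma mk_ntr_Hom:
  assumes C: "category C" and F: "is_functor C SetC F" and G: "is_functor C SetC G"
    and "\<And>c x. c \<in> Obj C \<Longrightarrow> x \<in> fob F c \<Longrightarrow> \<phi> c x \<in> fob G c"
    and nat: "\<And>c d g x. g \<in> Hom C c d \<Longrightarrow> x \<in> fob F c \<Longrightarrow> sfun (far G g) (\<phi> c x) = \<phi> d (sfun (far F g) x)"
  shows "mk_ntr C F G \<phi> \<in> Hom (fun_cat C SetC) F G"
proof -
  interpret category C by fact
  interpret S: category SetC by (rule category_SetC)
  have comp: "mk_sar (fob F c) (fob G c) (\<phi> c) \<in> Hom SetC (fob F c) (fob G c)" if "c \<in> Obj C" for c
    using that assms(4) by (intro mk_sar_Hom setF_small[OF F] setF_small[OF G])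
  have n: "Cmp SetC (far G g) (mk_sar (fob F c) (fob G c) (\<phi> c)) =
      Cmp SetC (mk_sar (fob F d) (fob G d) (\<phi> d)) (far F g)" if g: "g \<in> Hom C c d" for g c d
  proof -
    have cd: "c \<in> Obj C" "d \<in> Obj C" using Hom_Obj[OF g] by auto
    note Fg = is_functorD(4)[OF F g] and Gg = is_functorD(4)[OF G g]
    show ?thesis
    proof (rule sar_eqI[OF S.Cmp_Hom[OF comp[OF cd(1)] Gg] S.Cmp_Hom[OF Fg comp[OF cd(2)]]])
      fix x assume x: "x \<in> fob F c"
      show "sfun (Cmp SetC (far G g) (mk_sar (fob F c) (fob G c) (\<phi> c))) x =
         sfun (Cmp SetC (mk_sar (fob F d) (fob G d) (\<phi> d)) (far F g)) x"
        using sfun_Cmp[OF comp[OF cd(1)] x, of "far G g"]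
          sfun_Cmp[OF Fg x, of "mk_sar (fob F d) (fob G d) (\<phi> d)"] nat[OF g x] x setF_in[OF F g x]
        by (simp del: SetC_simps)
    qed
  qed
  show ?thesis unfolding mk_ntr_def Hom_fun_cat
    using F G comp n by (auto intro!: is_ntrI simp del: SetC_simps simp: Hom_Obj)
qed

section \<open>Simplicial objects as presheaves on the site\<close>

definition el :: "'u spc \<Rightarrow> site_ob \<Rightarrow> 'u set" where
  "el X = (\<lambda>(k, \<theta>, m). fob (fob (fob X k) \<theta>) m)"

text \<open>The three functorialities are applied one after the other; they commute by naturality, so that the
  order is immaterial.\<close>

definition act :: "nat \<Rightarrow> 'u spc \<Rightarrow> site_ar \<Rightarrow> 'u \<Rightarrow> 'u" where
  "act n X = (\<lambda>(a, f, b) x.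
     sfun (far (fob (fob X (ddom a)) (Dom (theta n) f)) b)
       (sfun (ncmp (far (fob X (ddom a)) f) (dcod b))
         (sfun (ncmp (ncmp (far X a) (Cod (theta n) f)) (dcod b)) x)))"

definition cmp :: "'u spcmap \<Rightarrow> site_ob \<Rightarrow> 'u \<Rightarrow> 'u" where
  "cmp t = (\<lambda>(k, \<theta>, m). sfun (ncmp (ncmp (ncmp t k) \<theta>) m))"

definition is_psh :: "nat \<Rightarrow> (site_ob \<Rightarrow> 'u set) \<Rightarrow> (site_ar \<Rightarrow> 'u \<Rightarrow> 'u) \<Rightarrow> bool" where
  "is_psh n S A \<longleftrightarrow> (\<forall>c \<in> Obj (site n). small (S c)) \<and>
     (\<forall>c d p x. p \<in> Hom (site n) c d \<longrightarrow> x \<in> S d \<longrightarrow> A p x \<in> S c) \<and>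
     (\<forall>c x. c \<in> Obj (site n) \<longrightarrow> x \<in> S c \<longrightarrow> A (Ide (site n) c) x = x) \<and>
     (\<forall>c d e p q x. p \<in> Hom (site n) c d \<longrightarrow> q \<in> Hom (site n) d e \<longrightarrow> x \<in> S e \<longrightarrow>
        A (Cmp (site n) q p) x = A p (A q x))"

lemma ThetaSp_cat: "category (ThetaSp n :: ('u tsp, 'u tspmap) cat)"
  unfolding ThetaSp_def SSets_def
  by (intro category_fun_cat category_opp category_theta category_Delta category_SetC)

lemma SimpThetaSp_cat: "category (SimpThetaSp n :: ('u spc, 'u spcmap) cat)"
  unfolding SimpThetaSp_def by (intro category_fun_cat category_opp category_Delta ThetaSp_cat)

lemma spaces_functor:
  assumes "X \<in> Obj (SimpThetaSp n)"
  shows "is_functor (opp Delta) (ThetaSp n) X"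
    and "is_functor (opp (theta n)) SSets (fob X k)"
    and "\<theta> \<in> Obj (theta n) \<Longrightarrow> is_functor (opp Delta) SetC (fob (fob X k) \<theta>)"
proof -
  show 1: "is_functor (opp Delta) (ThetaSp n) X" using assms by (simp add: SimpThetaSp_def)
  show 2: "is_functor (opp (theta n)) SSets (fob X k)"
    using is_functorD(3)[OF 1, of k] by (simp add: ThetaSp_def)
  show "\<theta> \<in> Obj (theta n) \<Longrightarrow> is_functor (opp Delta) SetC (fob (fob X k) \<theta>)"
    using is_functorD(3)[OF 2, of \<theta>] by (simp add: SSets_def)
qed

context
  fixes n :: nat and X :: "'u spc"
  assumes X: "X \<in> Obj (SimpThetaSp n)"
begin

private abbreviation (input) S where "S k \<theta> m \<equiv> fob (fob (fob X k) \<theta>) m"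
private abbreviation (input) A1 where "A1 a \<theta> m x \<equiv> sfun (ncmp (ncmp (far X a) \<theta>) m) x"
private abbreviation (input) A2 where "A2 k f m x \<equiv> sfun (ncmp (far (fob X k) f) m) x"
private abbreviation (input) A3 where "A3 k \<theta> b x \<equiv> sfun (far (fob (fob X k) \<theta>) b) x"

lemma simplicial_act_Hom:
  assumes "a \<in> Hom Delta k' k"
  shows "far X a \<in> Hom (fun_cat (opp (theta n)) SSets) (fob X k) (fob X k')"
    using is_functorD(4)[OF spaces_functor(1)[OF X], of a k k'] assms by (simp add: ThetaSp_def)

lemma simplicial_act_comp_Hom:
  assumes "a \<in> Hom Delta k' k" "\<theta> \<in> Obj (theta n)"
  shows "ncmp (far X a) \<theta> \<in> Hom (fun_cat (opp Delta) SetC) (fob (fob X k) \<theta>) (fob (fob X k') \<theta>)"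
    using funN_in[OF simplicial_act_Hom[OF assms(1)], of \<theta>] assms by (simp add: SSets_def)

lemma theta_act_Hom:
  assumes "f \<in> Hom (theta n) \<theta>' \<theta>"
  shows "far (fob X k) f \<in> Hom (fun_cat (opp Delta) SetC) (fob (fob X k) \<theta>) (fob (fob X k) \<theta>')"
    using is_functorD(4)[OF spaces_functor(2)[OF X], of f \<theta> \<theta>'] assms by (simp add: SSets_def)

lemma act_eq:
  assumes "a \<in> Hom Delta k' k" "f \<in> Hom (theta n) \<theta>' \<theta>" "b \<in> Hom Delta m' m"
  shows "act n X (a, f, b) x = A3 k' \<theta>' b (A2 k' f m (A1 a \<theta> m x))"
    using assms[THEN Hom_Arr] by (simp add: act_def)

lemma simplicial_act_Ide:
  assumes "\<theta> \<in> Obj (theta n)" "x \<in> S k \<theta> m"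
  shows "A1 (Ide Delta k) \<theta> m x = x"
    using is_functorD(5)[OF spaces_functor(1)[OF X], of k] assms
    by (simp add: ThetaSp_def SSets_def del: Delta_simps(2-) SetC_simps fun_cat_simps) simp

lemma theta_act_Ide:
  assumes "\<theta> \<in> Obj (theta n)" "x \<in> S k \<theta> m"
  shows "A2 k (Ide (theta n) \<theta>) m x = x"
    using is_functorD(5)[OF spaces_functor(2)[OF X], of \<theta>] assms
    by (simp add: SSets_def del: Delta_simps(2-) SetC_simps fun_cat_simps) simp

lemma space_act_Ide:
  assumes "\<theta> \<in> Obj (theta n)" "x \<in> S k \<theta> m"
  shows "A3 k \<theta> (Ide Delta m) x = x"
    using setF_Ide[OF spaces_functor(3)[OF X assms(1)] _ assms(2)] by (simp del: Delta_simps(2-))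

lemma act_one_factor:
  assumes \<theta>: "\<theta> \<in> Obj (theta n)" and x: "x \<in> el X (k, \<theta>, m)"
  shows "a \<in> Hom Delta k' k \<Longrightarrow> act n X (a, Ide (theta n) \<theta>, Ide Delta m) x = A1 a \<theta> m x"
    and "f \<in> Hom (theta n) \<theta>' \<theta> \<Longrightarrow> act n X (Ide Delta k, f, Ide Delta m) x = A2 k f m x"
    and "b \<in> Hom Delta m' m \<Longrightarrow> act n X (Ide Delta k, Ide (theta n) \<theta>, b) x = A3 k \<theta> b x"
proof -
  interpret D: category Delta by (rule category_Delta)
  interpret T: category "theta n" by (rule category_theta)
  have x': "x \<in> S k \<theta> m" using x by (simp add: el_def)
  note I = D.Ide_Hom[unfolded Delta_simps(1), OF UNIV_I] T.Ide_Hom[OF \<theta>]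
  show "act n X (a, Ide (theta n) \<theta>, Ide Delta m) x = A1 a \<theta> m x" if a: "a \<in> Hom Delta k' k"
  proof -
    have "A1 a \<theta> m x \<in> S k' \<theta> m" using setN_in[OF simplicial_act_comp_Hom[OF a \<theta>] _ x'] by simp
    then show ?thesis using act_eq[OF a I(2) I(1)] theta_act_Ide[OF \<theta>] space_act_Ide[OF \<theta>] by simp
  qed
  show "act n X (Ide Delta k, f, Ide Delta m) x = A2 k f m x" if f: "f \<in> Hom (theta n) \<theta>' \<theta>"
  proof -
    have "A2 k f m x \<in> S k \<theta>' m" using setN_in[OF theta_act_Hom[OF f] _ x'] by simp
    then show ?thesis using act_eq[OF I(1) f I(1)] simplicial_act_Ide[OF \<theta> x'] space_act_Ide T.Hom_Obj[OF f] by simp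
  qed
  show "act n X (Ide Delta k, Ide (theta n) \<theta>, b) x = A3 k \<theta> b x" if b: "b \<in> Hom Delta m' m"
    using act_eq[OF I(1) I(2) b] simplicial_act_Ide[OF \<theta> x'] theta_act_Ide[OF \<theta> x'] by simp
qed

end

text \<open>Composition is checked in each variable separately; the naturality squares supply the three
  interchange laws that are needed to sort the six factors of a composite of two arrows.\<close>

lemma psh_of:
  assumes X: "X \<in> Obj (SimpThetaSp n)"
  shows "is_psh n (el X) (act n X)"
proof -
  interpret D: category Delta by (rule category_Delta)
  interpret T: category "theta n" by (rule category_theta)
  note F = spaces_functor[OF X]
  let ?S = "\<lambda>k \<theta> m. fob (fob (fob X k) \<theta>) m"
  let ?a1 = "\<lambda>a \<theta> m x. sfun (ncmp (ncmp (far X a) \<theta>) m) x"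
  let ?a2 = "\<lambda>k f m x. sfun (ncmp (far (fob X k) f) m) x"
  let ?a3 = "\<lambda>k \<theta> b x. sfun (far (fob (fob X k) \<theta>) b) x"
  have a1: "?a1 a \<theta> m x \<in> ?S k' \<theta> m" if "a \<in> Hom Delta k' k" "\<theta> \<in> Obj (theta n)" "x \<in> ?S k \<theta> m" for a k k' \<theta> m x
    using setN_in[OF simplicial_act_comp_Hom[OF X that(1,2)] _ that(3)] by simp
  have a2: "?a2 k f m x \<in> ?S k \<theta>' m" if "f \<in> Hom (theta n) \<theta>' \<theta>" "x \<in> ?S k \<theta> m" for f k \<theta> \<theta>' m x
    using setN_in[OF theta_act_Hom[OF X that(1)] _ that(2)] by simp
  have a3: "?a3 k \<theta> b x \<in> ?S k \<theta> m'" if "b \<in> Hom Delta m' m" "\<theta> \<in> Obj (theta n)" "x \<in> ?S k \<theta> m" for b k \<theta> m' m x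
    using setF_in[OF F(3)[OF that(2)] _ that(3)] that by simp
  have c1: "?a1 (Cmp Delta a a') \<theta> m x = ?a1 a' \<theta> m (?a1 a \<theta> m x)"
    if "a' \<in> Hom Delta k'' k'" "a \<in> Hom Delta k' k" "\<theta> \<in> Obj (theta n)" "x \<in> ?S k \<theta> m" for a a' k k' k'' \<theta> m x
  proof -
    have "far X (Cmp Delta a a') = Cmp (ThetaSp n) (far X a') (far X a)"
      using is_functorD(6)[OF F(1), of a k k' a' k''] that by (simp del: Delta_simps)
    then have "ncmp (far X (Cmp Delta a a')) \<theta> = Cmp (fun_cat (opp Delta) SetC) (ncmp (far X a') \<theta>) (ncmp (far X a) \<theta>)"
      using that(3) by (simp add: ThetaSp_def SSets_def)
    then show ?thesis using setN_Cmp[OF simplicial_act_comp_Hom[OF X that(2,3)] _ that(4)]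
      by (simp del: Delta_simps(2-) SetC_simps fun_cat_simps)
  qed
  have c2: "?a2 k (Cmp (theta n) f f') m x = ?a2 k f' m (?a2 k f m x)"
    if "f' \<in> Hom (theta n) \<theta>'' \<theta>'" "f \<in> Hom (theta n) \<theta>' \<theta>" "x \<in> ?S k \<theta> m" for f f' k \<theta> \<theta>' \<theta>'' m x
  proof -
    have "far (fob X k) (Cmp (theta n) f f') = Cmp (fun_cat (opp Delta) SetC) (far (fob X k) f') (far (fob X k) f)"
      using is_functorD(6)[OF F(2), of f \<theta> \<theta>' f' \<theta>''] that by (simp add: SSets_def del: fun_cat_simps)
    then show ?thesis using setN_Cmp[OF theta_act_Hom[OF X that(2)] _ that(3)]
      by (simp del: Delta_simps(2-) SetC_simps fun_cat_simps)
  qed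
  have c3: "?a3 k \<theta> (Cmp Delta b b') x = ?a3 k \<theta> b' (?a3 k \<theta> b x)"
    if "b' \<in> Hom Delta m'' m'" "b \<in> Hom Delta m' m" "\<theta> \<in> Obj (theta n)" "x \<in> ?S k \<theta> m" for b b' m m' m'' \<theta> k x
    using setF_Cmp[OF F(3)[OF that(3)], of b m m' b' m'' x] that by (simp del: Delta_simps(2-))
  have e12: "?a2 k' f m (?a1 a \<theta> m x) = ?a1 a \<theta>' m (?a2 k f m x)"
    if "a \<in> Hom Delta k' k" "f \<in> Hom (theta n) \<theta>' \<theta>" "x \<in> ?S k \<theta> m" for a k k' f \<theta> \<theta>' m x
  proof -
    have ob: "\<theta> \<in> Obj (theta n)" "\<theta>' \<in> Obj (theta n)" using T.Hom_Obj[OF that(2)] by auto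
    have "Cmp SSets (far (fob X k') f) (ncmp (far X a) \<theta>) = Cmp SSets (ncmp (far X a) \<theta>') (far (fob X k) f)"
      using is_ntrD(5)[of "opp (theta n)" SSets "far X a" f \<theta> \<theta>'] simplicial_act_Hom[OF X that(1)] that(2)
      by (simp add: Hom_fun_cat)
    then have "ncmp (Cmp SSets (far (fob X k') f) (ncmp (far X a) \<theta>)) m
      = ncmp (Cmp SSets (ncmp (far X a) \<theta>') (far (fob X k) f)) m" by simp
    then show ?thesis
      using setN_Cmp[OF simplicial_act_comp_Hom[OF X that(1) ob(1)] _ that(3), of "far (fob X k') f"]
        setN_Cmp[OF theta_act_Hom[OF X that(2)] _ that(3), of "ncmp (far X a) \<theta>'"]
      by (simp add: SSets_def del: Delta_simps(2-) SetC_simps fun_cat_simps ncmp_Cmp)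
  qed
  have e13: "?a3 k' \<theta> b (?a1 a \<theta> m x) = ?a1 a \<theta> m' (?a3 k \<theta> b x)"
    if "a \<in> Hom Delta k' k" "b \<in> Hom Delta m' m" "\<theta> \<in> Obj (theta n)" "x \<in> ?S k \<theta> m" for a k k' b \<theta> m m' x
    using setN_nat[OF simplicial_act_comp_Hom[OF X that(1,3)], of b m m' x] that by simp
  have e23: "?a3 k \<theta>' b (?a2 k f m x) = ?a2 k f m' (?a3 k \<theta> b x)"
    if "f \<in> Hom (theta n) \<theta>' \<theta>" "b \<in> Hom Delta m' m" "x \<in> ?S k \<theta> m" for k f b \<theta> \<theta>' m m' x
    using setN_nat[OF theta_act_Hom[OF X that(1)], of b m m' x] that by simp
  show ?thesis unfolding is_psh_def
  proof (intro conjI allI impI ballI)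
    fix c assume "c \<in> Obj (site n)"
    then show "small (el X c)" using setF_small[OF F(3)] by (auto simp: el_def)
  next
    fix c d p x assume "p \<in> Hom (site n) c d" "x \<in> el X d"
    then show "act n X p x \<in> el X c"
    proof (elim Hom_siteE)
      fix k \<theta> m k' \<theta>' m' a f b
      assume *: "p = (a, f, b)" "c = (k, \<theta>, m)" "d = (k', \<theta>', m')"
       "a \<in> Hom Delta k k'" "f \<in> Hom (theta n) \<theta> \<theta>'" "b \<in> Hom Delta m m'" and x: "x \<in> el X d"
      have "\<theta> \<in> Obj (theta n)" "\<theta>' \<in> Obj (theta n)" using T.Hom_Obj[OF *(5)] by auto
      then show ?thesis using act_eq[OF X *(4-6)] a1[OF *(4)] a2[OF *(5)] a3[OF *(6)] x *(1-3)
        by (simp add: el_def)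
    qed
  next
    fix c x assume "c \<in> Obj (site n)" "x \<in> el X c"
    then obtain k \<theta> m where c: "c = (k, \<theta>, m)" "\<theta> \<in> Obj (theta n)" "x \<in> ?S k \<theta> m"
      by (cases c) (auto simp: el_def)
    show "act n X (Ide (site n) c) x = x"
      using act_eq[OF X D.Ide_Hom T.Ide_Hom[OF c(2)] D.Ide_Hom, of k m] simplicial_act_Ide[OF X c(2,3)] theta_act_Ide[OF X c(2,3)] space_act_Ide[OF X c(2,3)] c
      by (simp del: Delta_simps(2-))
  next
    fix c d e p q x assume "p \<in> Hom (site n) c d" "q \<in> Hom (site n) d e" "x \<in> el X e"
    then obtain a f b a' f' b' k \<theta> m k' \<theta>' m' k'' \<theta>'' m'' where
      p: "p = (a', f', b')" "c = (k'', \<theta>'', m'')" "d = (k', \<theta>', m')"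
       "a' \<in> Hom Delta k'' k'" "f' \<in> Hom (theta n) \<theta>'' \<theta>'" "b' \<in> Hom Delta m'' m'" and
      q: "q = (a, f, b)" "e = (k, \<theta>, m)"
       "a \<in> Hom Delta k' k" "f \<in> Hom (theta n) \<theta>' \<theta>" "b \<in> Hom Delta m' m" and x: "x \<in> ?S k \<theta> m"
      by (elim Hom_siteE) (auto simp: el_def)
    have ob: "\<theta> \<in> Obj (theta n)" "\<theta>' \<in> Obj (theta n)" "\<theta>'' \<in> Obj (theta n)"
      using T.Hom_Obj[OF p(5)] T.Hom_Obj[OF q(4)] by auto
    let ?x1 = "?a1 a \<theta> m x"
    note x1 = a1[OF q(3) ob(1) x]
    note x2 = a2[OF q(4) x1]
    note y1 = a1[OF p(4) ob(1) x1]
    have "act n X (Cmp (site n) q p) x = ?a3 k'' \<theta>'' (Cmp Delta b b')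
       (?a2 k'' (Cmp (theta n) f f') m (?a1 (Cmp Delta a a') \<theta> m x))"
      using act_eq[OF X D.Cmp_Hom[OF p(4) q(3)] T.Cmp_Hom[OF p(5) q(4)] D.Cmp_Hom[OF p(6) q(5)], of x] p q
      by (simp del: Delta_simps)
    also have "\<dots> = ?a3 k'' \<theta>'' (Cmp Delta b b') (?a2 k'' f' m (?a2 k'' f m (?a1 a' \<theta> m ?x1)))"
      using c1[OF p(4) q(3) ob(1) x] c2[OF p(5) q(4) y1] by (simp del: Delta_simps)
    also have "\<dots> = ?a3 k'' \<theta>'' b' (?a3 k'' \<theta>'' b (?a2 k'' f' m (?a2 k'' f m (?a1 a' \<theta> m ?x1))))"
      using c3[OF p(6) q(5) ob(3) a2[OF p(5) a2[OF q(4) y1]]] by (simp del: Delta_simps)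
    also have "?a3 k'' \<theta>'' b (?a2 k'' f' m (?a2 k'' f m (?a1 a' \<theta> m ?x1)))
      = ?a2 k'' f' m' (?a3 k'' \<theta>' b (?a2 k'' f m (?a1 a' \<theta> m ?x1)))"
      using e23[OF p(5) q(5) a2[OF q(4) y1]] .
    also have "?a2 k'' f m (?a1 a' \<theta> m ?x1) = ?a1 a' \<theta>' m (?a2 k' f m ?x1)"
      using e12[OF p(4) q(4) x1] .
    also have "?a3 k'' \<theta>' b (?a1 a' \<theta>' m (?a2 k' f m ?x1)) = ?a1 a' \<theta>' m' (?a3 k' \<theta>' b (?a2 k' f m ?x1))"
      using e13[OF p(4) q(5) ob(2) x2] .
    also have "?a3 k'' \<theta>'' b' (?a2 k'' f' m' (?a1 a' \<theta>' m' (?a3 k' \<theta>' b (?a2 k' f m ?x1))))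
      = act n X p (act n X q x)"
      using act_eq[OF X p(4-6)] act_eq[OF X q(3-5)] p q by simp
    finally show "act n X (Cmp (site n) q p) x = act n X p (act n X q x)" .
  qed
qed

lemma pshD:
  assumes "is_psh n S A"
  shows "c \<in> Obj (site n) \<Longrightarrow> small (S c)"
    and "p \<in> Hom (site n) c d \<Longrightarrow> x \<in> S d \<Longrightarrow> A p x \<in> S c"
    and "c \<in> Obj (site n) \<Longrightarrow> x \<in> S c \<Longrightarrow> A (Ide (site n) c) x = x"
    and "p \<in> Hom (site n) c d \<Longrightarrow> q \<in> Hom (site n) d e \<Longrightarrow> x \<in> S e \<Longrightarrow> A (Cmp (site n) q p) x = A p (A q x)"
  using assms unfolding is_psh_def by blast+

lemmas spc_small = pshD(1)[OF psh_of] and act_in = pshD(2)[OF psh_of]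
  and act_Ide = pshD(3)[OF psh_of] and act_Cmp = pshD(4)[OF psh_of]

lemma spc_Hom:
  assumes "t \<in> Hom (SimpThetaSp n) X Y"
  shows "t \<in> Hom (fun_cat (opp Delta) (ThetaSp n)) X Y"
    and "ncmp t k \<in> Hom (fun_cat (opp (theta n)) SSets) (fob X k) (fob Y k)"
    and "\<theta> \<in> Obj (theta n) \<Longrightarrow>
      ncmp (ncmp t k) \<theta> \<in> Hom (fun_cat (opp Delta) SetC) (fob (fob X k) \<theta>) (fob (fob Y k) \<theta>)"
    and "X \<in> Obj (SimpThetaSp n)" "Y \<in> Obj (SimpThetaSp n)"
proof -
  show 1: "t \<in> Hom (fun_cat (opp Delta) (ThetaSp n)) X Y" using assms by (simp add: SimpThetaSp_def)
  show 2: "ncmp t k \<in> Hom (fun_cat (opp (theta n)) SSets) (fob X k) (fob Y k)"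
    using funN_in[OF 1, of k] by (simp add: ThetaSp_def)
  show "\<theta> \<in> Obj (theta n) \<Longrightarrow>
      ncmp (ncmp t k) \<theta> \<in> Hom (fun_cat (opp Delta) SetC) (fob (fob X k) \<theta>) (fob (fob Y k) \<theta>)"
    using funN_in[OF 2, of \<theta>] by (simp add: SSets_def)
  show "X \<in> Obj (SimpThetaSp n)" "Y \<in> Obj (SimpThetaSp n)"
    using category.Hom_Obj[OF SimpThetaSp_cat assms] by auto
qed

lemma cmp_in:
  assumes "t \<in> Hom (SimpThetaSp n) X Y" "c \<in> Obj (site n)" "x \<in> el X c"
  shows "cmp t c x \<in> el Y c"
  using assms setN_in[OF spc_Hom(3)[OF assms(1)]] by (auto simp: el_def cmp_def)

lemma cmp_Cmp:
  assumes "t \<in> Hom (SimpThetaSp n) X Y" "c \<in> Obj (site n)" "x \<in> el X c"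
  shows "cmp (Cmp (SimpThetaSp n) u t) c x = cmp u c (cmp t c x)"
proof -
  obtain k \<theta> m where c: "c = (k, \<theta>, m)" "\<theta> \<in> Obj (theta n)" using assms by auto
  have "ncmp (ncmp (Cmp (SimpThetaSp n) u t) k) \<theta>
    = Cmp (fun_cat (opp Delta) SetC) (ncmp (ncmp u k) \<theta>) (ncmp (ncmp t k) \<theta>)"
    using c by (simp add: SimpThetaSp_def ThetaSp_def SSets_def)
  then show ?thesis using setN_Cmp[OF spc_Hom(3)[OF assms(1) c(2)], of m x k] assms(3) c
    by (simp add: cmp_def el_def del: fun_cat_simps ncmp_Cmp SetC_simps)
qed

lemma cmp_Ide:
  assumes "c \<in> Obj (site n)" "x \<in> el X c"
  shows "cmp (Ide (SimpThetaSp n) X) c x = x"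
  using assms by (auto simp: cmp_def el_def SimpThetaSp_def ThetaSp_def SSets_def)

lemma cmp_eqI:
  assumes "t \<in> Hom (SimpThetaSp n) X Y" "t' \<in> Hom (SimpThetaSp n) X Y"
    and "\<And>c x. c \<in> Obj (site n) \<Longrightarrow> x \<in> el X c \<Longrightarrow> cmp t c x = cmp t' c x"
  shows "t = t'"
proof (rule ntr_eqI[OF spc_Hom(1)[OF assms(1)] spc_Hom(1)[OF assms(2)]])
  fix k
  show "ncmp t k = ncmp t' k"
  proof (rule ntr_eqI[OF spc_Hom(2)[OF assms(1)] spc_Hom(2)[OF assms(2)]])
    fix \<theta> assume "\<theta> \<in> Obj (opp (theta n))"
    then have \<theta>: "\<theta> \<in> Obj (theta n)" by simp
    show "ncmp (ncmp t k) \<theta> = ncmp (ncmp t' k) \<theta>"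
      by (rule setN_eqI[OF spc_Hom(3)[OF assms(1) \<theta>] spc_Hom(3)[OF assms(2) \<theta>]])
        (use assms(3)[of "(k, \<theta>, _)"] \<theta> in \<open>auto simp: cmp_def el_def\<close>)
  qed
qed

lemma cmp_nat:
  assumes t: "t \<in> Hom (SimpThetaSp n) X Y" and p: "p \<in> Hom (site n) c d" and x: "x \<in> el X d"
  shows "act n Y p (cmp t d x) = cmp t c (act n X p x)"
proof -
  interpret D: category Delta by (rule category_Delta)
  interpret T: category "theta n" by (rule category_theta)
  note XY = spc_Hom(4,5)[OF t]
  obtain a f b k \<theta> m k' \<theta>' m' where
      p: "p = (a, f, b)" "c = (k', \<theta>', m')" "d = (k, \<theta>, m)"
       and a: "a \<in> Hom Delta k' k" and f: "f \<in> Hom (theta n) \<theta>' \<theta>" and b: "b \<in> Hom Delta m' m"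
    using p by (elim Hom_siteE) blast
  have ob: "\<theta> \<in> Obj (theta n)" "\<theta>' \<in> Obj (theta n)" using T.Hom_Obj[OF f] by auto
  have x': "x \<in> fob (fob (fob X k) \<theta>) m" using x p by (simp add: el_def)
  let ?t = "\<lambda>k \<theta> m. sfun (ncmp (ncmp (ncmp t k) \<theta>) m)"
  let ?x1 = "sfun (ncmp (ncmp (far X a) \<theta>) m) x"
  let ?x2 = "sfun (ncmp (far (fob X k') f) m) ?x1"
  have x1: "?x1 \<in> fob (fob (fob X k') \<theta>) m"
    using setN_in[OF simplicial_act_comp_Hom[OF XY(1) a ob(1)] _ x'] by simp
  have x2: "?x2 \<in> fob (fob (fob X k') \<theta>') m"
    using setN_in[OF theta_act_Hom[OF XY(1) f] _ x1] by simp
  have "Cmp (ThetaSp n) (far Y a) (ncmp t k) = Cmp (ThetaSp n) (ncmp t k') (far X a)"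
    using is_ntrD(5)[of "opp Delta" "ThetaSp n" t a k k'] spc_Hom(1)[OF t] a by (simp add: Hom_fun_cat)
  then have "ncmp (Cmp (ThetaSp n) (far Y a) (ncmp t k)) \<theta> = ncmp (Cmp (ThetaSp n) (ncmp t k') (far X a)) \<theta>" by simp
  then have "Cmp (fun_cat (opp Delta) SetC) (ncmp (far Y a) \<theta>) (ncmp (ncmp t k) \<theta>) =
    Cmp (fun_cat (opp Delta) SetC) (ncmp (ncmp t k') \<theta>) (ncmp (far X a) \<theta>)"
    using ob by (simp add: ThetaSp_def SSets_def)
  then have 1: "sfun (ncmp (ncmp (far Y a) \<theta>) m) (?t k \<theta> m x) = ?t k' \<theta> m ?x1"
    using setN_Cmp[OF spc_Hom(3)[OF t ob(1)] _ x', of "ncmp (far Y a) \<theta>"]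
     setN_Cmp[OF simplicial_act_comp_Hom[OF XY(1) a ob(1)] _ x', of "ncmp (ncmp t k') \<theta>"]
    by (simp del: fun_cat_simps ncmp_Cmp SetC_simps)
  have "Cmp SSets (far (fob Y k') f) (ncmp (ncmp t k') \<theta>) = Cmp SSets (ncmp (ncmp t k') \<theta>') (far (fob X k') f)"
    using is_ntrD(5)[of "opp (theta n)" SSets "ncmp t k'" f \<theta> \<theta>'] spc_Hom(2)[OF t] f by (simp add: Hom_fun_cat)
  then have 2: "sfun (ncmp (far (fob Y k') f) m) (?t k' \<theta> m ?x1) = ?t k' \<theta>' m ?x2"
    using setN_Cmp[OF spc_Hom(3)[OF t ob(1)] _ x1, of "far (fob Y k') f"]
     setN_Cmp[OF theta_act_Hom[OF XY(1) f] _ x1, of "ncmp (ncmp t k') \<theta>'"]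
    by (simp add: SSets_def del: fun_cat_simps ncmp_Cmp SetC_simps)
  have 3: "sfun (far (fob (fob Y k') \<theta>') b) (?t k' \<theta>' m ?x2) = ?t k' \<theta>' m' (sfun (far (fob (fob X k') \<theta>') b) ?x2)"
    using setN_nat[OF spc_Hom(3)[OF t ob(2)], of b m m' ?x2] x2 b by simp
  show ?thesis using 1 2 3 act_eq[OF XY(1) a f b] act_eq[OF XY(2) a f b] p by (simp add: cmp_def)
qed

definition mk_map :: "nat \<Rightarrow> 'u spc \<Rightarrow> 'u spc \<Rightarrow> (site_ob \<Rightarrow> 'u \<Rightarrow> 'u) \<Rightarrow> 'u spcmap" where
  "mk_map n X Y \<phi> = \<lparr>nsrc = X, ntgt = Y, ncmp = (\<lambda>k \<in> UNIV. \<lparr>nsrc = fob X k, ntgt = fob Y k,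
     ncmp = (\<lambda>\<theta> \<in> Obj (theta n). mk_ntr (opp Delta) (fob (fob X k) \<theta>) (fob (fob Y k) \<theta>) (\<lambda>m. \<phi> (k, \<theta>, m)))\<rparr>)\<rparr>"

lemma cmp_mk_map: "c \<in> Obj (site n) \<Longrightarrow> x \<in> el X c \<Longrightarrow> cmp (mk_map n X Y \<phi>) c x = \<phi> c x"
  by (auto simp: mk_map_def cmp_def el_def)

text \<open>Naturality with respect to arrows that are identities in two of the three coordinates yields the
  naturality squares of the three nested levels.\<close>

lemma mk_map_Hom:
  fixes X Y :: "'u spc"
  assumes X: "X \<in> Obj (SimpThetaSp n)" and Y: "Y \<in> Obj (SimpThetaSp n)"
    and im: "\<And>c x. c \<in> Obj (site n) \<Longrightarrow> x \<in> el X c \<Longrightarrow> \<phi> c x \<in> el Y c"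
    and nat: "\<And>p c d x. p \<in> Hom (site n) c d \<Longrightarrow> x \<in> el X d \<Longrightarrow> act n Y p (\<phi> d x) = \<phi> c (act n X p x)"
  shows "mk_map n X Y \<phi> \<in> Hom (SimpThetaSp n) X Y"
proof -
  interpret D: category Delta by (rule category_Delta)
  interpret T: category "theta n" by (rule category_theta)
  interpret S: category "SSets :: ('u sset, 'u ssmap) cat" unfolding SSets_def
    by (intro category_fun_cat category_opp category_Delta category_SetC)
  interpret H: category "ThetaSp n :: ('u tsp, 'u tspmap) cat" by (rule ThetaSp_cat)
  note I = D.Ide_Hom[unfolded Delta_simps(1), OF UNIV_I]
  define t1 where "t1 = (\<lambda>k \<theta>. mk_ntr (opp Delta) (fob (fob X k) \<theta>) (fob (fob Y k) \<theta>) (\<lambda>m. \<phi> (k, \<theta>, m)))"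
  define t2 where "t2 = (\<lambda>k. \<lparr>nsrc = fob X k, ntgt = fob Y k, ncmp = (\<lambda>\<theta> \<in> Obj (theta n). t1 k \<theta>)\<rparr>)"
  have t1: "t1 k \<theta> \<in> Hom (fun_cat (opp Delta) SetC) (fob (fob X k) \<theta>) (fob (fob Y k) \<theta>)"
    if \<theta>: "\<theta> \<in> Obj (theta n)" for k \<theta>
    unfolding t1_def
  proof (rule mk_ntr_Hom[OF category_opp[OF category_Delta] spaces_functor(3)[OF X \<theta>] spaces_functor(3)[OF Y \<theta>]])
    show "\<phi> (k, \<theta>, m) x \<in> fob (fob (fob Y k) \<theta>) m" if "x \<in> fob (fob (fob X k) \<theta>) m" for m x
      using im[of "(k, \<theta>, m)" x] that \<theta> by (simp add: el_def)
    fix m m' b x assume b: "b \<in> Hom (opp Delta) m m'" and x: "x \<in> fob (fob (fob X k) \<theta>) m"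
    then have b': "b \<in> Hom Delta m' m" and x': "x \<in> el X (k, \<theta>, m)" by (simp_all add: el_def)
    have p: "(Ide Delta k, Ide (theta n) \<theta>, b) \<in> Hom (site n) (k, \<theta>, m') (k, \<theta>, m)"
      using b' I T.Ide_Hom[OF \<theta>] by (simp add: Hom_site del: Delta_simps)
    show "sfun (far (fob (fob Y k) \<theta>) b) (\<phi> (k, \<theta>, m) x) = \<phi> (k, \<theta>, m') (sfun (far (fob (fob X k) \<theta>) b) x)"
      using nat[OF p x'] act_one_factor(3)[OF X \<theta> x' b'] act_one_factor(3)[OF Y \<theta> im[OF _ x'] b'] \<theta>
      by (simp del: Delta_simps(2-))
  qed
  have t2: "t2 k \<in> Hom (ThetaSp n) (fob X k) (fob Y k)" for k
    unfolding ThetaSp_def Hom_fun_cat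
  proof (intro conjI is_ntrI)
    show "is_functor (opp (theta n)) SSets (nsrc (t2 k))" "is_functor (opp (theta n)) SSets (ntgt (t2 k))"
      using spaces_functor(2)[OF X] spaces_functor(2)[OF Y] by (simp_all add: t2_def)
    fix f \<theta> \<theta>' assume "f \<in> Hom (opp (theta n)) \<theta> \<theta>'"
    then have f: "f \<in> Hom (theta n) \<theta>' \<theta>" by simp
    have ob: "\<theta> \<in> Obj (theta n)" "\<theta>' \<in> Obj (theta n)" using T.Hom_Obj[OF f] by auto
    note hX = theta_act_Hom[OF X f] and hY = theta_act_Hom[OF Y f]
    have "Cmp SSets (far (fob Y k) f) (t1 k \<theta>) = Cmp SSets (t1 k \<theta>') (far (fob X k) f)"
    proof (rule setN_eqI)
      show "Cmp SSets (far (fob Y k) f) (t1 k \<theta>) \<in> Hom (fun_cat (opp Delta) SetC) (fob (fob X k) \<theta>) (fob (fob Y k) \<theta>')"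
       "Cmp SSets (t1 k \<theta>') (far (fob X k) f) \<in> Hom (fun_cat (opp Delta) SetC) (fob (fob X k) \<theta>) (fob (fob Y k) \<theta>')"
        using S.Cmp_Hom[OF t1[OF ob(1), folded SSets_def] hY[folded SSets_def]]
          S.Cmp_Hom[OF hX[folded SSets_def] t1[OF ob(2), folded SSets_def]] by (simp_all add: SSets_def)
      fix m x assume x: "x \<in> fob (fob (fob X k) \<theta>) m"
      then have x': "x \<in> el X (k, \<theta>, m)" by (simp add: el_def)
      have p: "(Ide Delta k, f, Ide Delta m) \<in> Hom (site n) (k, \<theta>', m) (k, \<theta>, m)"
        using f I by (simp add: Hom_site del: Delta_simps)
      have "sfun (ncmp (far (fob X k) f) m) x \<in> fob (fob (fob X k) \<theta>') m"
        using setN_in[OF hX _ x] by simp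
      then show "sfun (ncmp (Cmp SSets (far (fob Y k) f) (t1 k \<theta>)) m) x =
          sfun (ncmp (Cmp SSets (t1 k \<theta>') (far (fob X k) f)) m) x"
        using nat[OF p x'] act_one_factor(2)[OF X ob(1) x' f] act_one_factor(2)[OF Y ob(1) im[OF _ x'] f] ob
          setN_Cmp[OF t1[OF ob(1)] _ x, of "far (fob Y k) f"] setN_Cmp[OF hX _ x, of "t1 k \<theta>'"] x
        by (simp del: Delta_simps(2-) SetC_simps fun_cat_simps ncmp_Cmp add: SSets_def t1_def)
    qed
    then show "Cmp SSets (far (ntgt (t2 k)) f) (ncmp (t2 k) \<theta>) = Cmp SSets (ncmp (t2 k) \<theta>') (far (nsrc (t2 k)) f)"
      using ob by (simp add: t2_def)
  qed (use t1 in \<open>auto simp: t2_def SSets_def\<close>)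
  have "\<lparr>nsrc = X, ntgt = Y, ncmp = (\<lambda>k \<in> UNIV. t2 k)\<rparr> \<in> Hom (SimpThetaSp n) X Y"
    unfolding SimpThetaSp_def Hom_fun_cat
  proof (intro conjI is_ntrI)
    fix a k k' assume "a \<in> Hom (opp Delta) k k'"
    then have a: "a \<in> Hom Delta k' k" by simp
    note hX = simplicial_act_Hom[OF X a, folded ThetaSp_def] and hY = simplicial_act_Hom[OF Y a, folded ThetaSp_def]
    have "Cmp (ThetaSp n) (far Y a) (t2 k) = Cmp (ThetaSp n) (t2 k') (far X a)"
    proof (rule ntr_eqI)
      show "Cmp (ThetaSp n) (far Y a) (t2 k) \<in> Hom (fun_cat (opp (theta n)) SSets) (fob X k) (fob Y k')"
        "Cmp (ThetaSp n) (t2 k') (far X a) \<in> Hom (fun_cat (opp (theta n)) SSets) (fob X k) (fob Y k')"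
        using H.Cmp_Hom[OF t2 hY] H.Cmp_Hom[OF hX t2] by (simp_all add: ThetaSp_def)
      fix \<theta> assume "\<theta> \<in> Obj (opp (theta n))"
      then have \<theta>: "\<theta> \<in> Obj (theta n)" by simp
      note hX = simplicial_act_comp_Hom[OF X a \<theta>] and hY = simplicial_act_comp_Hom[OF Y a \<theta>]
      have "Cmp SSets (ncmp (far Y a) \<theta>) (t1 k \<theta>) = Cmp SSets (t1 k' \<theta>) (ncmp (far X a) \<theta>)"
      proof (rule setN_eqI)
        show "Cmp SSets (ncmp (far Y a) \<theta>) (t1 k \<theta>) \<in> Hom (fun_cat (opp Delta) SetC) (fob (fob X k) \<theta>) (fob (fob Y k') \<theta>)"
         "Cmp SSets (t1 k' \<theta>) (ncmp (far X a) \<theta>) \<in> Hom (fun_cat (opp Delta) SetC) (fob (fob X k) \<theta>) (fob (fob Y k') \<theta>)"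
          using S.Cmp_Hom[OF t1[OF \<theta>, folded SSets_def] hY[folded SSets_def]]
            S.Cmp_Hom[OF hX[folded SSets_def] t1[OF \<theta>, folded SSets_def]] by (simp_all add: SSets_def)
        fix m x assume x: "x \<in> fob (fob (fob X k) \<theta>) m"
        then have x': "x \<in> el X (k, \<theta>, m)" by (simp add: el_def)
        have p: "(a, Ide (theta n) \<theta>, Ide Delta m) \<in> Hom (site n) (k', \<theta>, m) (k, \<theta>, m)"
          using a I T.Ide_Hom[OF \<theta>] by (simp add: Hom_site del: Delta_simps)
        have "sfun (ncmp (ncmp (far X a) \<theta>) m) x \<in> fob (fob (fob X k') \<theta>) m"
          using setN_in[OF hX _ x] by simp
        then show "sfun (ncmp (Cmp SSets (ncmp (far Y a) \<theta>) (t1 k \<theta>)) m) x =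
            sfun (ncmp (Cmp SSets (t1 k' \<theta>) (ncmp (far X a) \<theta>)) m) x"
          using nat[OF p x'] act_one_factor(1)[OF X \<theta> x' a] act_one_factor(1)[OF Y \<theta> im[OF _ x'] a] \<theta>
            setN_Cmp[OF t1[OF \<theta>] _ x, of "ncmp (far Y a) \<theta>"] setN_Cmp[OF hX _ x, of "t1 k' \<theta>"] x
          by (simp del: Delta_simps(2-) SetC_simps fun_cat_simps ncmp_Cmp add: SSets_def t1_def)
      qed
      then show "ncmp (Cmp (ThetaSp n) (far Y a) (t2 k)) \<theta> = ncmp (Cmp (ThetaSp n) (t2 k') (far X a)) \<theta>"
        using \<theta> by (simp add: ThetaSp_def t2_def)
    qed
    then show "Cmp (ThetaSp n) (far (ntgt \<lparr>nsrc = X, ntgt = Y, ncmp = (\<lambda>k \<in> UNIV. t2 k)\<rparr>) a)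
        (ncmp \<lparr>nsrc = X, ntgt = Y, ncmp = (\<lambda>k \<in> UNIV. t2 k)\<rparr> k) =
      Cmp (ThetaSp n) (ncmp \<lparr>nsrc = X, ntgt = Y, ncmp = (\<lambda>k \<in> UNIV. t2 k)\<rparr> k')
        (far (nsrc \<lparr>nsrc = X, ntgt = Y, ncmp = (\<lambda>k \<in> UNIV. t2 k)\<rparr>) a)" by simp
  qed (use t2 spaces_functor(1)[OF X] spaces_functor(1)[OF Y] in auto)
  then show ?thesis unfolding mk_map_def t2_def t1_def .
qed

text \<open>The passage from presheaves on the site back to nested functors: the space at \<open>(k, \<theta>)\<close>,
  then the object of \<open>ThetaSp n\<close> at \<open>k\<close>, then the simplicial object.\<close>

definition mk_obj1 :: "nat \<Rightarrow> (site_ob \<Rightarrow> 'u set) \<Rightarrow> (site_ar \<Rightarrow> 'u \<Rightarrow> 'u) \<Rightarrow> nat \<Rightarrow> tree \<Rightarrow> 'u sset" where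
  "mk_obj1 n S A k \<theta> = \<lparr>fob = (\<lambda>m \<in> UNIV. S (k, \<theta>, m)),
     far = (\<lambda>b \<in> Arr Delta. mk_sar (S (k, \<theta>, dcod b)) (S (k, \<theta>, ddom b))
       (A (Ide Delta k, Ide (theta n) \<theta>, b)))\<rparr>"

definition mk_obj2 :: "nat \<Rightarrow> (site_ob \<Rightarrow> 'u set) \<Rightarrow> (site_ar \<Rightarrow> 'u \<Rightarrow> 'u) \<Rightarrow> nat \<Rightarrow> 'u tsp" where
  "mk_obj2 n S A k = \<lparr>fob = (\<lambda>\<theta> \<in> Obj (theta n). mk_obj1 n S A k \<theta>),
     far = (\<lambda>f \<in> Arr (theta n). mk_ntr (opp Delta) (mk_obj1 n S A k (Cod (theta n) f))
       (mk_obj1 n S A k (Dom (theta n) f)) (\<lambda>m. A (Ide Delta k, f, Ide Delta m)))\<rparr>"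

definition mk_obj :: "nat \<Rightarrow> (site_ob \<Rightarrow> 'u set) \<Rightarrow> (site_ar \<Rightarrow> 'u \<Rightarrow> 'u) \<Rightarrow> 'u spc" where
  "mk_obj n S A = \<lparr>fob = (\<lambda>k \<in> UNIV. mk_obj2 n S A k),
     far = (\<lambda>a \<in> Arr Delta. \<lparr>nsrc = mk_obj2 n S A (dcod a), ntgt = mk_obj2 n S A (ddom a),
       ncmp = (\<lambda>\<theta> \<in> Obj (theta n). mk_ntr (opp Delta) (mk_obj1 n S A (dcod a) \<theta>)
         (mk_obj1 n S A (ddom a) \<theta>) (\<lambda>m. A (a, Ide (theta n) \<theta>, Ide Delta m)))\<rparr>)\<rparr>"

lemma el_mk_obj: "c \<in> Obj (site n) \<Longrightarrow> el (mk_obj n S A) c = S c"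
  by (auto simp: el_def mk_obj_def mk_obj2_def mk_obj1_def)

lemma mk_obj_Obj:
  fixes S :: "site_ob \<Rightarrow> 'u set"
  assumes P: "is_psh n S A"
  shows "mk_obj n S A \<in> Obj (SimpThetaSp n)"
    and "p \<in> Hom (site n) c d \<Longrightarrow> x \<in> S d \<Longrightarrow> act n (mk_obj n S A) p x = A p x"
proof -
  interpret D: category Delta by (rule category_Delta)
  interpret T: category "theta n" by (rule category_theta)
  interpret S: category "SSets :: ('u sset, 'u ssmap) cat" unfolding SSets_def
    by (intro category_fun_cat category_opp category_Delta category_SetC)
  interpret H: category "ThetaSp n :: ('u tsp, 'u tspmap) cat" by (rule ThetaSp_cat)
  interpret Si: category "site n" by (rule category_site)
  note I = D.Ide_Hom[unfolded Delta_simps(1), OF UNIV_I]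
  note small = pshD(1)[OF P] and A_in = pshD(2)[OF P] and A_Ide = pshD(3)[OF P] and A_Cmp = pshD(4)[OF P]
  have fact: "A (Cmp Delta a a', Cmp (theta n) f f', Cmp Delta b b') x = A (a', f', b') (A (a, f, b) x)"
    if "a' \<in> Hom Delta k'' k'" "a \<in> Hom Delta k' k" "f' \<in> Hom (theta n) \<theta>'' \<theta>'" "f \<in> Hom (theta n) \<theta>' \<theta>"
      "b' \<in> Hom Delta m'' m'" "b \<in> Hom Delta m' m" "x \<in> S (k, \<theta>, m)"
    for a a' k k' k'' f f' \<theta> \<theta>' \<theta>'' b b' m m' m'' x
    using A_Cmp[of "(a', f', b')" "(k'', \<theta>'', m'')" "(k', \<theta>', m')" "(a, f, b)" "(k, \<theta>, m)" x] that
    by (simp add: Hom_site del: Delta_simps)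
  have id: "A (Ide Delta k, Ide (theta n) \<theta>, Ide Delta m) x = x" if "\<theta> \<in> Obj (theta n)" "x \<in> S (k, \<theta>, m)" for k \<theta> m x
    using A_Ide[of "(k, \<theta>, m)" x] that by (simp del: Delta_simps(2-))
  have A_in': "A (a, f, b) x \<in> S (k', \<theta>', m')"
    if "a \<in> Hom Delta k' k" "f \<in> Hom (theta n) \<theta>' \<theta>" "b \<in> Hom Delta m' m" "x \<in> S (k, \<theta>, m)" for a k k' f \<theta> \<theta>' b m m' x
    using A_in[of "(a, f, b)" "(k', \<theta>', m')" "(k, \<theta>, m)" x] that by (simp add: Hom_site)
  let ?o1 = "mk_obj1 n S A" and ?o2 = "mk_obj2 n S A"
  have fob1: "fob (?o1 k \<theta>) m = S (k, \<theta>, m)" for k \<theta> m by (simp add: mk_obj1_def)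
  have far1: "far (?o1 k \<theta>) b = mk_sar (S (k, \<theta>, m)) (S (k, \<theta>, m')) (A (Ide Delta k, Ide (theta n) \<theta>, b))"
    if "b \<in> Hom Delta m' m" for k \<theta> b m m' using Hom_Arr[OF that] by (simp add: mk_obj1_def)
  have o1: "is_functor (opp Delta) SetC (?o1 k \<theta>)" if \<theta>: "\<theta> \<in> Obj (theta n)" for k \<theta>
  proof (rule is_functorI)
    show "fob (?o1 k \<theta>) \<in> extensional (Obj (opp Delta))" "far (?o1 k \<theta>) \<in> extensional (Arr (opp Delta))"
      by (simp_all add: mk_obj1_def)
    show sm: "fob (?o1 k \<theta>) m \<in> Obj SetC" for m using small[of "(k, \<theta>, m)"] \<theta> by (simp add: fob1)
    show h: "far (?o1 k \<theta>) b \<in> Hom SetC (fob (?o1 k \<theta>) m) (fob (?o1 k \<theta>) m')"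
      if "b \<in> Hom (opp Delta) m m'" for b m m'
      using that far1[of b m' m k \<theta>] sm A_in'[OF I T.Ide_Hom[OF \<theta>], of b m' m]
      by (auto simp: fob1 simp del: Delta_simps intro!: mk_sar_Hom)
    show "far (?o1 k \<theta>) (Ide (opp Delta) m) = Ide SetC (fob (?o1 k \<theta>) m)" if "m \<in> Obj (opp Delta)" for m
      unfolding opp_simps far1[OF I] mk_sar_def using id[OF \<theta>, of _ k m]
      by (auto simp: fob1 fun_eq_iff simp del: Delta_simps)
    fix b b' m m' m'' assume b: "b \<in> Hom (opp Delta) m m'" and b': "b' \<in> Hom (opp Delta) m' m''"
    have "Cmp Delta b b' \<in> Hom Delta m'' m" using D.Cmp_Hom b b' by simp
    then have c: "far (?o1 k \<theta>) (Cmp (opp Delta) b' b) \<in> Hom SetC (fob (?o1 k \<theta>) m) (fob (?o1 k \<theta>) m'')"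
      using h by (simp del: Delta_simps)
    have B: "b \<in> Hom Delta m' m" "b' \<in> Hom Delta m'' m'" using b b' by simp_all
    show "far (?o1 k \<theta>) (Cmp (opp Delta) b' b) = Cmp SetC (far (?o1 k \<theta>) b') (far (?o1 k \<theta>) b)"
    proof (rule sar_eqI[OF c category.Cmp_Hom[OF category_SetC h[OF b] h[OF b']]])
      fix x assume "x \<in> fob (?o1 k \<theta>) m"
      then have x: "x \<in> S (k, \<theta>, m)" by (simp add: fob1)
      show "sfun (far (?o1 k \<theta>) (Cmp (opp Delta) b' b)) x = sfun (Cmp SetC (far (?o1 k \<theta>) b') (far (?o1 k \<theta>) b)) x"
        unfolding opp_simps far1[OF D.Cmp_Hom[OF B(2,1)]]
        using sfun_Cmp[OF h[OF b], of x "far (?o1 k \<theta>) b'"] x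
          fact[OF I I T.Ide_Hom[OF \<theta>] T.Ide_Hom[OF \<theta>] B(2,1) x] A_in'[OF I T.Ide_Hom[OF \<theta>] B(1) x]
          D.Cmp_Ide_left[OF I] T.Cmp_Ide_left[OF T.Ide_Hom[OF \<theta>]]
        by (simp add: fob1 far1[OF B(1)] far1[OF B(2)] del: Delta_simps SetC_simps)
    qed
  qed
  have fob2: "fob (?o2 k) \<theta> = ?o1 k \<theta>" if "\<theta> \<in> Obj (theta n)" for k \<theta> using that by (simp add: mk_obj2_def)
  have far2: "far (?o2 k) f = mk_ntr (opp Delta) (?o1 k \<theta>) (?o1 k \<theta>') (\<lambda>m. A (Ide Delta k, f, Ide Delta m))"
    if "f \<in> Hom (theta n) \<theta>' \<theta>" for k f \<theta> \<theta>' using Hom_Arr[OF that] by (simp add: mk_obj2_def)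
  have n2: "far (?o2 k) f \<in> Hom SSets (?o1 k \<theta>) (?o1 k \<theta>')" if f: "f \<in> Hom (theta n) \<theta>' \<theta>" for k f \<theta> \<theta>'
  proof -
    have ob: "\<theta> \<in> Obj (theta n)" "\<theta>' \<in> Obj (theta n)" using T.Hom_Obj[OF f] by auto
    show ?thesis unfolding far2[OF f] SSets_def
    proof (rule mk_ntr_Hom[OF category_opp[OF category_Delta] o1[OF ob(1)] o1[OF ob(2)]])
      show "A (Ide Delta k, f, Ide Delta m) x \<in> fob (?o1 k \<theta>') m" if "x \<in> fob (?o1 k \<theta>) m" for m x
        using A_in'[OF I f I] that by (simp only: fob1)
      fix m m' b x assume "b \<in> Hom (opp Delta) m m'" and "x \<in> fob (?o1 k \<theta>) m"
      then have b: "b \<in> Hom Delta m' m" and x: "x \<in> S (k, \<theta>, m)" by (simp_all add: fob1)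
      show "sfun (far (?o1 k \<theta>') b) (A (Ide Delta k, f, Ide Delta m) x) = A (Ide Delta k, f, Ide Delta m') (sfun (far (?o1 k \<theta>) b) x)"
        using fact[OF I I T.Ide_Hom[OF ob(2)] f b I x] fact[OF I I f T.Ide_Hom[OF ob(1)] I b x] A_in'[OF I f I x]
          T.Cmp_Ide_left[OF f] T.Cmp_Ide_right[OF f] D.Cmp_Ide_left[OF b] D.Cmp_Ide_right[OF b] D.Cmp_Ide_left[OF I] x
        by (simp add: far1[OF b] del: Delta_simps)
    qed
  qed
  have o2: "is_functor (opp (theta n)) SSets (?o2 k)" for k
  proof (rule is_functorI)
    show "fob (?o2 k) \<in> extensional (Obj (opp (theta n)))" "far (?o2 k) \<in> extensional (Arr (opp (theta n)))"
      by (simp_all add: mk_obj2_def)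
    show "fob (?o2 k) \<theta> \<in> Obj SSets" if "\<theta> \<in> Obj (opp (theta n))" for \<theta>
      using o1 that by (simp add: fob2 SSets_def)
    show h: "far (?o2 k) f \<in> Hom SSets (fob (?o2 k) \<theta>) (fob (?o2 k) \<theta>')" if "f \<in> Hom (opp (theta n)) \<theta> \<theta>'" for f \<theta> \<theta>'
      using that n2[of f \<theta>' \<theta> k] T.Hom_Obj[of f \<theta>' \<theta>] by (simp add: fob2)
    show "far (?o2 k) (Ide (opp (theta n)) \<theta>) = Ide SSets (fob (?o2 k) \<theta>)" if "\<theta> \<in> Obj (opp (theta n))" for \<theta>
    proof -
      have \<theta>: "\<theta> \<in> Obj (theta n)" using that by simp
      have "?o1 k \<theta> \<in> Obj SSets" using o1[OF \<theta>] by (simp add: SSets_def)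
      note J = S.Ide_Hom[OF this]
      have "far (?o2 k) (Ide (theta n) \<theta>) = Ide SSets (?o1 k \<theta>)"
      proof (rule setN_eqI[OF n2[OF T.Ide_Hom[OF \<theta>], unfolded SSets_def] J[unfolded SSets_def], folded SSets_def])
        fix m x assume x: "x \<in> fob (?o1 k \<theta>) m"
        show "sfun (ncmp (far (?o2 k) (Ide (theta n) \<theta>)) m) x = sfun (ncmp (Ide SSets (?o1 k \<theta>)) m) x"
          using x id[OF \<theta>, of x k m] unfolding SSets_def
          by (simp add: fob1 far2[OF T.Ide_Hom[OF \<theta>]] del: Delta_simps(2-))
      qed
      then show ?thesis using \<theta> by (simp add: fob2)
    qed
    fix f f' \<theta> \<theta>' \<theta>'' assume "f \<in> Hom (opp (theta n)) \<theta> \<theta>'" and "f' \<in> Hom (opp (theta n)) \<theta>' \<theta>''"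
    then have F: "f' \<in> Hom (theta n) \<theta>'' \<theta>'" "f \<in> Hom (theta n) \<theta>' \<theta>" by simp_all
    have ob: "\<theta> \<in> Obj (theta n)" "\<theta>' \<in> Obj (theta n)" "\<theta>'' \<in> Obj (theta n)"
      using T.Hom_Obj[OF F(1)] T.Hom_Obj[OF F(2)] by auto
    have "far (?o2 k) (Cmp (theta n) f f') = Cmp SSets (far (?o2 k) f') (far (?o2 k) f)"
    proof (rule setN_eqI[OF n2[OF T.Cmp_Hom[OF F], unfolded SSets_def]
          S.Cmp_Hom[OF n2[OF F(2)] n2[OF F(1)], unfolded SSets_def], folded SSets_def])
      fix m x assume x: "x \<in> fob (?o1 k \<theta>) m"
      then have x': "x \<in> S (k, \<theta>, m)" by (simp add: fob1)
      show "sfun (ncmp (far (?o2 k) (Cmp (theta n) f f')) m) x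
          = sfun (ncmp (Cmp SSets (far (?o2 k) f') (far (?o2 k) f)) m) x"
        using setN_Cmp[OF n2[OF F(2), unfolded SSets_def] _ x, of "far (?o2 k) f'"] x'
          fact[OF I I F I I x'] A_in'[OF I F(2) I x'] D.Cmp_Ide_left[OF I]
        by (simp add: SSets_def fob1 far2[OF F(1)] far2[OF F(2)] far2[OF T.Cmp_Hom[OF F]]
          del: Delta_simps(2-) SetC_simps fun_cat_simps ncmp_Cmp)
    qed
    then show "far (?o2 k) (Cmp (opp (theta n)) f' f) = Cmp SSets (far (?o2 k) f') (far (?o2 k) f)" by simp
  qed
  have fob3: "fob (mk_obj n S A) k = ?o2 k" for k by (simp add: mk_obj_def)
  have far3: "far (mk_obj n S A) a = \<lparr>nsrc = ?o2 k, ntgt = ?o2 k', ncmp = (\<lambda>\<theta> \<in> Obj (theta n).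
      mk_ntr (opp Delta) (?o1 k \<theta>) (?o1 k' \<theta>) (\<lambda>m. A (a, Ide (theta n) \<theta>, Ide Delta m)))\<rparr>"
    if "a \<in> Hom Delta k' k" for a k k' using Hom_Arr[OF that] by (simp add: mk_obj_def)
  have n3': "mk_ntr (opp Delta) (?o1 k \<theta>) (?o1 k' \<theta>) (\<lambda>m. A (a, Ide (theta n) \<theta>, Ide Delta m)) \<in>
       Hom SSets (?o1 k \<theta>) (?o1 k' \<theta>)" if a: "a \<in> Hom Delta k' k" and \<theta>: "\<theta> \<in> Obj (theta n)" for a k k' \<theta>
    unfolding SSets_def
  proof (rule mk_ntr_Hom[OF category_opp[OF category_Delta] o1[OF \<theta>] o1[OF \<theta>]])
    show "A (a, Ide (theta n) \<theta>, Ide Delta m) x \<in> fob (?o1 k' \<theta>) m" if "x \<in> fob (?o1 k \<theta>) m" for m x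
      using A_in'[OF a T.Ide_Hom[OF \<theta>] I] that by (simp only: fob1)
    fix m m' b x assume "b \<in> Hom (opp Delta) m m'" and "x \<in> fob (?o1 k \<theta>) m"
    then have b: "b \<in> Hom Delta m' m" and x: "x \<in> S (k, \<theta>, m)" by (simp_all add: fob1)
    note J = T.Ide_Hom[OF \<theta>]
    show "sfun (far (?o1 k' \<theta>) b) (A (a, Ide (theta n) \<theta>, Ide Delta m) x) = A (a, Ide (theta n) \<theta>, Ide Delta m') (sfun (far (?o1 k \<theta>) b) x)"
      using fact[OF I a J J b I x] fact[OF a I J J I b x] A_in'[OF a J I x]
        T.Cmp_Ide_left[OF J] D.Cmp_Ide_left[OF b] D.Cmp_Ide_right[OF b] D.Cmp_Ide_left[OF a] D.Cmp_Ide_right[OF a] x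
      by (simp add: far1[OF b] del: Delta_simps)
  qed
  have n3: "far (mk_obj n S A) a \<in> Hom (ThetaSp n) (?o2 k) (?o2 k')" if a: "a \<in> Hom Delta k' k" for a k k'
    unfolding ThetaSp_def Hom_fun_cat far3[OF a]
  proof (intro conjI is_ntrI)
    fix f \<theta> \<theta>' assume "f \<in> Hom (opp (theta n)) \<theta> \<theta>'"
    then have f: "f \<in> Hom (theta n) \<theta>' \<theta>" by simp
    have ob: "\<theta> \<in> Obj (theta n)" "\<theta>' \<in> Obj (theta n)" using T.Hom_Obj[OF f] by auto
    let ?N = "\<lambda>\<theta>. mk_ntr (opp Delta) (?o1 k \<theta>) (?o1 k' \<theta>) (\<lambda>m. A (a, Ide (theta n) \<theta>, Ide Delta m))"
    note N = n3'[OF a ob(1)] n3'[OF a ob(2)]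
    have "Cmp SSets (far (?o2 k') f) (?N \<theta>) = Cmp SSets (?N \<theta>') (far (?o2 k) f)"
    proof (rule setN_eqI[OF S.Cmp_Hom[OF N(1) n2[OF f], unfolded SSets_def] S.Cmp_Hom[OF n2[OF f] N(2), unfolded SSets_def], folded SSets_def])
      fix m x assume x: "x \<in> fob (?o1 k \<theta>) m"
      then have x': "x \<in> S (k, \<theta>, m)" by (simp add: fob1)
      show "sfun (ncmp (Cmp SSets (far (?o2 k') f) (?N \<theta>)) m) x = sfun (ncmp (Cmp SSets (?N \<theta>') (far (?o2 k) f)) m) x"
        using setN_Cmp[OF N(1)[unfolded SSets_def] _ x, of "far (?o2 k') f"]
          setN_Cmp[OF n2[OF f, unfolded SSets_def] _ x, of "?N \<theta>'"] x'
          fact[OF I a f T.Ide_Hom[OF ob(1)] I I x'] fact[OF a I T.Ide_Hom[OF ob(2)] f I I x']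
          A_in'[OF a T.Ide_Hom[OF ob(1)] I x'] A_in'[OF I f I x'] D.Cmp_Ide_left[OF I]
          T.Cmp_Ide_left[OF f] T.Cmp_Ide_right[OF f] D.Cmp_Ide_left[OF a] D.Cmp_Ide_right[OF a]
        by (simp add: SSets_def fob1 far2[OF f] del: Delta_simps(2-) SetC_simps fun_cat_simps ncmp_Cmp)
    qed
    then show "Cmp SSets (far (ntgt \<lparr>nsrc = ?o2 k, ntgt = ?o2 k', ncmp = restrict ?N (Obj (theta n))\<rparr>) f)
        (ncmp \<lparr>nsrc = ?o2 k, ntgt = ?o2 k', ncmp = restrict ?N (Obj (theta n))\<rparr> \<theta>) =
       Cmp SSets (ncmp \<lparr>nsrc = ?o2 k, ntgt = ?o2 k', ncmp = restrict ?N (Obj (theta n))\<rparr> \<theta>')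
        (far (nsrc \<lparr>nsrc = ?o2 k, ntgt = ?o2 k', ncmp = restrict ?N (Obj (theta n))\<rparr>) f)"
      using ob by simp
  qed (use o2 n3'[OF a] fob2 in auto)
  have ncmp3: "sfun (ncmp (ncmp (far (mk_obj n S A) a) \<theta>) m) x = A (a, Ide (theta n) \<theta>, Ide Delta m) x"
    if "a \<in> Hom Delta k' k" "\<theta> \<in> Obj (theta n)" "x \<in> S (k, \<theta>, m)" for a k k' \<theta> m x
    using that by (simp add: far3[OF that(1)] fob1 del: Delta_simps(2-))
  have eq3: "t = t'" if t: "t \<in> Hom (ThetaSp n) (?o2 k) (?o2 k')" "t' \<in> Hom (ThetaSp n) (?o2 k) (?o2 k')"
    and e: "\<And>\<theta> m x. \<theta> \<in> Obj (theta n) \<Longrightarrow> x \<in> S (k, \<theta>, m) \<Longrightarrow> sfun (ncmp (ncmp t \<theta>) m) x = sfun (ncmp (ncmp t' \<theta>) m) x"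
    for t t' k k'
  proof (rule ntr_eqI[OF t[unfolded ThetaSp_def]])
    fix \<theta> assume "\<theta> \<in> Obj (opp (theta n))"
    then have \<theta>: "\<theta> \<in> Obj (theta n)" by simp
    show "ncmp t \<theta> = ncmp t' \<theta>"
      by (rule setN_eqI[OF funN_in[OF t(1)[unfolded ThetaSp_def], unfolded SSets_def] funN_in[OF t(2)[unfolded ThetaSp_def], unfolded SSets_def]])
        (use \<theta> e[OF \<theta>] in \<open>simp_all add: fob2 fob1\<close>)
  qed
  have o3: "is_functor (opp Delta) (ThetaSp n) (mk_obj n S A)"
  proof (rule is_functorI)
    show ob: "fob (mk_obj n S A) k \<in> Obj (ThetaSp n)" for k using o2 by (simp add: fob3 ThetaSp_def)
    show "far (mk_obj n S A) a \<in> Hom (ThetaSp n) (fob (mk_obj n S A) k) (fob (mk_obj n S A) k')" if "a \<in> Hom (opp Delta) k k'" for a k k'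
      using that n3 by (simp add: fob3)
    show "far (mk_obj n S A) (Ide (opp Delta) k) = Ide (ThetaSp n) (fob (mk_obj n S A) k)" for k
      unfolding fob3 opp_simps
    proof (rule eq3[OF n3[OF I] H.Ide_Hom[OF ob[of k, unfolded fob3]]])
      fix \<theta> m x assume \<theta>: "\<theta> \<in> Obj (theta n)" and x: "x \<in> S (k, \<theta>, m)"
      show "sfun (ncmp (ncmp (far (mk_obj n S A) (Ide Delta k)) \<theta>) m) x = sfun (ncmp (ncmp (Ide (ThetaSp n) (?o2 k)) \<theta>) m) x"
        unfolding ncmp3[OF I \<theta> x] using \<theta> x id[OF \<theta> x] by (simp add: ThetaSp_def SSets_def fob2 fob1 del: Delta_simps(2-))
    qed
    fix a a' k k' k'' assume "a \<in> Hom (opp Delta) k k'" "a' \<in> Hom (opp Delta) k' k''"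
    then have a: "a' \<in> Hom Delta k'' k'" "a \<in> Hom Delta k' k" by simp_all
    show "far (mk_obj n S A) (Cmp (opp Delta) a' a) = Cmp (ThetaSp n) (far (mk_obj n S A) a') (far (mk_obj n S A) a)"
      unfolding opp_simps
    proof (rule eq3[OF n3[OF D.Cmp_Hom[OF a]] H.Cmp_Hom[OF n3[OF a(2)] n3[OF a(1)]]])
      fix \<theta> m x assume \<theta>: "\<theta> \<in> Obj (theta n)" and x: "x \<in> S (k, \<theta>, m)"
      note J = T.Ide_Hom[OF \<theta>]
      have h: "ncmp (far (mk_obj n S A) a) \<theta> \<in> Hom (fun_cat (opp Delta) SetC) (?o1 k \<theta>) (?o1 k' \<theta>)"
        using n3'[OF a(2) \<theta>] \<theta> by (simp add: far3[OF a(2)] SSets_def)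
      have e: "ncmp (Cmp (ThetaSp n) (far (mk_obj n S A) a') (far (mk_obj n S A) a)) \<theta>
         = Cmp (fun_cat (opp Delta) SetC) (ncmp (far (mk_obj n S A) a') \<theta>) (ncmp (far (mk_obj n S A) a) \<theta>)"
        using \<theta> by (simp add: ThetaSp_def SSets_def)
      have "sfun (ncmp (ncmp (Cmp (ThetaSp n) (far (mk_obj n S A) a') (far (mk_obj n S A) a)) \<theta>) m) x
        = A (a', Ide (theta n) \<theta>, Ide Delta m) (A (a, Ide (theta n) \<theta>, Ide Delta m) x)"
        unfolding e using setN_Cmp[OF h, of m x] x ncmp3[OF a(2) \<theta> x] ncmp3[OF a(1) \<theta> A_in'[OF a(2) J I x]]
        by (simp add: fob1 del: Delta_simps(2-) SetC_simps fun_cat_simps ncmp_Cmp)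
      then show "sfun (ncmp (ncmp (far (mk_obj n S A) (Cmp Delta a a')) \<theta>) m) x =
        sfun (ncmp (ncmp (Cmp (ThetaSp n) (far (mk_obj n S A) a') (far (mk_obj n S A) a)) \<theta>) m) x"
        using ncmp3[OF D.Cmp_Hom[OF a] \<theta> x] fact[OF a J J I I x] D.Cmp_Ide_left[OF I] T.Cmp_Ide_left[OF J]
        by (simp del: Delta_simps)
    qed
  qed (simp_all add: mk_obj_def)
  then show X: "mk_obj n S A \<in> Obj (SimpThetaSp n)" by (simp add: SimpThetaSp_def)
  assume "p \<in> Hom (site n) c d" and xd: "x \<in> S d"
  then obtain a f b k \<theta> m k' \<theta>' m' where
      p: "p = (a, f, b)" "c = (k', \<theta>', m')" "d = (k, \<theta>, m)"
       and a: "a \<in> Hom Delta k' k" and f: "f \<in> Hom (theta n) \<theta>' \<theta>" and b: "b \<in> Hom Delta m' m"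
    by (elim Hom_siteE) blast
  have ob: "\<theta> \<in> Obj (theta n)" "\<theta>' \<in> Obj (theta n)" using T.Hom_Obj[OF f] by auto
  have x: "x \<in> S (k, \<theta>, m)" using xd p by simp
  let ?x1 = "A (a, Ide (theta n) \<theta>, Ide Delta m) x"
  have x1: "?x1 \<in> S (k', \<theta>, m)" using A_in'[OF a T.Ide_Hom[OF ob(1)] I x] .
  have x2: "A (Ide Delta k', f, Ide Delta m) ?x1 \<in> S (k', \<theta>', m)" using A_in'[OF I f I x1] .
  have e: "A (Ide Delta k', f, Ide Delta m) ?x1 = A (a, f, Ide Delta m) x"
    using fact[OF I a f T.Ide_Hom[OF ob(1)] I I x] D.Cmp_Ide_right[OF a] T.Cmp_Ide_left[OF f] D.Cmp_Ide_left[OF I]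
    by (simp del: Delta_simps)
  have e2: "A (Ide Delta k', Ide (theta n) \<theta>', b) (A (a, f, Ide Delta m) x) = A (a, f, b) x"
    using fact[OF I a T.Ide_Hom[OF ob(2)] f b I x] D.Cmp_Ide_right[OF a] T.Cmp_Ide_right[OF f] D.Cmp_Ide_left[OF b]
    by (simp del: Delta_simps)
  have "act n (mk_obj n S A) p x = sfun (far (?o1 k' \<theta>') b) (sfun (ncmp (far (?o2 k') f) m) ?x1)"
    using act_eq[OF X a f b, of x] p ncmp3[OF a ob(1) x] ob by (simp add: fob3 fob2 del: Delta_simps(2-))
  also have "sfun (ncmp (far (?o2 k') f) m) ?x1 = A (Ide Delta k', f, Ide Delta m) ?x1"
    using x1 by (simp add: far2[OF f] fob1 del: Delta_simps(2-))
  also have "sfun (far (?o1 k' \<theta>') b) (A (Ide Delta k', f, Ide Delta m) ?x1)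
     = A (Ide Delta k', Ide (theta n) \<theta>', b) (A (Ide Delta k', f, Ide Delta m) ?x1)"
    using x2 by (simp add: far1[OF b] del: Delta_simps(2-))
  finally show "act n (mk_obj n S A) p x = A p x" using e e2 p by simp
qed

lemmas act_mk_obj = mk_obj_Obj(2)

section \<open>Small sets\<close>

lemma inaccessible_infinite:
  assumes "inaccessible TYPE('u)"
  shows "infinite (UNIV :: 'u set)"
  using assms unfolding inaccessible_def
  by (metis infinite_iff_natLeq_ordLeq ordLess_imp_ordLeq)

lemma finite_ordLess_infinite_set:
  assumes "infinite B" "finite A"
  shows "(card_of A, card_of B) \<in> ordLess"
  unfolding card_of_ordLess[symmetric] using assms by (meson finite_imageD finite_subset)

lemma small_finite: "infinite (UNIV :: 'u set) \<Longrightarrow> finite A \<Longrightarrow> small (A :: 'u set)"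
  unfolding small_def by (rule finite_ordLess_infinite_set)

text \<open>An infinite type is equivalent to its square, so that products of its subsets can be formed inside
  of it.\<close>

definition pair :: "'u \<times> 'u \<Rightarrow> 'u" where
  "pair = (SOME e. inj e)"

lemma inj_pair:
  assumes "infinite (UNIV :: 'u set)"
  shows "inj (pair :: 'u \<times> 'u \<Rightarrow> 'u)"
proof -
  have "(card_of (UNIV \<times> UNIV :: ('u \<times> 'u) set), card_of (UNIV :: 'u set)) \<in> ordLeq"
    using card_of_Times_same_infinite[OF assms] by (rule ordIso_imp_ordLeq)
  then have "\<exists>e :: 'u \<times> 'u \<Rightarrow> 'u. inj e"
    unfolding card_of_ordLeq[symmetric] by auto
  then show ?thesis unfolding pair_def by (rule someI_ex)
qed

lemma small_pair:
  assumes "infinite (UNIV :: 'u set)" "small (A :: 'u set)" "small B"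
  shows "small (pair ` (A \<times> B))"
proof -
  have "(card_of (A \<times> B), card_of (UNIV :: 'u set)) \<in> ordLess"
  proof -
    have bound: "(card_of (A \<times> B), card_of (UNIV :: 'u set)) \<in> ordLess"
      if "(card_of A, card_of M) \<in> ordLeq" "(card_of B, card_of M) \<in> ordLeq"
        "(card_of M, card_of (UNIV :: 'u set)) \<in> ordLess" for M :: "'u set"
    proof (cases "finite M")
      case True
      then show ?thesis
        using card_of_ordLeq_finite[OF that(1)] card_of_ordLeq_finite[OF that(2)]
        by (intro finite_ordLess_infinite_set assms) simp
    next
      case False
      then have "(card_of (A \<times> B), card_of M) \<in> ordLeq"
        using card_of_Times_ordLeq_infinite_Field[OF _ that(1,2) card_of_Card_order] by (simp add: Field_card_of)
      then show ?thesis using that(3) ordLeq_ordLess_trans by blast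
    qed
    have "(card_of A, card_of B) \<in> ordLeq \<or> (card_of B, card_of A) \<in> ordLeq"
      using ordLeq_total card_of_Well_order by blast
    then show ?thesis
      using bound[of A] bound[of B] assms(2,3) card_of_refl[THEN ordIso_imp_ordLeq]
      unfolding small_def by blast
  qed
  then show ?thesis unfolding small_def using card_of_image ordLeq_ordLess_trans by blast
qed

lemma inj_enc:
  assumes "infinite (UNIV :: 'u set)" "finite S"
  shows "inj_on (enc S :: 'x \<Rightarrow> 'u) S"
proof -
  have "\<exists>e :: 'x \<Rightarrow> 'u. inj_on e S"
    using ordLess_imp_ordLeq[OF finite_ordLess_infinite_set[OF assms]]
    unfolding card_of_ordLeq[symmetric] by blast
  then show ?thesis unfolding enc_def by (rule someI_ex)
qed

section \<open>Products of simplicial objects\<close>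

text \<open>The product is formed elementwise, with pairs encoded by \<open>pair\<close>.\<close>

lemma product_exists:
  fixes X Y :: "'u spc"
  assumes inf: "infinite (UNIV :: 'u set)"
    and X: "X \<in> Obj (SimpThetaSp n)" and Y: "Y \<in> Obj (SimpThetaSp n)"
  shows "\<exists>P p. is_limit (SimpThetaSp n) UNIV (\<lambda>i. if i then Y else X) {} P p \<and>
    (\<forall>c \<in> Obj (site n). (\<forall>z \<in> el P c. \<forall>z' \<in> el P c. (\<forall>i. cmp (p i) c z = cmp (p i) c z') \<longrightarrow> z = z') \<and>
      (\<forall>x \<in> el X c. \<forall>y \<in> el Y c. \<exists>z \<in> el P c. cmp (p False) c z = x \<and> cmp (p True) c z = y))"
proof -
  note inj = inj_pair[OF inf]
  define up :: "'u \<Rightarrow> 'u \<times> 'u" where "up = inv pair"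
  have up [simp]: "up (pair x) = x" for x using inj by (simp add: up_def)
  define S where "S = (\<lambda>c. pair ` (el X c \<times> el Y c))"
  define A where "A = (\<lambda>p u. pair (act n X p (fst (up u)), act n Y p (snd (up u))))"
  have psh: "is_psh n S A" unfolding is_psh_def
  proof (intro conjI allI impI ballI)
    show "small (S c)" if "c \<in> Obj (site n)" for c
      unfolding S_def using that by (intro small_pair inf spc_small[OF X] spc_small[OF Y])
    show "A p x \<in> S c" if "p \<in> Hom (site n) c d" "x \<in> S d" for c d p x
      using that act_in[OF X that(1)] act_in[OF Y that(1)] by (auto simp: S_def A_def)
    show "A (Ide (site n) c) x = x" if "c \<in> Obj (site n)" "x \<in> S c" for c x
      using that act_Ide[OF X that(1)] act_Ide[OF Y that(1)] by (auto simp: S_def A_def)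
    show "A (Cmp (site n) q p) x = A p (A q x)"
      if "p \<in> Hom (site n) c d" "q \<in> Hom (site n) d e" "x \<in> S e" for c d e p q x
      using that act_Cmp[OF X that(1,2)] act_Cmp[OF Y that(1,2)] by (auto simp: S_def A_def)
  qed
  let ?P = "mk_obj n S A"
  note P = mk_obj_Obj(1)[OF psh] and elP = el_mk_obj[of _ n S A] and actP = act_mk_obj[OF psh]
  define Z where "Z = (\<lambda>i. if i then Y else X)"
  define p where "p = (\<lambda>i. mk_map n ?P (Z i) (\<lambda>c u. if i then snd (up u) else fst (up u)))"
  have ZO: "Z i \<in> Obj (SimpThetaSp n)" for i using X Y by (simp add: Z_def)
  have Ob: "d \<in> Obj (site n)" "c \<in> Obj (site n)" if "p \<in> Hom (site n) c d" for p c d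
    using category.Hom_Obj[OF category_site that] by auto
  have pH: "p i \<in> Hom (SimpThetaSp n) ?P (Z i)" for i
    unfolding p_def
  proof (rule mk_map_Hom[OF P ZO])
    show "(if i then snd (up x) else fst (up x)) \<in> el (Z i) c"
      if "c \<in> Obj (site n)" "x \<in> el ?P c" for c x
      using that elP[OF that(1)] by (auto simp: S_def Z_def)
    show "act n (Z i) q (if i then snd (up x) else fst (up x)) =
        (if i then snd (up (act n ?P q x)) else fst (up (act n ?P q x)))"
      if "q \<in> Hom (site n) c d" "x \<in> el ?P d" for q c d x
      using that elP[OF Ob(1)[OF that(1)]] actP[OF that(1)] by (auto simp: A_def Z_def)
  qed
  have pc: "cmp (p i) c x = (if i then snd (up x) else fst (up x))"
    if "c \<in> Obj (site n)" "x \<in> el ?P c" for i c x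
    unfolding p_def using that by (simp add: cmp_mk_map)
  have inj: "\<forall>z \<in> el ?P c. \<forall>z' \<in> el ?P c. (\<forall>i. cmp (p i) c z = cmp (p i) c z') \<longrightarrow> z = z'"
    if c: "c \<in> Obj (site n)" for c
  proof (intro ballI impI)
    fix z z' assume z: "z \<in> el ?P c" "z' \<in> el ?P c" and e: "\<forall>i. cmp (p i) c z = cmp (p i) c z'"
    have "up z = up z'" using e[rule_format, of True] e[rule_format, of False] pc[OF c z(1)] pc[OF c z(2)]
      by (simp add: prod_eq_iff)
    then show "z = z'" using z elP[OF c] by (auto simp: S_def)
  qed
  have "is_limit (SimpThetaSp n) UNIV Z {} ?P p"
    unfolding is_limit_def is_cone_def
  proof (intro conjI allI impI)
    show "?P \<in> Obj (SimpThetaSp n)" by (rule P)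
    show "\<forall>i \<in> UNIV. p i \<in> Hom (SimpThetaSp n) ?P (Z i)" using pH by blast
    fix w q assume "w \<in> Obj (SimpThetaSp n) \<and> (\<forall>i \<in> UNIV. q i \<in> Hom (SimpThetaSp n) w (Z i)) \<and>
      (\<forall>(i, a, j) \<in> {}. Cmp (SimpThetaSp n) a (q i) = q j)"
    then have w: "w \<in> Obj (SimpThetaSp n)" and q: "\<And>i. q i \<in> Hom (SimpThetaSp n) w (Z i)" by auto
    define h where "h = mk_map n w ?P (\<lambda>c x. pair (cmp (q False) c x, cmp (q True) c x))"
    have qF: "q False \<in> Hom (SimpThetaSp n) w X" and qT: "q True \<in> Hom (SimpThetaSp n) w Y"
      using q[of False] q[of True] by (simp_all add: Z_def)
    have h: "h \<in> Hom (SimpThetaSp n) w ?P" unfolding h_def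
    proof (rule mk_map_Hom[OF w P])
      show im: "pair (cmp (q False) c x, cmp (q True) c x) \<in> el ?P c" if "c \<in> Obj (site n)" "x \<in> el w c" for c x
        using elP[OF that(1)] cmp_in[OF qF that] cmp_in[OF qT that] by (simp add: S_def)
      fix r c d x assume r: "r \<in> Hom (site n) c d" and x: "x \<in> el w d"
      show "act n ?P r (pair (cmp (q False) d x, cmp (q True) d x)) =
           pair (cmp (q False) c (act n w r x), cmp (q True) c (act n w r x))"
        using im[OF Ob(1)[OF r] x] actP[OF r] elP[OF Ob(1)[OF r]] cmp_nat[OF qF r x] cmp_nat[OF qT r x]
        by (simp add: A_def)
    qed
    have hc: "cmp h c x = pair (cmp (q False) c x, cmp (q True) c x)"
      if "c \<in> Obj (site n)" "x \<in> el w c" for c x using that by (simp add: h_def cmp_mk_map)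
    have ph: "Cmp (SimpThetaSp n) (p i) h = q i" for i
    proof (rule cmp_eqI[OF category.Cmp_Hom[OF SimpThetaSp_cat h pH] q])
      fix c x assume cx: "c \<in> Obj (site n)" "x \<in> el w c"
      show "cmp (Cmp (SimpThetaSp n) (p i) h) c x = cmp (q i) c x"
        using cmp_Cmp[OF h cx] pc[OF cx(1) cmp_in[OF h cx]] hc[OF cx] by simp
    qed
    show "\<exists>!h. h \<in> Hom (SimpThetaSp n) w ?P \<and> (\<forall>i \<in> UNIV. Cmp (SimpThetaSp n) (p i) h = q i)"
    proof (intro ex1I[of _ h] conjI ballI ph h)
      fix g assume g: "g \<in> Hom (SimpThetaSp n) w ?P \<and> (\<forall>i \<in> UNIV. Cmp (SimpThetaSp n) (p i) g = q i)"
      show "g = h"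
      proof (rule cmp_eqI[OF conjunct1[OF g] h])
        fix c x assume cx: "c \<in> Obj (site n)" "x \<in> el w c"
        have gH: "g \<in> Hom (SimpThetaSp n) w ?P" using g by blast
        have "cmp (p i) c (cmp g c x) = cmp (p i) c (cmp h c x)" for i
          using cmp_Cmp[OF gH cx, of "p i"] cmp_Cmp[OF h cx, of "p i"] ph[of i] g by simp
        then show "cmp g c x = cmp h c x" using inj[OF cx(1)] cmp_in[OF gH cx] cmp_in[OF h cx] by blast
      qed
    qed
  qed auto
  moreover have "\<exists>z \<in> el ?P c. cmp (p False) c z = x \<and> cmp (p True) c z = y"
    if "c \<in> Obj (site n)" "x \<in> el X c" "y \<in> el Y c" for c x y
  proof (intro bexI conjI)
    show z: "pair (x, y) \<in> el ?P c" using that elP[OF that(1)] by (simp add: S_def)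
    show "cmp (p False) c (pair (x, y)) = x" "cmp (p True) c (pair (x, y)) = y"
      using pc[OF that(1) z] by simp_all
  qed
  ultimately show ?thesis unfolding Z_def using inj by blast
qed

text \<open>The product singled out by \<open>prod_cone\<close> is isomorphic to the elementwise one, so its elements
  correspond to pairs as well. Thus the chosen products can be handled through their projections
  only.\<close>

lemma chosen_product:
  fixes X Y :: "'u spc"
  assumes inf: "infinite (UNIV :: 'u set)"
    and X: "X \<in> Obj (SimpThetaSp n)" and Y: "Y \<in> Obj (SimpThetaSp n)"
  defines "P \<equiv> prod_ob (SimpThetaSp n) X Y"
    and "p \<equiv> snd (prod_cone (SimpThetaSp n) X Y)"
  shows "is_limit (SimpThetaSp n) UNIV (\<lambda>i. if i then Y else X) {} P p"
    and "p False \<in> Hom (SimpThetaSp n) P X" "p True \<in> Hom (SimpThetaSp n) P Y"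
    and "c \<in> Obj (site n) \<Longrightarrow> z \<in> el P c \<Longrightarrow> z' \<in> el P c \<Longrightarrow>
      cmp (p False) c z = cmp (p False) c z' \<Longrightarrow> cmp (p True) c z = cmp (p True) c z' \<Longrightarrow> z = z'"
    and "c \<in> Obj (site n) \<Longrightarrow> x \<in> el X c \<Longrightarrow> y \<in> el Y c \<Longrightarrow>
      \<exists>z \<in> el P c. cmp (p False) c z = x \<and> cmp (p True) c z = y"
proof -
  interpret category "SimpThetaSp n :: ('u spc, 'u spcmap) cat" by (rule SimpThetaSp_cat)
  let ?C = "SimpThetaSp n :: ('u spc, 'u spcmap) cat"
  let ?Z = "\<lambda>i. if i then Y else X"
  obtain P' p' where lim': "is_limit ?C UNIV ?Z {} P' p'"
    and P': "\<And>c z z'. c \<in> Obj (site n) \<Longrightarrow> z \<in> el P' c \<Longrightarrow> z' \<in> el P' c \<Longrightarrow>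
      (\<And>i. cmp (p' i) c z = cmp (p' i) c z') \<Longrightarrow> z = z'"
      "\<And>c x y. c \<in> Obj (site n) \<Longrightarrow> x \<in> el X c \<Longrightarrow> y \<in> el Y c \<Longrightarrow>
      \<exists>z \<in> el P' c. cmp (p' False) c z = x \<and> cmp (p' True) c z = y"
    using product_exists[OF inf X Y] by blast
  have "case (P', p') of (l, p) \<Rightarrow> is_limit ?C UNIV ?Z {} l p" using lim' by simp
  then have "case prod_cone ?C X Y of (l, p) \<Rightarrow> is_limit ?C UNIV ?Z {} l p"
    unfolding prod_cone_def by (rule someI)
  then show lim: "is_limit ?C UNIV ?Z {} P p"
    unfolding P_def p_def prod_ob_def by (simp add: case_prod_beta)
  have cone: "is_cone ?C UNIV ?Z {} P p" "is_cone ?C UNIV ?Z {} P' p'"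
    using lim lim' by (simp_all add: is_limit_def)
  have pH: "p i \<in> Hom ?C P (?Z i)" and pH': "p' i \<in> Hom ?C P' (?Z i)" for i
    using cone unfolding is_cone_def by blast+
  show "p False \<in> Hom ?C P X" "p True \<in> Hom ?C P Y" using pH[of False] pH[of True] by auto
  obtain h where h: "h \<in> Hom ?C P P'" "\<And>i. Cmp ?C (p' i) h = p i"
    using lim' cone(1) unfolding is_limit_def by blast
  obtain k where k: "k \<in> Hom ?C P' P" "\<And>i. Cmp ?C (p i) k = p' i"
    using lim cone(2) unfolding is_limit_def by blast
  have kh: "Cmp ?C k h = Ide ?C P"
  proof -
    have "\<exists>!g. g \<in> Hom ?C P P \<and> (\<forall>i \<in> UNIV. Cmp ?C (p i) g = p i)"
      using lim cone(1) unfolding is_limit_def by blast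
    moreover have "Cmp ?C k h \<in> Hom ?C P P" using Cmp_Hom[OF h(1) k(1)] .
    moreover have "Cmp ?C (p i) (Cmp ?C k h) = p i" for i
      using Cmp_assoc[OF h(1) k(1) pH] h(2)[of i] k(2)[of i] by simp
    moreover have "Ide ?C P \<in> Hom ?C P P" using Hom_Obj[OF h(1)] Ide_Hom by blast
    moreover have "Cmp ?C (p i) (Ide ?C P) = p i" for i using Cmp_Ide_right[OF pH] .
    ultimately show ?thesis by blast
  qed
  show "z = z'" if c: "c \<in> Obj (site n)" and z: "z \<in> el P c" "z' \<in> el P c"
    and e: "cmp (p False) c z = cmp (p False) c z'" "cmp (p True) c z = cmp (p True) c z'"
  proof -
    have e': "cmp (p i) c z = cmp (p i) c z'" for i using e by (cases i) auto
    have "cmp (p' i) c (cmp h c z) = cmp (p' i) c (cmp h c z')" for i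
      using cmp_Cmp[OF h(1) c z(1), of "p' i"] cmp_Cmp[OF h(1) c z(2), of "p' i"] h(2)[of i] e'[of i] by simp
    then have "cmp h c z = cmp h c z'" using P'(1)[OF c] cmp_in[OF h(1) c] z by blast
    then have "cmp (Cmp ?C k h) c z = cmp (Cmp ?C k h) c z'"
      using cmp_Cmp[OF h(1) c z(1), of k] cmp_Cmp[OF h(1) c z(2), of k] by simp
    then show ?thesis using cmp_Ide[OF c z(1)] cmp_Ide[OF c z(2)] by (simp add: kh)
  qed
  show "\<exists>z \<in> el P c. cmp (p False) c z = x \<and> cmp (p True) c z = y"
    if c: "c \<in> Obj (site n)" and xy: "x \<in> el X c" "y \<in> el Y c"
  proof -
    obtain z where z: "z \<in> el P' c" "cmp (p' False) c z = x" "cmp (p' True) c z = y"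
      using P'(2)[OF c xy] by blast
    show ?thesis
    proof (intro bexI conjI)
      show "cmp k c z \<in> el P c" using cmp_in[OF k(1) c z(1)] .
      show "cmp (p False) c (cmp k c z) = x" "cmp (p True) c (cmp k c z) = y"
        using cmp_Cmp[OF k(1) c z(1), of "p False"] cmp_Cmp[OF k(1) c z(1), of "p True"] k(2) z by simp_all
    qed
  qed
qed

lemma prod_ar_Hom:
  fixes X Y X' Y' :: "'u spc"
  assumes inf: "infinite (UNIV :: 'u set)"
    and f: "f \<in> Hom (SimpThetaSp n) X X'" and g: "g \<in> Hom (SimpThetaSp n) Y Y'"
  defines "C \<equiv> SimpThetaSp n :: ('u spc, 'u spcmap) cat"
  shows "prod_ar C f g \<in> Hom C (prod_ob C X Y) (prod_ob C X' Y')"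
    and "Cmp C (snd (prod_cone C X' Y') False) (prod_ar C f g) = Cmp C f (snd (prod_cone C X Y) False)"
    and "Cmp C (snd (prod_cone C X' Y') True) (prod_ar C f g) = Cmp C g (snd (prod_cone C X Y) True)"
proof -
  interpret category C unfolding C_def by (rule SimpThetaSp_cat)
  have ob: "X \<in> Obj C" "Y \<in> Obj C" "X' \<in> Obj C" "Y' \<in> Obj C"
    using Hom_Obj f g unfolding C_def by blast+
  note P = chosen_product[OF inf ob(1,2)[unfolded C_def], folded C_def]
  note P' = chosen_product(1)[OF inf ob(3,4)[unfolded C_def], folded C_def]
  define q where "q = (\<lambda>i. if i then Cmp C g (snd (prod_cone C X Y) True) else Cmp C f (snd (prod_cone C X Y) False))"
  have "is_cone C UNIV (\<lambda>i. if i then Y' else X') {} (prod_ob C X Y) q"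
    unfolding is_cone_def q_def
    using Cmp_Hom[OF P(2) f[folded C_def]] Cmp_Hom[OF P(3) g[folded C_def]] Hom_Obj[OF P(2)] by auto
  then have ex: "\<exists>!h. h \<in> Hom C (prod_ob C X Y) (prod_ob C X' Y') \<and>
     (\<forall>i \<in> UNIV. Cmp C (snd (prod_cone C X' Y') i) h = q i)"
    using P' unfolding is_limit_def by blast
  have eq: "(\<forall>i \<in> UNIV. Cmp C (snd (prod_cone C X' Y') i) h = q i) \<longleftrightarrow>
     Cmp C (snd (prod_cone C X' Y') False) h = Cmp C f (snd (prod_cone C X Y) False) \<and>
     Cmp C (snd (prod_cone C X' Y') True) h = Cmp C g (snd (prod_cone C X Y) True)" for h
    unfolding q_def UNIV_bool by auto
  have "prod_ar C f g \<in> Hom C (prod_ob C X Y) (prod_ob C X' Y') \<and>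
     Cmp C (snd (prod_cone C X' Y') False) (prod_ar C f g) = Cmp C f (snd (prod_cone C X Y) False) \<and>
     Cmp C (snd (prod_cone C X' Y') True) (prod_ar C f g) = Cmp C g (snd (prod_cone C X Y) True)"
    using theI'[OF ex[unfolded eq]] Hom_Arr[OF f[folded C_def]] Hom_Arr[OF g[folded C_def]]
    unfolding prod_ar_def by simp
  then show "prod_ar C f g \<in> Hom C (prod_ob C X Y) (prod_ob C X' Y')"
    and "Cmp C (snd (prod_cone C X' Y') False) (prod_ar C f g) = Cmp C f (snd (prod_cone C X Y) False)"
    and "Cmp C (snd (prod_cone C X' Y') True) (prod_ar C f g) = Cmp C g (snd (prod_cone C X Y) True)" by auto
qed

section \<open>Segal precategories\<close>

lemma disc_ob:
  assumes "small (S :: 'u set)"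
  shows "fob (disc n) S = const_ob (opp (theta n)) SSets (const_ob (opp Delta) SetC S)"
proof -
  have "const_ob (opp Delta) SetC S \<in> Obj SSets" unfolding SSets_def
    using is_functor_const_ob[OF category_opp[OF category_Delta] category_SetC, of S] assms by simp
  then show ?thesis using assms by (simp add: disc_def fcomp_def diag_def)
qed

lemma SegPre_Obj: "X \<in> Obj (SegPre n) \<longleftrightarrow> X \<in> Obj (SimpThetaSp n) \<and>
    (\<exists>S. small S \<and> fob X 0 = const_ob (opp (theta n)) SSets (const_ob (opp Delta) SetC S))"
  unfolding SegPre_def by (auto simp: disc_ob)

text \<open>A Segal precategory is required to be equal to a constant diagram in degree zero; the action there
  is trivial on the nose, not only up to isomorphism.\<close>

lemma SegPre_const:
  assumes X: "X \<in> Obj (SegPre n)" and f: "f \<in> Hom (theta n) \<theta>' \<theta>" and b: "b \<in> Hom Delta m' m"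
    and x: "x \<in> el X (0, \<theta>, m)"
  shows "act n X (Ide Delta 0, f, b) x = x"
proof -
  interpret D: category Delta by (rule category_Delta)
  interpret T: category "theta n" by (rule category_theta)
  have X': "X \<in> Obj (SimpThetaSp n)" using X by (simp add: SegPre_Obj)
  obtain S where S: "small S" "fob X 0 = const_ob (opp (theta n)) SSets (const_ob (opp Delta) SetC S)"
    using X by (auto simp: SegPre_Obj)
  have ob: "\<theta> \<in> Obj (theta n)" "\<theta>' \<in> Obj (theta n)" using T.Hom_Obj[OF f] by auto
  have xS: "x \<in> S" using x ob by (simp add: el_def S const_ob_def)
  have x': "x \<in> fob (fob (fob X 0) \<theta>) m" using x by (simp add: el_def)
  have I0: "Ide Delta 0 \<in> Hom Delta 0 0" using D.Ide_Hom[of 0] by (simp del: Delta_simps(2-))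
  have "sfun (ncmp (far (fob X 0) f) m) x = x"
    using xS Hom_Arr[OF f] by (simp add: S const_ob_def SSets_def)
  moreover have "sfun (far (fob (fob X 0) \<theta>') b) x = x"
    using xS Hom_Arr[OF b] ob by (simp add: S const_ob_def)
  ultimately show ?thesis
    using act_eq[OF X' I0 f b, of x] simplicial_act_Ide[OF X' ob(1) x'] by (simp del: Delta_simps(2-))
qed

lemma mk_obj_SegPre:
  assumes P: "is_psh n S A" and S0: "small S0" "\<And>\<theta> m. \<theta> \<in> Obj (theta n) \<Longrightarrow> S (0, \<theta>, m) = S0"
    and A0: "\<And>f b \<theta> \<theta>' m m' x. f \<in> Hom (theta n) \<theta>' \<theta> \<Longrightarrow> b \<in> Hom Delta m' m \<Longrightarrow> x \<in> S0 \<Longrightarrow>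
      A (Ide Delta 0, f, b) x = x"
  shows "mk_obj n S A \<in> Obj (SegPre n)"
proof -
  interpret D: category Delta by (rule category_Delta)
  interpret T: category "theta n" by (rule category_theta)
  have I: "Ide Delta m \<in> Hom Delta m m" for m using D.Ide_Hom[of m] by (simp del: Delta_simps(2-))
  have sar: "mk_sar S0 S0 g = Ide SetC S0" if "\<And>x. x \<in> S0 \<Longrightarrow> g x = x" for g
    using that by (auto simp: mk_sar_def fun_eq_iff)
  have 1: "mk_obj1 n S A 0 \<theta> = const_ob (opp Delta) SetC S0" if \<theta>: "\<theta> \<in> Obj (theta n)" for \<theta>
  proof -
    have "mk_sar S0 S0 (A (Ide Delta 0, Ide (theta n) \<theta>, b)) = Ide SetC S0" if "b \<in> Arr Delta" for b
      using A0[OF T.Ide_Hom[OF \<theta>]] that sar by (metis Arr_Hom)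
    then show ?thesis using S0(2)[OF \<theta>]
      by (auto simp: mk_obj1_def const_ob_def fun_eq_iff restrict_def simp del: Delta_simps(4,5) SetC_simps)
  qed
  have "mk_ntr (opp Delta) (const_ob (opp Delta) SetC S0) (const_ob (opp Delta) SetC S0) (\<lambda>m. A (Ide Delta 0, f, Ide Delta m))
     = Ide SSets (const_ob (opp Delta) SetC S0)" if "f \<in> Arr (theta n)" for f
  proof -
    have "f \<in> Hom (theta n) (Dom (theta n) f) (Cod (theta n) f)" using that by (simp add: Hom_def)
    then have "mk_sar S0 S0 (A (Ide Delta 0, f, Ide Delta m)) = Ide SetC S0" for m
      using A0 I sar by metis
    then show ?thesis by (simp add: mk_ntr_def SSets_def const_ob_def del: Delta_simps(4,5) SetC_simps)
  qed
  then have "mk_obj2 n S A 0 = const_ob (opp (theta n)) SSets (const_ob (opp Delta) SetC S0)"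
    using 1 T.Hom_Obj[unfolded Hom_def]
    by (auto simp: mk_obj2_def const_ob_def[of "opp (theta n)"] fun_eq_iff restrict_def
      simp del: Delta_simps(4,5) SetC_simps)
  then show ?thesis using mk_obj_Obj(1)[OF P] S0(1) unfolding SegPre_Obj by (auto simp: mk_obj_def)
qed

section \<open>Encoded set-valued functors and the generating cofibrations\<close>

definition set_act :: "('o, 'a) cat \<Rightarrow> ('o \<Rightarrow> 'x set) \<Rightarrow> ('a \<Rightarrow> 'x \<Rightarrow> 'x) \<Rightarrow> bool" where
  "set_act C S A \<longleftrightarrow> (\<forall>c \<in> Obj C. finite (S c)) \<and>
     (\<forall>a c d x. a \<in> Hom C c d \<longrightarrow> x \<in> S c \<longrightarrow> A a x \<in> S d) \<and>
     (\<forall>c x. c \<in> Obj C \<longrightarrow> x \<in> S c \<longrightarrow> A (Ide C c) x = x) \<and>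
     (\<forall>a b c d e x. a \<in> Hom C c d \<longrightarrow> b \<in> Hom C d e \<longrightarrow> x \<in> S c \<longrightarrow> A (Cmp C b a) x = A b (A a x))"

text \<open>For finite sets the chosen encoding \<open>enc\<close> is injective, so that \<open>carr\<close>, \<open>setfun\<close> and
  their variants transport functions and actions faithfully.\<close>

context
  assumes inf: "infinite (UNIV :: 'u set)"
begin

lemma cset_small: "finite S \<Longrightarrow> small (cset S :: 'u set)"
  unfolding cset_def by (intro small_finite inf finite_imageI)

lemma sfun_carr:
  assumes "finite S" "x \<in> S"
  shows "sfun (carr S T f :: 'u sar) (enc S x) = enc T (f x)"
  using assms inv_into_f_f[OF inj_enc[OF inf assms(1)] assms(2)] by (simp add: carr_def cset_def)

lemma carr_Hom:
  assumes "finite S" "finite T" "\<And>x. x \<in> S \<Longrightarrow> f x \<in> T"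
  shows "(carr S T f :: 'u sar) \<in> Hom SetC (cset S) (cset T)"
  unfolding Hom_SetC
proof (intro conjI cset_small assms)
  show "sfun (carr S T f :: 'u sar) \<in> cset S \<rightarrow>\<^sub>E cset T"
    using sfun_carr[OF assms(1), of _ T f] assms(3) by (auto simp: carr_def cset_def)
qed (simp_all add: carr_def)

lemma carr_eqI:
  assumes "finite S" "g \<in> Hom SetC (cset S) (cset T)" "g' \<in> Hom SetC (cset S) (cset T)"
    and "\<And>x. x \<in> S \<Longrightarrow> sfun (g :: 'u sar) (enc S x) = sfun g' (enc S x)"
  shows "g = g'"
  using assms by (intro sar_eqI[OF assms(2,3)]) (auto simp: cset_def)

lemma carr_Cmp:
  assumes "finite S" "finite T" "finite R" "\<And>x. x \<in> S \<Longrightarrow> f x \<in> T" "\<And>x. x \<in> T \<Longrightarrow> g x \<in> R"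
    "\<And>x. x \<in> S \<Longrightarrow> h x = g (f x)"
  shows "Cmp SetC (carr T R g :: 'u sar) (carr S T f) = carr S R h"
proof (rule carr_eqI[OF assms(1)])
  have f: "(carr S T f :: 'u sar) \<in> Hom SetC (cset S) (cset T)" by (intro carr_Hom assms)
  have g: "(carr T R g :: 'u sar) \<in> Hom SetC (cset T) (cset R)" by (intro carr_Hom assms)
  show "Cmp SetC (carr T R g) (carr S T f :: 'u sar) \<in> Hom SetC (cset S) (cset R)"
    by (rule category.Cmp_Hom[OF category_SetC f g])
  show "(carr S R h :: 'u sar) \<in> Hom SetC (cset S) (cset R)" using assms by (intro carr_Hom) auto
  show "sfun (Cmp SetC (carr T R g) (carr S T f) :: 'u sar) (enc S x) = sfun (carr S R h) (enc S x)"
    if "x \<in> S" for x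
    using sfun_Cmp[OF f, of "enc S x" "carr T R g"] that assms by (simp add: cset_def sfun_carr del: SetC_simps)
qed

lemma carr_Ide:
  assumes "finite S" "\<And>x. x \<in> S \<Longrightarrow> f x = x"
  shows "(carr S S f :: 'u sar) = Ide SetC (cset S)"
proof (rule carr_eqI[OF assms(1)])
  show "(carr S S f :: 'u sar) \<in> Hom SetC (cset S) (cset S)" using assms by (intro carr_Hom) auto
  show "(Ide SetC (cset S) :: 'u sar) \<in> Hom SetC (cset S) (cset S)"
    using assms by (intro category.Ide_Hom[OF category_SetC]) (simp add: cset_small)
  show "sfun (carr S S f :: 'u sar) (enc S x) = sfun (Ide SetC (cset S)) (enc S x)" if "x \<in> S" for x
    using that assms by (simp add: sfun_carr) (simp add: cset_def)
qed

lemma set_actD: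
  assumes "set_act C S A"
  shows "c \<in> Obj C \<Longrightarrow> finite (S c)"
    and "a \<in> Hom C c d \<Longrightarrow> x \<in> S c \<Longrightarrow> A a x \<in> S d"
    and "c \<in> Obj C \<Longrightarrow> x \<in> S c \<Longrightarrow> A (Ide C c) x = x"
    and "a \<in> Hom C c d \<Longrightarrow> b \<in> Hom C d e \<Longrightarrow> x \<in> S c \<Longrightarrow> A (Cmp C b a) x = A b (A a x)"
  using assms unfolding set_act_def by blast+

lemma setfun_functor:
  assumes C: "category C" and S: "set_act C S A"
  shows "is_functor C SetC (setfun C S A :: (_, _, 'u set, 'u sar) func)"
proof -
  interpret category C by fact
  have far: "far (setfun C S A) a = carr (S c) (S d) (A a)" if "a \<in> Hom C c d" for a c d
    using Hom_Arr[OF that] by (simp add: setfun_def)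
  show ?thesis
  proof (rule is_functorI)
    show "fob (setfun C S A) c \<in> (Obj SetC :: 'u set set)" if "c \<in> Obj C" for c
      using that S by (simp add: setfun_def set_act_def cset_small)
    show "far (setfun C S A) a \<in> Hom SetC (fob (setfun C S A) c) (fob (setfun C S A) d :: 'u set)"
      if "a \<in> Hom C c d" for a c d
      using that S Hom_Obj[OF that] carr_Hom[of "S c" "S d" "A a"]
      by (simp add: far set_act_def) (simp add: setfun_def)
    show "far (setfun C S A) (Ide C c) = (Ide SetC (fob (setfun C S A) c) :: 'u sar)" if "c \<in> Obj C" for c
      using that S carr_Ide[of "S c" "A (Ide C c)"] unfolding far[OF Ide_Hom[OF that]]
      by (simp add: set_act_def setfun_def del: SetC_simps)
    show "far (setfun C S A) (Cmp C b a) = Cmp SetC (far (setfun C S A) b) (far (setfun C S A) a :: 'u sar)"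
      if "a \<in> Hom C c d" "b \<in> Hom C d e" for a b c d e
      unfolding far[OF Cmp_Hom[OF that]] far[OF that(1)] far[OF that(2)]
      using Hom_Obj[OF that(1)] Hom_Obj[OF that(2)] set_actD(1,2)[OF S] set_actD(4)[OF S that] that
      by (intro carr_Cmp[symmetric]) blast+
  qed (simp_all add: setfun_def)
qed

lemma setnat_Hom:
  assumes C: "category C" and S: "set_act C S A" and T: "set_act C T B"
    and \<phi>: "\<And>c x. c \<in> Obj C \<Longrightarrow> x \<in> S c \<Longrightarrow> \<phi> c x \<in> T c"
    and nat: "\<And>a c d x. a \<in> Hom C c d \<Longrightarrow> x \<in> S c \<Longrightarrow> B a (\<phi> c x) = \<phi> d (A a x)"
  shows "(setnat C S A T B \<phi> :: (_, _, 'u set, 'u sar) ntr) \<in>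
    Hom (fun_cat C SetC) (setfun C S A) (setfun C T B)"
proof -
  interpret category C by fact
  have fin: "finite (S c)" "finite (T c)" if "c \<in> Obj C" for c using S T that by (auto simp: set_act_def)
  show ?thesis unfolding Hom_fun_cat
  proof (intro conjI is_ntrI)
    fix a c d assume a: "a \<in> Hom C c d"
    have cd: "c \<in> Obj C" "d \<in> Obj C" using Hom_Obj[OF a] by auto
    have "Cmp SetC (carr (T c) (T d) (B a)) (carr (S c) (T c) (\<phi> c)) =
      Cmp SetC (carr (S d) (T d) (\<phi> d)) (carr (S c) (S d) (A a) :: 'u sar)"
      using carr_Cmp[of "S c" "T c" "T d" "\<phi> c" "B a" "\<lambda>x. B a (\<phi> c x)"]
        carr_Cmp[of "S c" "S d" "T d" "A a" "\<phi> d" "\<lambda>x. B a (\<phi> c x)"] fin cd S T \<phi> nat[OF a] a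
      by (auto simp: set_act_def simp del: SetC_simps)
    then show "Cmp SetC (far (ntgt (setnat C S A T B \<phi>)) a) (ncmp (setnat C S A T B \<phi>) c) =
       Cmp SetC (ncmp (setnat C S A T B \<phi>) d) (far (nsrc (setnat C S A T B \<phi>)) a :: 'u sar)"
      using Hom_Arr[OF a] cd by (simp add: setnat_def setfun_def del: SetC_simps)
  qed (use setfun_functor[OF C S] setfun_functor[OF C T] fin \<phi> in
      \<open>auto simp: setnat_def setfun_def intro!: carr_Hom\<close>)
qed

lemma sfun_setnat:
  assumes "set_act C S A" "c \<in> Obj C" "x \<in> S c"
  shows "sfun (ncmp (setnat C S A T B \<phi>) c) (enc (S c) x) = (enc (T c) (\<phi> c x) :: 'u)"
  using assms by (simp add: setnat_def set_act_def sfun_carr)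

lemma setnat_eqI:
  assumes "set_act C S A"
    and t: "t \<in> Hom (fun_cat C SetC) (setfun C S A) G" "t' \<in> Hom (fun_cat C SetC) (setfun C S A) G"
    and "\<And>c x. c \<in> Obj C \<Longrightarrow> x \<in> S c \<Longrightarrow> sfun (ncmp t c) (enc (S c) x :: 'u) = sfun (ncmp t' c) (enc (S c) x)"
  shows "t = t'"
  using assms(4) by (intro setN_eqI[OF t]) (auto simp: setfun_def cset_def)

lemma binat_Hom:
  fixes C :: "('o, 'a) cat" and D :: "('p, 'b) cat"
  assumes C: "category C" and D: "category D"
    and S: "\<And>c. c \<in> Obj C \<Longrightarrow> set_act D (S c) (A2 c)" "\<And>d. d \<in> Obj D \<Longrightarrow> set_act C (\<lambda>c. S c d) (\<lambda>a. A1 a d)"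
    and T: "\<And>c. c \<in> Obj C \<Longrightarrow> set_act D (T c) (B2 c)" "\<And>d. d \<in> Obj D \<Longrightarrow> set_act C (\<lambda>c. T c d) (\<lambda>a. B1 a d)"
    and AA: "\<And>a b c c' d d' x. a \<in> Hom C c c' \<Longrightarrow> b \<in> Hom D d d' \<Longrightarrow> x \<in> S c d \<Longrightarrow> A2 c' b (A1 a d x) = A1 a d' (A2 c b x)"
    and BB: "\<And>a b c c' d d' x. a \<in> Hom C c c' \<Longrightarrow> b \<in> Hom D d d' \<Longrightarrow> x \<in> T c d \<Longrightarrow> B2 c' b (B1 a d x) = B1 a d' (B2 c b x)"
    and \<phi>: "\<And>c d x. c \<in> Obj C \<Longrightarrow> d \<in> Obj D \<Longrightarrow> x \<in> S c d \<Longrightarrow> \<phi> c d x \<in> T c d"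
    and n1: "\<And>a c c' d x. a \<in> Hom C c c' \<Longrightarrow> d \<in> Obj D \<Longrightarrow> x \<in> S c d \<Longrightarrow> B1 a d (\<phi> c d x) = \<phi> c' d (A1 a d x)"
    and n2: "\<And>c b d d' x. c \<in> Obj C \<Longrightarrow> b \<in> Hom D d d' \<Longrightarrow> x \<in> S c d \<Longrightarrow> B2 c b (\<phi> c d x) = \<phi> c d' (A2 c b x)"
  shows "(binat C D S A1 A2 T B1 B2 \<phi> :: (_, _, (_, _, 'u set, 'u sar) func, _) ntr) \<in>
    Hom (fun_cat C (fun_cat D SetC)) (bifun C D S A1 A2) (bifun C D T B1 B2)"
proof -
  interpret C: category C by fact
  interpret F: category "fun_cat D SetC :: (('p, 'b, 'u set, 'u sar) func, ('p, 'b, 'u set, 'u sar) ntr) cat"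
    by (rule category_fun_cat[OF D category_SetC])
  have bif: "is_functor C (fun_cat D SetC) (bifun C D S A1 A2 :: (_, _, (_, _, 'u set, 'u sar) func, _) func)"
    if S: "\<And>c. c \<in> Obj C \<Longrightarrow> set_act D (S c) (A2 c)" "\<And>d. d \<in> Obj D \<Longrightarrow> set_act C (\<lambda>c. S c d) (\<lambda>a. A1 a d)"
    and AA: "\<And>a b c c' d d' x. a \<in> Hom C c c' \<Longrightarrow> b \<in> Hom D d d' \<Longrightarrow> x \<in> S c d \<Longrightarrow> A2 c' b (A1 a d x) = A1 a d' (A2 c b x)"
    for S :: "'o \<Rightarrow> 'p \<Rightarrow> 'z set" and A1 A2
  proof -
    let ?F = "bifun C D S A1 A2 :: (_, _, (_, _, 'u set, 'u sar) func, _) func"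
    have far: "far ?F a = setnat D (S c) (A2 c) (S c') (A2 c') (A1 a)" if "a \<in> Hom C c c'" for a c c'
      using Hom_Arr[OF that] by (simp add: bifun_def)
    have fob: "fob ?F c = setfun D (S c) (A2 c)" if "c \<in> Obj C" for c using that by (simp add: bifun_def)
    have fH: "far ?F a \<in> Hom (fun_cat D SetC) (setfun D (S c) (A2 c)) (setfun D (S c') (A2 c'))"
      if a: "a \<in> Hom C c c'" for a c c'
      unfolding far[OF a] using a C.Hom_Obj[OF a] S AA[OF a]
      by (intro setnat_Hom[OF D]) (auto simp: set_act_def)
    have sf: "sfun (ncmp (far ?F a) d) (enc (S c d) x) = enc (S c' d) (A1 a d x)"
      if "a \<in> Hom C c c'" "d \<in> Obj D" "x \<in> S c d" for a c c' d x
      unfolding far[OF that(1)] using sfun_setnat[OF S(1)] C.Hom_Obj[OF that(1)] that by blast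
    have A1: "A1 a d x \<in> S c' d" if "a \<in> Hom C c c'" "d \<in> Obj D" "x \<in> S c d" for a c c' d x
      using S(2)[OF that(2)] that unfolding set_act_def by blast
    have encin: "enc (S c d) x \<in> fob (setfun D (S c) (A2 c)) d" if "d \<in> Obj D" "x \<in> S c d" for c d x
      using that by (simp add: setfun_def cset_def)
    show ?thesis
    proof (rule is_functorI)
      show "fob ?F c \<in> Obj (fun_cat D SetC)" if "c \<in> Obj C" for c
        using setfun_functor[OF D S(1)[OF that]] that by (simp add: fob)
      show "far ?F a \<in> Hom (fun_cat D SetC) (fob ?F c) (fob ?F c')" if "a \<in> Hom C c c'" for a c c'
        using fH[OF that] C.Hom_Obj[OF that] by (simp add: fob)
      show "far ?F (Ide C c) = Ide (fun_cat D SetC) (fob ?F c)" if c: "c \<in> Obj C" for c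
        unfolding fob[OF c]
      proof (rule setnat_eqI[OF S(1)[OF c] fH[OF C.Ide_Hom[OF c]] F.Ide_Hom])
        show "setfun D (S c) (A2 c) \<in> Obj (fun_cat D SetC :: ((_, _, 'u set, 'u sar) func, _) cat)"
          using setfun_functor[OF D S(1)[OF c]] by simp
        fix d x assume dx: "d \<in> Obj D" "x \<in> S c d"
        have "A1 (Ide C c) d x = x" using S(2)[OF dx(1)] c dx unfolding set_act_def by blast
        then show "sfun (ncmp (far ?F (Ide C c)) d) (enc (S c d) x) =
           sfun (ncmp (Ide (fun_cat D SetC) (setfun D (S c) (A2 c))) d) (enc (S c d) x :: 'u)"
          unfolding setN_Ide[OF dx(1) encin[OF dx]] using sf[OF C.Ide_Hom[OF c] dx] by simp
      qed
      show "far ?F (Cmp C b a) = Cmp (fun_cat D SetC) (far ?F b) (far ?F a)"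
        if a: "a \<in> Hom C c c'" and b: "b \<in> Hom C c' c''" for a b c c' c''
      proof (rule setnat_eqI[OF S(1) fH[OF C.Cmp_Hom[OF a b]] F.Cmp_Hom[OF fH[OF a] fH[OF b]]])
        show "c \<in> Obj C" using C.Hom_Obj[OF a] by blast
        fix d x assume dx: "d \<in> Obj D" "x \<in> S c d"
        have "A1 (Cmp C b a) d x = A1 b d (A1 a d x)" using S(2)[OF dx(1)] a b dx unfolding set_act_def by blast
        then show "sfun (ncmp (far ?F (Cmp C b a)) d) (enc (S c d) x) =
           sfun (ncmp (Cmp (fun_cat D SetC) (far ?F b) (far ?F a)) d) (enc (S c d) x :: 'u)"
          using sf[OF C.Cmp_Hom[OF a b] dx] setN_Cmp[OF fH[OF a] dx(1) encin[OF dx], of "far ?F b"]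
            sf[OF a dx] sf[OF b dx(1) A1[OF a dx]] by simp
      qed
    qed (simp_all add: bifun_def)
  qed
  let ?t = "binat C D S A1 A2 T B1 B2 \<phi> :: (_, _, (_, _, 'u set, 'u sar) func, _) ntr"
  have FS: "far (bifun C D S A1 A2) a = (setnat D (S c) (A2 c) (S c') (A2 c') (A1 a) :: (_, _, 'u set, _) ntr)"
    and FT: "far (bifun C D T B1 B2) a = (setnat D (T c) (B2 c) (T c') (B2 c') (B1 a) :: (_, _, 'u set, _) ntr)"
    if "a \<in> Hom C c c'" for a c c' using Hom_Arr[OF that] by (simp_all add: bifun_def)
  have HS: "(setnat D (S c) (A2 c) (S c') (A2 c') (A1 a) :: (_, _, 'u set, _) ntr) \<in>
       Hom (fun_cat D SetC) (setfun D (S c) (A2 c)) (setfun D (S c') (A2 c'))"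
      and HT: "(setnat D (T c) (B2 c) (T c') (B2 c') (B1 a) :: (_, _, 'u set, _) ntr) \<in>
       Hom (fun_cat D SetC) (setfun D (T c) (B2 c)) (setfun D (T c') (B2 c'))"
    if a: "a \<in> Hom C c c'" for a c c'
    using a C.Hom_Obj[OF a] S T AA[OF a] BB[OF a] by (auto intro!: setnat_Hom[OF D] simp: set_act_def)
  have H\<phi>: "(setnat D (S c) (A2 c) (T c) (B2 c) (\<phi> c) :: (_, _, 'u set, _) ntr) \<in>
       Hom (fun_cat D SetC) (setfun D (S c) (A2 c)) (setfun D (T c) (B2 c))" if "c \<in> Obj C" for c
    using that S T \<phi> n2 by (intro setnat_Hom[OF D]) auto
  have A1: "A1 a d x \<in> S c' d" if "a \<in> Hom C c c'" "d \<in> Obj D" "x \<in> S c d" for a c c' d x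
    using S(2)[OF that(2)] that unfolding set_act_def by blast
  have encin: "(enc (S c d) x :: 'u) \<in> fob (setfun D (S c) (A2 c)) d" if "d \<in> Obj D" "x \<in> S c d" for c d x
    using that by (simp add: setfun_def cset_def)
  have nat: "Cmp (fun_cat D SetC) (setnat D (T c) (B2 c) (T c') (B2 c') (B1 a)) (setnat D (S c) (A2 c) (T c) (B2 c) (\<phi> c))
    = Cmp (fun_cat D SetC) (setnat D (S c') (A2 c') (T c') (B2 c') (\<phi> c'))
        (setnat D (S c) (A2 c) (S c') (A2 c') (A1 a) :: (_, _, 'u set, _) ntr)"
    if a: "a \<in> Hom C c c'" for a c c'
  proof -
    have cc: "c \<in> Obj C" "c' \<in> Obj C" using C.Hom_Obj[OF a] by auto
    show ?thesis
    proof (rule setnat_eqI[OF S(1)[OF cc(1)] F.Cmp_Hom[OF H\<phi>[OF cc(1)] HT[OF a]] F.Cmp_Hom[OF HS[OF a] H\<phi>[OF cc(2)]]])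
      fix d x assume dx: "d \<in> Obj D" "x \<in> S c d"
      note N = setN_Cmp[OF H\<phi>[OF cc(1)] dx(1) encin[OF dx], of "setnat D (T c) (B2 c) (T c') (B2 c') (B1 a)"]
        setN_Cmp[OF HS[OF a] dx(1) encin[OF dx], of "setnat D (S c') (A2 c') (T c') (B2 c') (\<phi> c')"]
      show "sfun (ncmp (Cmp (fun_cat D SetC) (setnat D (T c) (B2 c) (T c') (B2 c') (B1 a)) (setnat D (S c) (A2 c) (T c) (B2 c) (\<phi> c))) d) (enc (S c d) x)
        = sfun (ncmp (Cmp (fun_cat D SetC) (setnat D (S c') (A2 c') (T c') (B2 c') (\<phi> c'))
        (setnat D (S c) (A2 c) (S c') (A2 c') (A1 a))) d) (enc (S c d) x :: 'u)"
        unfolding N sfun_setnat[OF S(1)[OF cc(1)] dx] sfun_setnat[OF T(1)[OF cc(1)] dx(1) \<phi>[OF cc(1) dx]]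
          sfun_setnat[OF S(1)[OF cc(2)] dx(1) A1[OF a dx]] n1[OF a dx] ..
    qed
  qed
  show ?thesis unfolding Hom_fun_cat
  proof (intro conjI is_ntrI)
    show "is_functor C (fun_cat D SetC) (nsrc ?t)" "is_functor C (fun_cat D SetC) (ntgt ?t)"
      using bif[OF S AA] bif[OF T BB] by (simp_all add: binat_def)
    show "ncmp ?t c \<in> Hom (fun_cat D SetC) (fob (nsrc ?t) c) (fob (ntgt ?t) c)" if "c \<in> Obj C" for c
      using H\<phi>[OF that] that by (simp add: binat_def bifun_def)
    show "Cmp (fun_cat D SetC) (far (ntgt ?t) a) (ncmp ?t c) = Cmp (fun_cat D SetC) (ncmp ?t c') (far (nsrc ?t) a)"
      if a: "a \<in> Hom C c c'" for a c c'
      using nat[OF a] C.Hom_Obj[OF a] FS[OF a] FT[OF a] by (simp add: binat_def)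
  qed (simp_all add: binat_def)
qed

end

lemma yo_ob_functor:
  assumes inf: "infinite (UNIV :: 'u set)"
  shows "is_functor (opp Delta) SetC (yo_ob Delta p :: (_, _, 'u set, 'u sar) func)"
proof -
  interpret D: category Delta by (rule category_Delta)
  show ?thesis unfolding yo_ob_def
  proof (rule setfun_functor[OF inf category_opp[OF category_Delta]])
    show "set_act (opp Delta) (\<lambda>x. Hom Delta x p) (\<lambda>b a. Cmp Delta a b)"
      unfolding set_act_def
      using finite_Hom_Delta D.Cmp_Hom D.Cmp_Ide_right D.Cmp_assoc by (auto simp del: Delta_simps)
  qed
qed

lemma bdry_sieve:
  assumes C: "category C" and "g \<in> bdry C c" "f \<in> Arr C" "Cod C f = Dom C g"
  shows "Cmp C g f \<in> bdry C c"
  using assms unfolding bdry_def by blast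

text \<open>The domain is a subpresheaf, since the boundaries are sieves, and the map is the inclusion.\<close>

lemma gencof_Hom:
  fixes n m :: nat
  assumes inf: "infinite (UNIV :: 'u set)" and \<theta>0: "\<theta> \<in> Obj (theta n)"
  defines "f \<equiv> gencof_map n m \<theta> :: 'u tspmap"
  shows "f \<in> Hom (ThetaSp n) (nsrc f) (ntgt f)"
    and "\<theta>' \<in> Obj (theta n) \<Longrightarrow> inj_on (sfun (ncmp (ncmp f \<theta>') k)) (fob (fob (nsrc f) \<theta>') k)"
proof -
  interpret D: category Delta by (rule category_Delta)
  interpret T: category "theta n" by (rule category_theta)
  define S where "S = (\<lambda>\<theta>' k. {(a, g). a \<in> Hom Delta k m \<and> g \<in> Hom (theta n) \<theta>' \<theta> \<and>
                      (a \<in> bdry Delta m \<or> g \<in> bdry (theta n) \<theta>)})"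
  define R where "R = (\<lambda>\<theta>' k. Hom Delta k m \<times> Hom (theta n) \<theta>' \<theta>)"
  define A1 :: "tmor \<Rightarrow> nat \<Rightarrow> dar \<times> tmor \<Rightarrow> dar \<times> tmor"
    where "A1 = (\<lambda>f k (a, g). (a, Cmp (theta n) g f))"
  define A2 :: "tree \<Rightarrow> dar \<Rightarrow> dar \<times> tmor \<Rightarrow> dar \<times> tmor"
    where "A2 = (\<lambda>\<theta>' b (a, g). (Cmp Delta a b, g))"
  have f: "f = binat (opp (theta n)) (opp Delta) S A1 A2 R A1 A2 (\<lambda>\<theta>' k x. x)"
    unfolding f_def gencof_map_def S_def R_def A1_def A2_def by simp
  have finR: "finite (R \<theta>' k)" for \<theta>' k by (simp add: R_def finite_Hom_Delta finite_Hom_theta)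
  have SR: "S \<theta>' k \<subseteq> R \<theta>' k" for \<theta>' k by (auto simp: S_def R_def)
  then have finS: "finite (S \<theta>' k)" for \<theta>' k using finR finite_subset by blast
  have bD: "Cmp Delta a b \<in> bdry Delta m" if "a \<in> bdry Delta m" "a \<in> Hom Delta k m" "b \<in> Hom Delta k' k" for a b k k'
    using bdry_sieve[OF category_Delta that(1), of b] that(2,3) by (auto simp: Hom_def simp del: Delta_simps)
  have bT: "Cmp (theta n) g h \<in> bdry (theta n) \<theta>" if "g \<in> bdry (theta n) \<theta>" "g \<in> Hom (theta n) \<theta>' \<theta>" "h \<in> Hom (theta n) \<theta>'' \<theta>'" for g h \<theta>' \<theta>''
    using bdry_sieve[OF category_theta that(1), of h] that(2,3) by (auto simp: Hom_def)
  have sa: "set_act (opp Delta) (R c) (A2 c)" "set_act (opp Delta) (S c) (A2 c)"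
    "set_act (opp (theta n)) (\<lambda>c. R c k) (\<lambda>h. A1 h k)" "set_act (opp (theta n)) (\<lambda>c. S c k) (\<lambda>h. A1 h k)" for c k
    unfolding set_act_def using finR finS bD bT
    by (auto simp: R_def S_def A1_def A2_def D.Cmp_Ide_right T.Cmp_Ide_right D.Cmp_assoc T.Cmp_assoc
      intro: D.Cmp_Hom T.Cmp_Hom simp del: Delta_simps(2-))
  have H: "f \<in> Hom (fun_cat (opp (theta n)) (fun_cat (opp Delta) SetC))
       (bifun (opp (theta n)) (opp Delta) S A1 A2) (bifun (opp (theta n)) (opp Delta) R A1 A2)"
    unfolding f
    by (rule binat_Hom[OF inf category_opp[OF category_theta] category_opp[OF category_Delta]])
      (use sa in \<open>auto simp: A1_def A2_def split: prod.splits intro: SR[THEN subsetD]\<close>)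
  then show "f \<in> Hom (ThetaSp n) (nsrc f) (ntgt f)"
    unfolding ThetaSp_def SSets_def by (simp add: Hom_def)
  show "inj_on (sfun (ncmp (ncmp f \<theta>') k)) (fob (fob (nsrc f) \<theta>') k)" if \<theta>': "\<theta>' \<in> Obj (theta n)"
  proof -
    have n: "ncmp (ncmp f \<theta>') k = carr (S \<theta>' k) (R \<theta>' k) (\<lambda>x. x)" and s: "fob (fob (nsrc f) \<theta>') k = cset (S \<theta>' k)"
      using \<theta>' by (simp_all add: f binat_def setnat_def bifun_def setfun_def)
    show ?thesis
    proof (rule inj_onI)
      fix u v assume "u \<in> fob (fob (nsrc f) \<theta>') k" "v \<in> fob (fob (nsrc f) \<theta>') k"
        and e: "sfun (ncmp (ncmp f \<theta>') k) u = sfun (ncmp (ncmp f \<theta>') k) v"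
      then obtain x y where x: "x \<in> S \<theta>' k" "u = enc (S \<theta>' k) x" and y: "y \<in> S \<theta>' k" "v = enc (S \<theta>' k) y"
        unfolding s cset_def by blast
      have "enc (R \<theta>' k) x = (enc (R \<theta>' k) y :: 'u)"
        using e x y sfun_carr[OF inf finS x(1), of "R \<theta>' k" "\<lambda>x. x"] sfun_carr[OF inf finS y(1), of "R \<theta>' k" "\<lambda>x. x"]
        by (simp add: n)
      then have "x = y" using inj_enc[OF inf finR[of \<theta>' k]] SR x(1) y(1) by (meson inj_onD subsetD)
      then show "u = v" using x y by simp
    qed
  qed
qed

section \<open>Cofree Segal precategories\<close>

definition is_const :: "dar \<Rightarrow> bool" where
  "is_const a \<longleftrightarrow> (\<forall>i \<le> ddom a. dfun a i = dfun a 0)"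

text \<open>Two arrows of the site with the same source and target have the same image under \<open>ncls\<close> if
  they have the same first coordinate \<open>a\<close> and, unless \<open>a\<close> is constant, agree altogether.
  This is the congruence for which presheaves on the quotient are those that are constant in degree
  zero.\<close>

definition ncls :: "site_ar \<Rightarrow> dar \<times> (tmor \<times> dar) option" where
  "ncls q = (fst q, if is_const (fst q) then None else Some (snd q))"

lemma is_const_cns: "is_const (cns m q v)"
  by (simp add: is_const_def cns_def)

lemma is_constD:
  assumes "is_const a" "a \<in> Hom Delta k l"
  shows "a = cns k l (dfun a 0)" "dfun a 0 \<le> l"
proof -
  obtain f where f: "a = DA k l f" "f \<in> {..k} \<rightarrow>\<^sub>E {..l}" using assms(2) unfolding Hom_Delta by blast
  have c: "\<forall>i \<le> k. f i = f 0" using assms(1) unfolding is_const_def f(1) dar.sel .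
  have "f i = (\<lambda>i \<in> {..k}. f 0) i" for i
  proof (cases "i \<le> k")
    case True
    then have "f i = f 0" using c by blast
    then show ?thesis using True by (simp only: restrict_apply atMost_iff if_True)
  qed (use f(2) in \<open>simp add: PiE_iff extensional_def\<close>)
  then have "f = (\<lambda>i \<in> {..k}. f 0)" by (rule ext)
  then have "DA k l f = DA k l (\<lambda>i \<in> {..k}. f 0)" by (rule arg_cong)
  then show "a = cns k l (dfun a 0)" unfolding cns_def f(1) dar.sel .
  show "dfun a 0 \<le> l" using f by (auto simp: PiE_iff)
qed

lemma is_const_Cmp:
  assumes "is_const a" "a \<in> Hom Delta k l" "e \<in> Hom Delta l r"
  shows "is_const (Cmp Delta e a)"
proof -
  note a = is_constD[OF assms(1,2)]
  have "Cmp Delta e a = cns k r (dfun e (dfun a 0))"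
    using Cmp_const[OF assms(3) a(2), of k] unfolding a(1)[symmetric] .
  then show ?thesis by (simp add: is_const_cns del: Delta_simps)
qed

lemma ncls_cong:
  assumes q: "q \<in> Hom (site n) d c" "q' \<in> Hom (site n) d c" and p: "p \<in> Hom (site n) c e" and e: "ncls q = ncls q'"
  shows "ncls (Cmp (site n) p q) = ncls (Cmp (site n) p q')"
proof -
  obtain a f b where q1: "q = (a, f, b)" by (cases q)
  obtain a' f' b' where q2: "q' = (a', f', b')" by (cases q')
  obtain a'' f'' b'' where p1: "p = (a'', f'', b'')" by (cases p)
  have aa: "a' = a" using e q1 q2 by (simp add: ncls_def)
  show ?thesis
  proof (cases "is_const a")
    case True
    obtain k l r where "a \<in> Hom Delta k l" "a'' \<in> Hom Delta l r"
      using q(1) p q1 p1 by (elim Hom_siteE) auto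
    then have "is_const (Cmp Delta a'' a)" using is_const_Cmp True by blast
    then show ?thesis using q1 q2 p1 aa by (simp add: ncls_def del: Delta_simps)
  next
    case False
    then have "q = q'" using e q1 q2 aa by (simp add: ncls_def)
    then show ?thesis by simp
  qed
qed

text \<open>A constant map from \<open>[k]\<close> to \<open>[k']\<close> is the composite of the map from \<open>[k]\<close> to
  \<open>[0]\<close> and of a vertex of \<open>[k']\<close>.\<close>

lemma act_const:
  assumes X: "X \<in> Obj (SimpThetaSp n)" and q: "(a, f, b) \<in> Hom (site n) (k, \<theta>, m) (k', \<theta>', m')"
    and a: "is_const a" and x: "x \<in> el X (k', \<theta>', m')"
  shows "act n X (a, f, b) x = act n X (cns k 0 0, Ide (theta n) \<theta>, Ide Delta m)
      (act n X (cns 0 k' (dfun a 0), f, b) x)"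
    and "act n X (cns 0 k' (dfun a 0), f, b) x \<in> el X (0, \<theta>, m)"
proof -
  interpret D: category Delta by (rule category_Delta)
  interpret T: category "theta n" by (rule category_theta)
  have H: "a \<in> Hom Delta k k'" "f \<in> Hom (theta n) \<theta> \<theta>'" "b \<in> Hom Delta m m'"
    using q by (auto simp: Hom_site)
  note v = is_constD[OF a H(1)]
  have 1: "(cns k 0 0, Ide (theta n) \<theta>, Ide Delta m) \<in> Hom (site n) (k, \<theta>, m) (0, \<theta>, m)"
    using T.Hom_Obj[OF H(2)] T.Ide_Hom D.Ide_Hom[of m] cns_Hom[of 0 0 k] by (simp add: Hom_site del: Delta_simps(2-))
  have 2: "(cns 0 k' (dfun a 0), f, b) \<in> Hom (site n) (0, \<theta>, m) (k', \<theta>', m')"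
    using H cns_Hom[OF v(2)] by (simp add: Hom_site)
  have "Cmp (site n) (cns 0 k' (dfun a 0), f, b) (cns k 0 0, Ide (theta n) \<theta>, Ide Delta m) = (a, f, b)"
    using Cmp_cns[OF cns_Hom[of 0 0 k], of k' "dfun a 0"] v(1) T.Cmp_Ide_right[OF H(2)] D.Cmp_Ide_right[OF H(3)]
    by (simp del: Delta_simps)
  then show "act n X (a, f, b) x = act n X (cns k 0 0, Ide (theta n) \<theta>, Ide Delta m)
      (act n X (cns 0 k' (dfun a 0), f, b) x)"
    using act_Cmp[OF X 1 2 x] by simp
  show "act n X (cns 0 k' (dfun a 0), f, b) x \<in> el X (0, \<theta>, m)" using act_in[OF X 2 x] .
qed

text \<open>If the first coordinate is constant, then the action factors through degree zero, where the other two
  coordinates act trivially.\<close>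

lemma SegPre_ncls:
  assumes X: "X \<in> Obj (SegPre n)" and q: "q \<in> Hom (site n) d c" "q' \<in> Hom (site n) d c"
    and e: "ncls q = ncls q'" and x: "x \<in> el X c"
  shows "act n X q x = act n X q' x"
proof -
  interpret D: category Delta by (rule category_Delta)
  interpret T: category "theta n" by (rule category_theta)
  have X': "X \<in> Obj (SimpThetaSp n)" using X by (simp add: SegPre_Obj)
  obtain k \<theta> m k' \<theta>' m' a f b where q1: "q = (a, f, b)" "d = (k, \<theta>, m)" "c = (k', \<theta>', m')"
    and H: "a \<in> Hom Delta k k'" "f \<in> Hom (theta n) \<theta> \<theta>'" "b \<in> Hom Delta m m'"
    using q(1) by (elim Hom_siteE)
  obtain a' f' b' where q2: "q' = (a', f', b')" by (cases q')
  have H': "f' \<in> Hom (theta n) \<theta> \<theta>'" "b' \<in> Hom Delta m m'" using q(2) q1 q2 by (auto simp: Hom_site)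
  have aa: "a' = a" using e q1 q2 by (simp add: ncls_def)
  show ?thesis
  proof (cases "is_const a")
    case True
    let ?w = "cns 0 k' (dfun a 0)"
    have w: "?w \<in> Hom Delta 0 k'" using is_constD[OF True H(1)] cns_Hom by simp
    have ob: "\<theta>' \<in> Obj (theta n)" using T.Hom_Obj[OF H(2)] by simp
    have eq: "act n X (?w, g, h) x = act n X (?w, Ide (theta n) \<theta>', Ide Delta m') x"
      if g: "g \<in> Hom (theta n) \<theta> \<theta>'" and h: "h \<in> Hom Delta m m'" for g h
    proof -
      have 1: "(Ide Delta 0, g, h) \<in> Hom (site n) (0, \<theta>, m) (0, \<theta>', m')"
        using g h D.Ide_Hom[of 0] by (simp add: Hom_site del: Delta_simps(2-))
      have 2: "(?w, Ide (theta n) \<theta>', Ide Delta m') \<in> Hom (site n) (0, \<theta>', m') (k', \<theta>', m')"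
        using w D.Ide_Hom[of m'] T.Ide_Hom[OF ob] by (simp add: Hom_site del: Delta_simps(2-))
      have x': "x \<in> el X (k', \<theta>', m')" using x q1 by simp
      have "Cmp (site n) (?w, Ide (theta n) \<theta>', Ide Delta m') (Ide Delta 0, g, h) = (?w, g, h)"
        using D.Cmp_Ide_right[OF w] D.Cmp_Ide_left[OF h] T.Cmp_Ide_left[OF g] by (simp del: Delta_simps)
      then have "act n X (?w, g, h) x = act n X (Ide Delta 0, g, h) (act n X (?w, Ide (theta n) \<theta>', Ide Delta m') x)"
        using act_Cmp[OF X' 1 2 x'] by simp
      then show ?thesis using SegPre_const[OF X g h act_in[OF X' 2 x']] by simp
    qed
    show ?thesis
      using act_const(1)[OF X' q(1)[unfolded q1] True x[unfolded q1]]
        act_const(1)[OF X' q(2)[unfolded q1 q2 aa] True x[unfolded q1]] eq[OF H(2,3)] eq[OF H'] q1 q2 aa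
      by simp
  next
    case False
    then have "q = q'" using e q1 q2 aa by (simp add: ncls_def)
    then show ?thesis by simp
  qed
qed

text \<open>The arrows from \<open>d\<close> to \<open>c\<close> in the quotient of the site by \<open>ncls\<close>.\<close>

definition nhom :: "nat \<Rightarrow> site_ob \<Rightarrow> site_ob \<Rightarrow> (dar \<times> (tmor \<times> dar) option) set" where
  "nhom n d c = ncls ` Hom (site n) d c"

text \<open>The preimage of \<open>U\<close> under composition with \<open>p\<close>, on classes of arrows
  (\<open>pull_iff\<close>).\<close>

definition pull :: "nat \<Rightarrow> site_ob \<Rightarrow> site_ar \<Rightarrow> (dar \<times> (tmor \<times> dar) option) set \<Rightarrow>
    (dar \<times> (tmor \<times> dar) option) set" where
  "pull n d p U = {ncls q | q. q \<in> Hom (site n) d (Dom (site n) p) \<and> ncls (Cmp (site n) p q) \<in> U}"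

definition encode :: "nat \<Rightarrow> site_ob \<Rightarrow> site_ob \<Rightarrow> (dar \<times> (tmor \<times> dar) option) set \<Rightarrow> 'u" where
  "encode n d c = enc (Pow (nhom n d c))"

definition decode :: "nat \<Rightarrow> site_ob \<Rightarrow> site_ob \<Rightarrow> 'u \<Rightarrow> (dar \<times> (tmor \<times> dar) option) set" where
  "decode n d c = inv_into (Pow (nhom n d c)) (encode n d c)"

text \<open>The presheaf \<open>c \<mapsto> Pow (nhom n d c)\<close>. In presheaf terms, it represents the functor that
  takes a presheaf on the quotient of the site to the power set of its value at \<open>d\<close>.\<close>

definition cofree :: "nat \<Rightarrow> site_ob \<Rightarrow> 'u spc" where
  "cofree n d = mk_obj n (\<lambda>c. encode n d c ` Pow (nhom n d c))
     (\<lambda>p u. encode n d (Dom (site n) p) (pull n d p (decode n d (Cod (site n) p) u)))"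

lemma Hom_site_sel: "p \<in> Hom (site n) c d \<Longrightarrow> Dom (site n) p = c \<and> Cod (site n) p = d"
  by (simp add: Hom_def)

lemma pull_iff:
  assumes p: "p \<in> Hom (site n) c e" and q: "q \<in> Hom (site n) d c"
  shows "ncls q \<in> pull n d p U \<longleftrightarrow> ncls (Cmp (site n) p q) \<in> U"
proof
  assume "ncls q \<in> pull n d p U"
  then obtain q' where q': "ncls q = ncls q'" "q' \<in> Hom (site n) d c" "ncls (Cmp (site n) p q') \<in> U"
    unfolding pull_def using Hom_site_sel[OF p] by auto
  show "ncls (Cmp (site n) p q) \<in> U" using ncls_cong[OF q q'(2) p q'(1)] q'(3) by simp
next
  assume "ncls (Cmp (site n) p q) \<in> U"
  then show "ncls q \<in> pull n d p U" unfolding pull_def using q Hom_site_sel[OF p] by blast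
qed

lemma pull_subset: "p \<in> Hom (site n) c e \<Longrightarrow> pull n d p U \<subseteq> nhom n d c"
  using Hom_site_sel[of p n c e] by (auto simp: pull_def nhom_def)

lemma nhom_eqI:
  assumes "U \<subseteq> nhom n d c" "V \<subseteq> nhom n d c" "\<And>q. q \<in> Hom (site n) d c \<Longrightarrow> ncls q \<in> U \<longleftrightarrow> ncls q \<in> V"
  shows "U = V"
proof (rule set_eqI)
  fix r
  show "r \<in> U \<longleftrightarrow> r \<in> V"
  proof (cases "r \<in> nhom n d c")
    case True
    then obtain q where "r = ncls q" "q \<in> Hom (site n) d c" unfolding nhom_def by blast
    then show ?thesis using assms(3) by simp
  qed (use assms(1,2) in auto)
qed

text \<open>The subset of \<open>Z(d)\<close> that corresponds to a map \<open>t\<close> from \<open>Z\<close> to \<open>cofree n d\<close>: an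
  element belongs to it if its image contains the class of the identity.\<close>

definition marks :: "nat \<Rightarrow> site_ob \<Rightarrow> 'u spcmap \<Rightarrow> 'u \<Rightarrow> bool" where
  "marks n d t z \<longleftrightarrow> ncls (Ide (site n) d) \<in> decode n d d (cmp t d z)"

context
  fixes n :: nat and d :: site_ob
  assumes inf: "infinite (UNIV :: 'u set)" and d: "d \<in> Obj (site n)"
begin

lemma finite_nhom: "finite (Pow (nhom n d c))"
  by (simp add: nhom_def finite_Hom_site)

lemma decode_encode: "U \<subseteq> nhom n d c \<Longrightarrow> decode n d c (encode n d c U :: 'u) = U"
  unfolding decode_def encode_def using inj_enc[OF inf finite_nhom] by (intro inv_into_f_f) auto

lemma encode_decode:
  assumes "(u :: 'u) \<in> encode n d c ` Pow (nhom n d c)"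
  shows "encode n d c (decode n d c u) = u" "decode n d c u \<subseteq> nhom n d c"
  using assms by (auto simp: decode_encode)

lemma cofree_psh: "is_psh n (\<lambda>c. encode n d c ` Pow (nhom n d c) :: 'u set)
     (\<lambda>p u. encode n d (Dom (site n) p) (pull n d p (decode n d (Cod (site n) p) u)))"
proof -
  interpret category "site n" by (rule category_site)
  show ?thesis unfolding is_psh_def
  proof (intro conjI allI impI ballI)
    show "small (encode n d c ` Pow (nhom n d c) :: 'u set)" for c
      by (intro small_finite inf finite_imageI finite_nhom)
    show "encode n d (Dom (site n) p) (pull n d p (decode n d (Cod (site n) p) x)) \<in> (encode n d c ` Pow (nhom n d c) :: 'u set)"
      if "p \<in> Hom (site n) c e" for c e p and x :: 'u
      using pull_subset[OF that] Hom_site_sel[OF that] by auto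
    show "encode n d (Dom (site n) (Ide (site n) c)) (pull n d (Ide (site n) c) (decode n d (Cod (site n) (Ide (site n) c)) x)) = x"
      if c: "c \<in> Obj (site n)" and x: "x \<in> encode n d c ` Pow (nhom n d c)" for c and x :: 'u
    proof -
      have "pull n d (Ide (site n) c) (decode n d c x) = decode n d c x"
        using pull_subset[OF Ide_Hom[OF c]] encode_decode(2)[OF x] pull_iff[OF Ide_Hom[OF c]] Cmp_Ide_left
        by (intro nhom_eqI[of _ n d c]) auto
      then show ?thesis using encode_decode(1)[OF x] Hom_site_sel[OF Ide_Hom[OF c]] by simp
    qed
    show "encode n d (Dom (site n) (Cmp (site n) q p)) (pull n d (Cmp (site n) q p) (decode n d (Cod (site n) (Cmp (site n) q p)) x)) =
       encode n d (Dom (site n) p) (pull n d p (decode n d (Cod (site n) p) (encode n d (Dom (site n) q) (pull n d q (decode n d (Cod (site n) q) x)) :: 'u)))"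
      if p: "p \<in> Hom (site n) c c'" and q: "q \<in> Hom (site n) c' e" for c c' e p q and x :: 'u
    proof -
      have "pull n d (Cmp (site n) q p) U = pull n d p (pull n d q U)" for U
      proof (rule nhom_eqI[of _ n d c])
        fix r assume r: "r \<in> Hom (site n) d c"
        show "ncls r \<in> pull n d (Cmp (site n) q p) U \<longleftrightarrow> ncls r \<in> pull n d p (pull n d q U)"
          using pull_iff[OF Cmp_Hom[OF p q] r] pull_iff[OF p r] pull_iff[OF q Cmp_Hom[OF r p]] Cmp_assoc[OF r p q]
          by simp
      qed (use pull_subset[OF p] pull_subset[OF Cmp_Hom[OF p q]] in blast)+
      then show ?thesis
        using Hom_site_sel[OF p] Hom_site_sel[OF q] Hom_site_sel[OF Cmp_Hom[OF p q]] decode_encode[OF pull_subset[OF q]]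
        by simp
    qed
  qed
qed

lemma cofree_Simp: "(cofree n d :: 'u spc) \<in> Obj (SimpThetaSp n)"
  unfolding cofree_def by (rule mk_obj_Obj(1)[OF cofree_psh])

lemma el_cofree: "c \<in> Obj (site n) \<Longrightarrow> el (cofree n d :: 'u spc) c = encode n d c ` Pow (nhom n d c)"
  unfolding cofree_def by (rule el_mk_obj)

lemma decode_act:
  assumes p: "p \<in> Hom (site n) c e" and x: "x \<in> el (cofree n d :: 'u spc) e"
  shows "decode n d c (act n (cofree n d :: 'u spc) p x) = pull n d p (decode n d e x)"
proof -
  have "e \<in> Obj (site n)" using category.Hom_Obj[OF category_site p] by simp
  then have "act n (cofree n d :: 'u spc) p x = encode n d c (pull n d p (decode n d e x))"
    using act_mk_obj[OF cofree_psh p] x Hom_site_sel[OF p] unfolding cofree_def[symmetric] by (simp add: el_cofree)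
  then show ?thesis using decode_encode[OF pull_subset[OF p]] by simp
qed

text \<open>In degree zero there is exactly one class of arrows from \<open>d\<close>, the same one for all values of the
  other two coordinates; it exists because the hom sets of the site are nonempty. So the power sets
  in degree zero, and hence their encodings, are literally the same.\<close>

lemma cofree_SegPre: "(cofree n d :: 'u spc) \<in> Obj (SegPre n)"
proof -
  obtain k \<theta>0 m0 where dk: "d = (k, \<theta>0, m0)" by (cases d)
  define r0 where "r0 = (cns k 0 0, None :: (tmor \<times> dar) option)"
  have n0: "ncls q = r0" if "q \<in> Hom (site n) d (0, \<theta>, m)" for q \<theta> m
  proof -
    have "fst q = cns k 0 0" using that Hom_Delta_0 by (cases q) (auto simp: dk Hom_site)
    then show ?thesis by (simp add: ncls_def r0_def is_const_cns)
  qed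
  have nh: "nhom n d (0, \<theta>, m) = {r0}" if "\<theta> \<in> Obj (theta n)" for \<theta> m
    using n0 Hom_site_nonempty[OF d, of "(0, \<theta>, m)"] that unfolding nhom_def by auto
  have cd: "encode n d (0, \<theta>, m) = (enc (Pow {r0}) :: _ \<Rightarrow> 'u)" "decode n d (0, \<theta>, m) = inv_into (Pow {r0}) (enc (Pow {r0}) :: _ \<Rightarrow> 'u)"
    if "\<theta> \<in> Obj (theta n)" for \<theta> m using nh[OF that] by (simp_all add: encode_def decode_def)
  show ?thesis unfolding cofree_def
  proof (rule mk_obj_SegPre[OF cofree_psh])
  show "small (enc (Pow {r0}) ` Pow {r0} :: 'u set)" by (intro small_finite inf) simp
  show "encode n d (0, \<theta>, m) ` Pow (nhom n d (0, \<theta>, m)) = (enc (Pow {r0}) ` Pow {r0} :: 'u set)"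
    if "\<theta> \<in> Obj (theta n)" for \<theta> m using nh[OF that] cd[OF that] by simp
  fix f b \<theta> \<theta>' m m' and x :: 'u
  assume f: "f \<in> Hom (theta n) \<theta>' \<theta>" and b: "b \<in> Hom Delta m' m" and x: "x \<in> enc (Pow {r0}) ` Pow {r0}"
  have ob: "\<theta> \<in> Obj (theta n)" "\<theta>' \<in> Obj (theta n)" using category.Hom_Obj[OF category_theta f] by auto
  have "Ide Delta 0 \<in> Hom Delta 0 0" using category.Ide_Hom[OF category_Delta, of 0] by (simp del: Delta_simps(2-))
  then have p: "(Ide Delta 0, f, b) \<in> Hom (site n) (0, \<theta>', m') (0, \<theta>, m)"
    using f b by (simp add: Hom_site del: Delta_simps)
  have x': "x \<in> encode n d (0, \<theta>, m) ` Pow (nhom n d (0, \<theta>, m))" using x nh cd ob by simp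
  have "pull n d (Ide Delta 0, f, b) (decode n d (0, \<theta>, m) x) = decode n d (0, \<theta>, m) x"
  proof (rule nhom_eqI[of _ n d "(0, \<theta>', m')"])
    show "pull n d (Ide Delta 0, f, b) (decode n d (0, \<theta>, m) x) \<subseteq> nhom n d (0, \<theta>', m')" by (rule pull_subset[OF p])
    show "decode n d (0, \<theta>, m) x \<subseteq> nhom n d (0, \<theta>', m')" using encode_decode(2)[OF x'] nh ob by simp
    fix q assume q: "q \<in> Hom (site n) d (0, \<theta>', m')"
    show "(ncls q \<in> pull n d (Ide Delta 0, f, b) (decode n d (0, \<theta>, m) x)) = (ncls q \<in> decode n d (0, \<theta>, m) x)"
      using pull_iff[OF p q] n0[OF q] n0[OF category.Cmp_Hom[OF category_site q p]] by simp
  qed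
  then show "encode n d (Dom (site n) (Ide Delta 0, f, b)) (pull n d (Ide Delta 0, f, b) (decode n d (Cod (site n) (Ide Delta 0, f, b)) x)) = x"
    using Hom_site_sel[OF p] encode_decode(1)[OF x'] cd ob by (simp del: Delta_simps)
  qed
qed

text \<open>By naturality, the subset of \<open>Z(d)\<close> determines the map everywhere.\<close>

lemma marks_act:
  fixes Z :: "'u spc"
  assumes t: "t \<in> Hom (SimpThetaSp n) Z (cofree n d)" and q: "q \<in> Hom (site n) d c" and z: "z \<in> el Z c"
  shows "ncls q \<in> decode n d c (cmp t c z) \<longleftrightarrow> marks n d t (act n Z q z)"
proof -
  interpret category "site n" by (rule category_site)
  have c: "c \<in> Obj (site n)" using Hom_Obj[OF q] by simp
  have "decode n d d (cmp t d (act n Z q z)) = pull n d q (decode n d c (cmp t c z))"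
    using cmp_nat[OF t q z] decode_act[OF q cmp_in[OF t c z]] by simp
  then show ?thesis unfolding marks_def using pull_iff[OF q Ide_Hom[OF d]] Cmp_Ide_right[OF q] by simp
qed

lemma cofree_eqI:
  fixes Z :: "'u spc"
  assumes t: "t \<in> Hom (SimpThetaSp n) Z (cofree n d)" "t' \<in> Hom (SimpThetaSp n) Z (cofree n d)"
    and m: "\<And>z. z \<in> el Z d \<Longrightarrow> marks n d t z \<longleftrightarrow> marks n d t' z"
  shows "t = t'"
proof (rule cmp_eqI[OF t])
  fix c z assume c: "c \<in> Obj (site n)" and z: "z \<in> el Z c"
  note in1 = cmp_in[OF t(1) c z, unfolded el_cofree[OF c]] and in2 = cmp_in[OF t(2) c z, unfolded el_cofree[OF c]]
  have Z: "Z \<in> Obj (SimpThetaSp n)" using spc_Hom(4)[OF t(1)] .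
  have "decode n d c (cmp t c z) = decode n d c (cmp t' c z)"
  proof (rule nhom_eqI[OF encode_decode(2)[OF in1] encode_decode(2)[OF in2]])
    fix q assume q: "q \<in> Hom (site n) d c"
    show "ncls q \<in> decode n d c (cmp t c z) \<longleftrightarrow> ncls q \<in> decode n d c (cmp t' c z)"
      using marks_act[OF t(1) q z] marks_act[OF t(2) q z] m[OF act_in[OF Z q z]] by simp
  qed
  then have "encode n d c (decode n d c (cmp t c z)) = (encode n d c (decode n d c (cmp t' c z)) :: 'u)" by simp
  then show "cmp t c z = cmp t' c z" unfolding encode_decode(1)[OF in1] encode_decode(1)[OF in2] .
qed

lemma marks_Cmp:
  fixes Z :: "'u spc"
  assumes "s \<in> Hom (SimpThetaSp n) Z Z'" "z \<in> el Z d"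
  shows "marks n d (Cmp (SimpThetaSp n) t s) z \<longleftrightarrow> marks n d t (cmp s d z)"
  using assms unfolding marks_def by (simp add: cmp_Cmp[OF _ d])

text \<open>An element \<open>z\<close> of \<open>Z(c)\<close> is sent to the set of classes of those arrows from \<open>d\<close> that
  act on \<open>z\<close> with values in \<open>U\<close>. The hypothesis says that this does not depend on the
  representative; it is satisfied by all \<open>U\<close> if \<open>Z\<close> is a Segal precategory
  (\<open>SegPre_ncls\<close>), but \<open>Z\<close> may be any simplicial object.\<close>

lemma cofree_map:
  fixes Z :: "'u spc"
  assumes Z: "Z \<in> Obj (SimpThetaSp n)"
    and U: "\<And>c z q q'. z \<in> el Z c \<Longrightarrow> q \<in> Hom (site n) d c \<Longrightarrow> q' \<in> Hom (site n) d c \<Longrightarrow> ncls q = ncls q' \<Longrightarrow>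
      act n Z q z \<in> U \<Longrightarrow> act n Z q' z \<in> U"
  shows "\<exists>t \<in> Hom (SimpThetaSp n) Z (cofree n d). \<forall>z \<in> el Z d. marks n d t z \<longleftrightarrow> z \<in> U"
proof -
  interpret category "site n" by (rule category_site)
  define V where "V = (\<lambda>c z. {ncls q | q. q \<in> Hom (site n) d c \<and> act n Z q z \<in> U})"
  have Vs: "V c z \<subseteq> nhom n d c" for c z by (auto simp: V_def nhom_def)
  have Viff: "ncls q \<in> V c z \<longleftrightarrow> act n Z q z \<in> U" if "q \<in> Hom (site n) d c" "z \<in> el Z c" for q c z
  proof
    assume "ncls q \<in> V c z"
    then obtain q' where q': "ncls q = ncls q'" "q' \<in> Hom (site n) d c" "act n Z q' z \<in> U"
      unfolding V_def by blast
    show "act n Z q z \<in> U" by (rule U[OF that(2) q'(2) that(1) q'(1)[symmetric] q'(3)])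
  next
    assume "act n Z q z \<in> U"
    then show "ncls q \<in> V c z" unfolding V_def using that by blast
  qed
  define t where "t = mk_map n Z (cofree n d) (\<lambda>c z. encode n d c (V c z))"
  have t: "t \<in> Hom (SimpThetaSp n) Z (cofree n d)" unfolding t_def
  proof (rule mk_map_Hom[OF Z cofree_Simp])
    show im: "encode n d c (V c z) \<in> el (cofree n d :: 'u spc) c" if "c \<in> Obj (site n)" for c z
      unfolding el_cofree[OF that] using Vs by blast
    fix p c e z assume p: "p \<in> Hom (site n) c e" and z: "z \<in> el Z e"
    have ce: "c \<in> Obj (site n)" "e \<in> Obj (site n)" using Hom_Obj[OF p] by auto
    have "pull n d p (V e z) = V c (act n Z p z)"
    proof (rule nhom_eqI[OF pull_subset[OF p] Vs])
      fix q assume q: "q \<in> Hom (site n) d c"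
      show "ncls q \<in> pull n d p (V e z) \<longleftrightarrow> ncls q \<in> V c (act n Z p z)"
        using pull_iff[OF p q] Viff[OF Cmp_Hom[OF q p] z] Viff[OF q act_in[OF Z p z]] act_Cmp[OF Z q p z] by simp
    qed
    then have dec: "decode n d c (act n (cofree n d :: 'u spc) p (encode n d e (V e z))) = V c (act n Z p z)"
      using decode_act[OF p im[OF ce(2)]] decode_encode[OF Vs] by simp
    show "act n (cofree n d :: 'u spc) p (encode n d e (V e z)) = encode n d c (V c (act n Z p z))"
      using encode_decode(1)[OF act_in[OF cofree_Simp p im[OF ce(2), of z], unfolded el_cofree[OF ce(1)]]]
      unfolding dec by (rule sym)
  qed
  moreover have "marks n d t z \<longleftrightarrow> z \<in> U" if z: "z \<in> el Z d" for z
    unfolding marks_def t_def cmp_mk_map[OF d z] decode_encode[OF Vs] Viff[OF Ide_Hom[OF d] z] act_Ide[OF Z d z] ..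
  ultimately show ?thesis by blast
qed

end

lemma Hom_SegPre: "f \<in> Hom (SegPre n) X Y \<longleftrightarrow> f \<in> Hom (SimpThetaSp n) X Y \<and> X \<in> Obj (SegPre n) \<and> Y \<in> Obj (SegPre n)"
  unfolding SegPre_def Hom_full_sub using category.Hom_Obj[OF SimpThetaSp_cat] by auto

lemma SegPre_simps: "Dom (SegPre n) = nsrc" "Cod (SegPre n) = ntgt" "Cmp (SegPre n) = Cmp (SimpThetaSp n)"
  by (simp_all add: SegPre_def SimpThetaSp_def fun_cat_def)

lemma category_SegPre: "category (SegPre n :: ('u spc, 'u spcmap) cat)"
  unfolding SegPre_def by (rule category_full_sub[OF SimpThetaSp_cat])

text \<open>If \<open>i\<close> identifies two elements \<open>g x\<close> and \<open>h x\<close> over \<open>d\<close>, then so does every map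
  that factors through \<open>i\<close>. The map to \<open>cofree n d\<close> that corresponds to the set
  \<open>{g x}\<close> does factor through \<open>i\<close>, but separates \<open>g x\<close> from all other elements.\<close>

lemma extends_mono:
  fixes i :: "'u spcmap"
  assumes inf: "infinite (UNIV :: 'u set)"
    and ext: "\<And>d. d \<in> Obj (site n) \<Longrightarrow> i \<in> extends_to (SegPre n) (cofree n d)"
  shows "is_mono (SegPre n) i"
proof -
  have Ob: "(0, Tree [], 0) \<in> Obj (site n)" by (cases n) auto
  have iA: "i \<in> Arr (SegPre n)" using ext[OF Ob] by (simp add: extends_to_def)
  have i: "i \<in> Hom (SegPre n) (nsrc i) (ntgt i)" using iA by (simp add: Hom_def SegPre_simps)
  then have iS: "i \<in> Hom (SimpThetaSp n) (nsrc i) (ntgt i)" and A: "nsrc i \<in> Obj (SegPre n)" by (simp_all add: Hom_SegPre)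
  have A': "nsrc i \<in> Obj (SimpThetaSp n)" using spc_Hom(4)[OF iS] .
  show ?thesis unfolding is_mono_def SegPre_simps
  proof (intro conjI iA allI ballI impI)
    fix w g h assume g: "g \<in> Hom (SegPre n) w (nsrc i)" and h: "h \<in> Hom (SegPre n) w (nsrc i)"
      and e: "Cmp (SimpThetaSp n) i g = Cmp (SimpThetaSp n) i h"
    have gS: "g \<in> Hom (SimpThetaSp n) w (nsrc i)" and hS: "h \<in> Hom (SimpThetaSp n) w (nsrc i)"
      using g h by (simp_all add: Hom_SegPre)
    show "g = h"
    proof (rule cmp_eqI[OF gS hS])
      fix d x assume d: "d \<in> Obj (site n)" and x: "x \<in> el w d"
      note gx = cmp_in[OF gS d x] and hx = cmp_in[OF hS d x]
      have "\<exists>t \<in> Hom (SimpThetaSp n) (nsrc i) (cofree n d). \<forall>z \<in> el (nsrc i) d. marks n d t z \<longleftrightarrow> z \<in> {cmp g d x}"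
        by (rule cofree_map[OF inf d A']) (metis SegPre_ncls[OF A])
      then obtain t where t: "t \<in> Hom (SimpThetaSp n) (nsrc i) (cofree n d)"
        and tm: "\<And>z. z \<in> el (nsrc i) d \<Longrightarrow> marks n d t z \<longleftrightarrow> z = cmp g d x" by blast
      have "t \<in> Hom (SegPre n) (nsrc i) (cofree n d)"
        using t A cofree_SegPre[OF inf d] by (simp add: Hom_SegPre)
      then obtain s where s: "s \<in> Hom (SegPre n) (ntgt i) (cofree n d)" "Cmp (SimpThetaSp n) s i = t"
        using ext[OF d] unfolding extends_to_def SegPre_simps by blast
      have "cmp i d (cmp g d x) = cmp i d (cmp h d x)"
        using cmp_Cmp[OF gS d x, of i] cmp_Cmp[OF hS d x, of i] e by simp
      then have "marks n d t (cmp g d x) \<longleftrightarrow> marks n d t (cmp h d x)"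
        using marks_Cmp[OF inf d iS gx, of s] marks_Cmp[OF inf d iS hx, of s] s(2) by simp
      then show "cmp g d x = cmp h d x" using tm[OF gx] tm[OF hx] by simp
    qed
  qed
qed

section \<open>The maps in the set I_f\<close>

lemma is_functor_disc: "is_functor SetC (ThetaSp n) (disc n)"
proof -
  have 1: "is_functor SetC SSets (diag (opp Delta) SetC)" unfolding SSets_def
    by (intro is_functor_diag category_opp category_Delta category_SetC)
  have "category (SSets :: ('u sset, 'u ssmap) cat)" unfolding SSets_def
    by (intro category_fun_cat category_opp category_Delta category_SetC)
  then have 2: "is_functor SSets (ThetaSp n) (diag (opp (theta n)) (SSets :: ('u sset, 'u ssmap) cat))"
    unfolding ThetaSp_def by (intro is_functor_diag category_opp category_theta)
  show ?thesis unfolding disc_def by (rule is_functor_fcomp[OF category_SetC 1 2])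
qed

lemma simplex_SegPre:
  assumes inf: "infinite (UNIV :: 'u set)"
  shows "(simplex n p :: 'u spc) \<in> Obj (SegPre n)"
proof -
  note yo = yo_ob_functor[OF inf, of p]
  have "is_functor (opp Delta) (ThetaSp n) (simplex n p :: 'u spc)" unfolding simplex_def
    by (rule is_functor_fcomp[OF category_opp[OF category_Delta] yo is_functor_disc])
  moreover have sm: "small (fob (yo_ob Delta p) 0 :: 'u set)" using setF_small[OF yo] by simp
  moreover have "fob (simplex n p) 0 = fob (disc n) (fob (yo_ob Delta p) 0 :: 'u set)"
    by (simp add: simplex_def fcomp_def)
  ultimately show ?thesis unfolding SegPre_def by (auto simp: SimpThetaSp_def)
qed

lemma vertices_Obj:
  assumes inf: "infinite (UNIV :: 'u set)"
  shows "(vertices n p :: 'u spc) \<in> Obj (SimpThetaSp n)"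
    and "el (vertices n p :: 'u spc) (k, \<theta>, m) = el (simplex n p) (0, \<theta>, m)"
proof -
  have "(simplex n p :: 'u spc) \<in> Obj (SimpThetaSp n)" using simplex_SegPre[OF inf] by (simp add: SegPre_Obj)
  then have "fob (simplex n p :: 'u spc) 0 \<in> Obj (ThetaSp n)"
    using spaces_functor(2)[of _ n 0] by (simp add: ThetaSp_def)
  then show "(vertices n p :: 'u spc) \<in> Obj (SimpThetaSp n)"
    using is_functor_const_ob[OF category_opp[OF category_Delta] ThetaSp_cat]
    by (simp add: vertices_def SimpThetaSp_def)
  show "el (vertices n p :: 'u spc) (k, \<theta>, m) = el (simplex n p) (0, \<theta>, m)"
    by (simp add: el_def vertices_def const_ob_def)
qed

lemma sq_cns: "sq 0 (replicate (k + 1) 0) = cns k 0 0"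
  by (auto simp: sq_def cns_def fun_eq_iff restrict_def simp del: replicate.simps)

lemma vertices_incl_Hom:
  assumes inf: "infinite (UNIV :: 'u set)"
  shows "(vertices_incl n p :: 'u spcmap) \<in> Hom (SimpThetaSp n) (vertices n p) (simplex n p)"
    and "\<theta> \<in> Obj (theta n) \<Longrightarrow> v \<in> el (simplex n p :: 'u spc) (0, \<theta>, m) \<Longrightarrow>
      cmp (vertices_incl n p) (k, \<theta>, m) v = act n (simplex n p) (cns k 0 0, Ide (theta n) \<theta>, Ide Delta m) v"
proof -
  interpret D: category Delta by (rule category_Delta)
  interpret H: category "ThetaSp n :: ('u tsp, 'u tspmap) cat" by (rule ThetaSp_cat)
  let ?X = "simplex n p :: 'u spc"
  have X: "?X \<in> Obj (SimpThetaSp n)" using simplex_SegPre[OF inf] by (simp add: SegPre_Obj)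
  note F = spaces_functor(1)[OF X]
  have c: "cns k 0 0 \<in> Hom Delta k 0" for k by (rule cns_Hom) simp
  have fc: "far ?X (cns k 0 0) \<in> Hom (ThetaSp n) (fob ?X 0) (fob ?X k)" for k
    using is_functorD(4)[OF F, of "cns k 0 0" 0 k] c by simp
  have n: "ncmp (vertices_incl n p) k = far ?X (cns k 0 0)" for k
    using sq_cns[of k] by (simp add: vertices_incl_def)
  show "(vertices_incl n p :: 'u spcmap) \<in> Hom (SimpThetaSp n) (vertices n p) ?X"
    unfolding SimpThetaSp_def Hom_fun_cat
  proof (intro conjI is_ntrI)
    show "is_functor (opp Delta) (ThetaSp n) (nsrc (vertices_incl n p :: 'u spcmap))"
      using spaces_functor(1)[OF vertices_Obj(1)[OF inf]] by (simp add: vertices_incl_def)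
    show "is_functor (opp Delta) (ThetaSp n) (ntgt (vertices_incl n p :: 'u spcmap))"
      using F by (simp add: vertices_incl_def)
    show "ncmp (vertices_incl n p :: 'u spcmap) k \<in> Hom (ThetaSp n) (fob (nsrc (vertices_incl n p)) k) (fob (ntgt (vertices_incl n p)) k)"
      for k using fc[of k] unfolding n by (simp add: vertices_incl_def vertices_def const_ob_def)
    fix a k k' assume "a \<in> Hom (opp Delta) k k'"
    then have a: "a \<in> Hom Delta k' k" by simp
    have "far ?X (Cmp Delta (cns k 0 0) a) = Cmp (ThetaSp n) (far ?X a) (far ?X (cns k 0 0))"
      using is_functorD(6)[OF F, of "cns k 0 0" 0 k a k'] c a by (simp del: Delta_simps)
    then have "Cmp (ThetaSp n) (far ?X a) (far ?X (cns k 0 0)) = far ?X (cns k' 0 0)"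
      using Cmp_cns[OF a] by (simp del: Delta_simps)
    also have "\<dots> = Cmp (ThetaSp n) (far ?X (cns k' 0 0)) (Ide (ThetaSp n) (fob ?X 0))"
      using H.Cmp_Ide_right[OF fc] by simp
    finally show "Cmp (ThetaSp n) (far (ntgt (vertices_incl n p)) a) (ncmp (vertices_incl n p) k) =
       Cmp (ThetaSp n) (ncmp (vertices_incl n p) k') (far (nsrc (vertices_incl n p :: 'u spcmap)) a)"
      unfolding n using Hom_Arr[OF a] by (simp add: vertices_incl_def vertices_def const_ob_def)
  qed (simp_all add: vertices_incl_def)
  show "cmp (vertices_incl n p) (k, \<theta>, m) v = act n ?X (cns k 0 0, Ide (theta n) \<theta>, Ide Delta m) v"
    if "\<theta> \<in> Obj (theta n)" "v \<in> el ?X (0, \<theta>, m)"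
    using act_one_factor(1)[OF X that c] unfolding cmp_def by (simp add: n del: Delta_simps)
qed

text \<open>The total degeneracies are split by the vertex \<open>0\<close>.\<close>

lemma vertices_incl_inj:
  assumes inf: "infinite (UNIV :: 'u set)" and d: "d \<in> Obj (site n)"
    and v: "v \<in> el (vertices n p :: 'u spc) d" "v' \<in> el (vertices n p :: 'u spc) d"
    and e: "cmp (vertices_incl n p) d v = cmp (vertices_incl n p) d v'"
  shows "v = v'"
proof -
  interpret D: category Delta by (rule category_Delta)
  interpret T: category "theta n" by (rule category_theta)
  obtain k \<theta> m where dk: "d = (k, \<theta>, m)" and \<theta>: "\<theta> \<in> Obj (theta n)" using d by auto
  let ?X = "simplex n p :: 'u spc"
  have X: "?X \<in> Obj (SimpThetaSp n)" using simplex_SegPre[OF inf] by (simp add: SegPre_Obj)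
  have I: "Ide Delta m \<in> Hom Delta m m" for m using D.Ide_Hom[of m] by (simp del: Delta_simps(2-))
  have 1: "(cns k 0 0, Ide (theta n) \<theta>, Ide Delta m) \<in> Hom (site n) (k, \<theta>, m) (0, \<theta>, m)"
    and 2: "(cns 0 k 0, Ide (theta n) \<theta>, Ide Delta m) \<in> Hom (site n) (0, \<theta>, m) (k, \<theta>, m)"
    using T.Ide_Hom[OF \<theta>] I cns_Hom by (simp_all add: Hom_site del: Delta_simps)
  have id: "Cmp (site n) (cns k 0 0, Ide (theta n) \<theta>, Ide Delta m) (cns 0 k 0, Ide (theta n) \<theta>, Ide Delta m)
     = Ide (site n) (0, \<theta>, m)"
    using Cmp_cns[OF cns_Hom[of 0 k 0], of 0 0] Hom_Delta_0[OF I[of 0]] T.Cmp_Ide_left[OF T.Ide_Hom[OF \<theta>]] D.Cmp_Ide_left[OF I]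
    by (simp del: Delta_simps)
  have *: "act n ?X (cns 0 k 0, Ide (theta n) \<theta>, Ide Delta m) (cmp (vertices_incl n p) d v) = v"
    if "v \<in> el (vertices n p :: 'u spc) d" for v
  proof -
    have v: "v \<in> el ?X (0, \<theta>, m)" using that vertices_Obj(2)[OF inf] by (simp add: dk)
    have "(0, \<theta>, m) \<in> Obj (site n)" using \<theta> by simp
    then show ?thesis unfolding dk vertices_incl_Hom(2)[OF inf \<theta> v] act_Cmp[OF X 2 1 v, symmetric] id
      using act_Ide[OF X _ v] by simp
  qed
  show ?thesis using *[OF v(1)] *[OF v(2)] e by simp
qed

lemma cst_Obj:
  fixes A :: "'u tsp"
  assumes "A \<in> Obj (ThetaSp n)"
  shows "cst n A \<in> Obj (SimpThetaSp n)"
  using is_functor_const_ob[OF category_opp[OF category_Delta] ThetaSp_cat assms]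
  by (simp add: cst_def SimpThetaSp_def)

lemma cst_map_Hom:
  fixes f :: "'u tspmap"
  assumes "f \<in> Hom (ThetaSp n) A B"
  shows "cst_map n f \<in> Hom (SimpThetaSp n) (cst n A) (cst n B)"
    and "cmp (cst_map n f) (k, \<theta>, m) x = sfun (ncmp (ncmp f \<theta>) m) x"
  using const_ar_Hom[OF category_opp[OF category_Delta] ThetaSp_cat assms]
  by (simp_all add: cst_def cst_map_def SimpThetaSp_def cmp_def const_ar_def)

lemma is_pushoutD:
  assumes "is_pushout C f g P u v"
  shows "f \<in> Arr C" "g \<in> Arr C" "u \<in> Hom C (Cod C f) P" "v \<in> Hom C (Cod C g) P" "Cmp C u f = Cmp C v g"
    and "u' \<in> Hom C (Cod C f) Q \<Longrightarrow> v' \<in> Hom C (Cod C g) Q \<Longrightarrow> Cmp C u' f = Cmp C v' g \<Longrightarrow>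
      \<exists>!h. h \<in> Hom C P Q \<and> Cmp C h u = u' \<and> Cmp C h v = v'"
  using assms unfolding is_pushout_def by blast+

text \<open>A map \<open>u\<close> from \<open>P = A\<^sub>[\<^sub>p\<^sub>]\<close> to \<open>cofree n d\<close> amounts to a subset of
  \<open>(A \<times> \<Delta>[p])(d)\<close> (marked by \<open>uq\<close>) and a set of vertices (marked by \<open>wV\<close>) that
  are compatible over \<open>A \<times> (\<Delta>[p])\<^sub>0\<close>. The subset \<open>U\<close> of
  \<open>(B \<times> \<Delta>[p])(d)\<close> consists of the image of the first set and of all elements whose
  second coordinate is a marked vertex. Compatibility (\<open>K0\<close>) and injectivity ensure that \<open>U\<close>
  contains an element over a vertex only if that vertex is marked (\<open>K1\<close>), and meets
  \<open>(A \<times> \<Delta>[p])(d)\<close> in the first set only (\<open>K2\<close>). By \<open>K1\<close>, the map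
  corresponding to \<open>U\<close> agrees with the given one over the vertices and descends to
  \<open>B\<^sub>[\<^sub>p\<^sub>]\<close>; by \<open>K2\<close>, the result restricts to \<open>u\<close>.\<close>

lemma bracket_extends:
  fixes f :: "'u tspmap"
  assumes inf: "infinite (UNIV :: 'u set)" and d: "d \<in> Obj (site n)"
    and f: "f \<in> Hom (ThetaSp n) A B"
    and f_inj: "\<And>\<theta> m. \<theta> \<in> Obj (theta n) \<Longrightarrow> inj_on (sfun (ncmp (ncmp f \<theta>) m)) (fob (fob A \<theta>) m)"
    and br: "is_bracket n p A P j q" and br': "is_bracket n p B P' j' q'"
    and h: "h \<in> Hom (SegPre n) P P'"
    and hj: "Cmp (SimpThetaSp n) h j = j'"
    and hq: "Cmp (SimpThetaSp n) h q = Cmp (SimpThetaSp n) q'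
          (prod_ar (SimpThetaSp n) (cst_map n f) (Ide (SimpThetaSp n) (simplex n p)))"
  shows "h \<in> extends_to (SegPre n) (cofree n d)"
proof -
  define C where "C = (SimpThetaSp n :: ('u spc, 'u spcmap) cat)"
  interpret category C unfolding C_def by (rule SimpThetaSp_cat)
  let ?A = "cst n A" and ?B = "cst n B" and ?F = "cst_map n f"
  let ?X = "simplex n p :: 'u spc" and ?V = "vertices n p :: 'u spc" and ?\<iota> = "vertices_incl n p :: 'u spcmap"
  let ?Q = "cofree n d :: 'u spc"
  have ob: "A \<in> Obj (ThetaSp n)" "B \<in> Obj (ThetaSp n)" using category.Hom_Obj[OF ThetaSp_cat f] by auto
  have Ao: "?A \<in> Obj C" and Bo: "?B \<in> Obj C" using cst_Obj ob unfolding C_def by auto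
  have Xs: "?X \<in> Obj (SegPre n)" by (rule simplex_SegPre[OF inf])
  have Xo: "?X \<in> Obj C" using Xs by (simp add: SegPre_Obj C_def)
  have Vo: "?V \<in> Obj C" unfolding C_def by (rule vertices_Obj(1)[OF inf])
  note \<iota> = vertices_incl_Hom(1)[OF inf, of n p, folded C_def]
  note F = cst_map_Hom(1)[OF f, folded C_def]
  let ?AX = "prod_ob C ?A ?X" and ?BX = "prod_ob C ?B ?X" and ?AV = "prod_ob C ?A ?V" and ?BV = "prod_ob C ?B ?V"
  define \<alpha> where "\<alpha> = prod_ar C (Ide C ?A) ?\<iota>"
  define \<beta> where "\<beta> = prod_ar C (Ide C ?B) ?\<iota>"
  define \<phi> where "\<phi> = prod_ar C ?F (Ide C ?X)"
  note \<alpha> = prod_ar_Hom[OF inf Ide_Hom[OF Ao, unfolded C_def] \<iota>[unfolded C_def], folded C_def, folded \<alpha>_def]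
  note \<beta> = prod_ar_Hom[OF inf Ide_Hom[OF Bo, unfolded C_def] \<iota>[unfolded C_def], folded C_def, folded \<beta>_def]
  note \<phi> = prod_ar_Hom[OF inf F[unfolded C_def] Ide_Hom[OF Xo, unfolded C_def], folded C_def, folded \<phi>_def]
  note AX = chosen_product[OF inf Ao[unfolded C_def] Xo[unfolded C_def], folded C_def]
  note BX = chosen_product[OF inf Bo[unfolded C_def] Xo[unfolded C_def], folded C_def]
  note AV = chosen_product[OF inf Ao[unfolded C_def] Vo[unfolded C_def], folded C_def]
  note BV = chosen_product[OF inf Bo[unfolded C_def] Vo[unfolded C_def], folded C_def]
  let ?p1 = "\<lambda>Y Z. snd (prod_cone C Y Z) False" and ?p2 = "\<lambda>Y Z. snd (prod_cone C Y Z) True"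
  have po: "is_pushout C (?p2 ?A ?V) \<alpha> P j q" and po': "is_pushout C (?p2 ?B ?V) \<beta> P' j' q'"
    using br br' unfolding is_bracket_def proj2_def \<alpha>_def \<beta>_def C_def by auto
  have cods: "Cod C (?p2 ?A ?V) = ?V" "Cod C (?p2 ?B ?V) = ?V" "Cod C \<alpha> = ?AX" "Cod C \<beta> = ?BX"
    using Hom_Arr[OF AV(3)] Hom_Arr[OF BV(3)] Hom_Arr[OF \<alpha>(1)] Hom_Arr[OF \<beta>(1)] by blast+
  note j = is_pushoutD(3)[OF po, unfolded cods] and q = is_pushoutD(4)[OF po, unfolded cods] and sq = is_pushoutD(5)[OF po]
  note j' = is_pushoutD(3)[OF po', unfolded cods] and q' = is_pushoutD(4)[OF po', unfolded cods]
  have cC: "cmp (Cmp C u t) c x = cmp u c (cmp t c x)"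
    if "t \<in> Hom C Y Z" "c \<in> Obj (site n)" "x \<in> el Y c" for t u Y Z c x
    using that unfolding C_def by (rule cmp_Cmp)
  have cI: "cmp (Ide C Y) c x = x" if "c \<in> Obj (site n)" "x \<in> el Y c" for Y c x
    using that unfolding C_def by (rule cmp_Ide)
  have cin: "cmp t c x \<in> el Z c" if "t \<in> Hom C Y Z" "c \<in> Obj (site n)" "x \<in> el Y c" for t Y Z c x
    using that unfolding C_def by (rule cmp_in)
  note mk = marks_Cmp[OF inf d, folded C_def]
  have p2\<phi>: "cmp (?p2 ?B ?X) d (cmp \<phi> d z) = cmp (?p2 ?A ?X) d z" if z: "z \<in> el ?AX d" for z
    unfolding cC[OF \<phi>(1) d z, symmetric] unfolding \<phi>(3) unfolding cC[OF AX(3) d z]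
    by (rule cI[OF d cin[OF AX(3) d z]])
  have p1\<phi>: "cmp (?p1 ?B ?X) d (cmp \<phi> d z) = cmp ?F d (cmp (?p1 ?A ?X) d z)" if z: "z \<in> el ?AX d" for z
    unfolding cC[OF \<phi>(1) d z, symmetric] unfolding \<phi>(2) by (rule cC[OF AX(2) d z])
  have p2\<alpha>: "cmp (?p2 ?A ?X) d (cmp \<alpha> d z) = cmp ?\<iota> d (cmp (?p2 ?A ?V) d z)" if z: "z \<in> el ?AV d" for z
    unfolding cC[OF \<alpha>(1) d z, symmetric] unfolding \<alpha>(3) by (rule cC[OF AV(3) d z])
  have p1\<alpha>: "cmp (?p1 ?A ?X) d (cmp \<alpha> d z) = cmp (?p1 ?A ?V) d z" if z: "z \<in> el ?AV d" for z
    unfolding cC[OF \<alpha>(1) d z, symmetric] unfolding \<alpha>(2) unfolding cC[OF AV(2) d z]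
    by (rule cI[OF d cin[OF AV(2) d z]])
  have p2\<beta>: "cmp (?p2 ?B ?X) d (cmp \<beta> d z) = cmp ?\<iota> d (cmp (?p2 ?B ?V) d z)" if z: "z \<in> el ?BV d" for z
    unfolding cC[OF \<beta>(1) d z, symmetric] unfolding \<beta>(3) by (rule cC[OF BV(3) d z])
  have Finj: "x = y" if "x \<in> el ?A d" "y \<in> el ?A d" "cmp ?F d x = cmp ?F d y" for x y
  proof -
    obtain k \<theta> m where dk: "d = (k, \<theta>, m)" "\<theta> \<in> Obj (theta n)" using d by auto
    show ?thesis using inj_onD[OF f_inj[OF dk(2), of m], of x y] that dk(1) cst_map_Hom(2)[OF f]
      by (simp add: el_def cst_def const_ob_def)
  qed
  have \<phi>inj: "z = z'" if z: "z \<in> el ?AX d" "z' \<in> el ?AX d" "cmp \<phi> d z = cmp \<phi> d z'" for z z'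
  proof (rule AX(4)[OF d z(1,2)])
    show "cmp (?p2 ?A ?X) d z = cmp (?p2 ?A ?X) d z'" using p2\<phi>[OF z(1)] p2\<phi>[OF z(2)] z(3) by simp
    show "cmp (?p1 ?A ?X) d z = cmp (?p1 ?A ?X) d z'"
      by (rule Finj[OF cin[OF AX(2) d z(1)] cin[OF AX(2) d z(2)]])
        (use p1\<phi>[OF z(1)] p1\<phi>[OF z(2)] z(3) in simp)
  qed
  have "\<exists>w \<in> Hom C P' ?Q. Cmp C w h = u" if u: "u \<in> Hom C P ?Q" for u
  proof -
    have hH: "h \<in> Hom C P P'" using h by (simp add: Hom_SegPre C_def)
    define wV where "wV = Cmp C u j"
    define uq where "uq = Cmp C u q"
    have wV: "wV \<in> Hom C ?V ?Q" unfolding wV_def by (rule Cmp_Hom[OF j u])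
    have uq: "uq \<in> Hom C ?AX ?Q" unfolding uq_def by (rule Cmp_Hom[OF q u])
    have compat: "Cmp C wV (?p2 ?A ?V) = Cmp C uq \<alpha>"
      unfolding wV_def uq_def using Cmp_assoc[OF AV(3) j u] Cmp_assoc[OF \<alpha>(1) q u] sq by simp
    have K0: "marks n d uq z \<longleftrightarrow> marks n d wV v"
      if z: "z \<in> el ?AX d" and v: "v \<in> el ?V d" and e: "cmp (?p2 ?A ?X) d z = cmp ?\<iota> d v" for z v
    proof -
      \<comment> \<open>As the product is formed elementwise, \<open>z\<close> comes from \<open>A \<times> (\<Delta>[p])\<^sub>0\<close>.\<close>
      obtain y where y: "y \<in> el ?AV d" "cmp (?p1 ?A ?V) d y = cmp (?p1 ?A ?X) d z" "cmp (?p2 ?A ?V) d y = v"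
        using AV(5)[OF d cin[OF AX(2) d z] v] by blast
      have "cmp \<alpha> d y = z"
        using p1\<alpha>[OF y(1)] p2\<alpha>[OF y(1)] y(2,3) e by (intro AX(4)[OF d cin[OF \<alpha>(1) d y(1)] z]) simp_all
      then show ?thesis using mk[OF \<alpha>(1) y(1), of uq] mk[OF AV(3) y(1), of wV] compat y(3) by simp
    qed
    define U where "U = {z \<in> el ?BX d. (\<exists>a \<in> el ?AX d. cmp \<phi> d a = z \<and> marks n d uq a) \<or>
       (\<exists>v \<in> el ?V d. cmp (?p2 ?B ?X) d z = cmp ?\<iota> d v \<and> marks n d wV v)}"
    have K1: "z \<in> U \<longleftrightarrow> marks n d wV v"
      if z: "z \<in> el ?BX d" and v: "v \<in> el ?V d" and e: "cmp (?p2 ?B ?X) d z = cmp ?\<iota> d v" for z v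
    proof
      assume "z \<in> U"
      then consider a where "a \<in> el ?AX d" "cmp \<phi> d a = z" "marks n d uq a"
        | v' where "v' \<in> el ?V d" "cmp (?p2 ?B ?X) d z = cmp ?\<iota> d v'" "marks n d wV v'" unfolding U_def by blast
      then show "marks n d wV v"
      proof cases
        case 1
        have "cmp (?p2 ?A ?X) d a = cmp ?\<iota> d v" using p2\<phi>[OF 1(1)] e unfolding 1(2) by simp
        then show ?thesis using K0[OF 1(1) v] 1(3) by blast
      next
        case 2
        have "cmp ?\<iota> d v' = cmp ?\<iota> d v" using 2(2) e by (rule trans[OF sym])
        then have "v' = v" by (rule vertices_incl_inj[OF inf d 2(1) v])
        then show ?thesis using 2(3) by blast
      qed
    next
      assume "marks n d wV v"
      then show "z \<in> U" unfolding U_def using z v e by blast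
    qed
    have K2: "cmp \<phi> d z \<in> U \<longleftrightarrow> marks n d uq z" if z: "z \<in> el ?AX d" for z
    proof
      assume "cmp \<phi> d z \<in> U"
      then consider a where "a \<in> el ?AX d" "cmp \<phi> d a = cmp \<phi> d z" "marks n d uq a"
        | v where "v \<in> el ?V d" "cmp (?p2 ?B ?X) d (cmp \<phi> d z) = cmp ?\<iota> d v" "marks n d wV v" unfolding U_def by blast
      then show "marks n d uq z"
      proof cases
        case 1
        show ?thesis using \<phi>inj[OF 1(1) z 1(2)] 1(3) by blast
      next
        case 2
        have "cmp (?p2 ?A ?X) d z = cmp ?\<iota> d v" using p2\<phi>[OF z] 2(2) by (rule trans[OF sym])
        then show ?thesis using K0[OF z 2(1)] 2(3) by blast
      qed
    next
      assume "marks n d uq z"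
      then show "cmp \<phi> d z \<in> U" unfolding U_def using z cin[OF \<phi>(1) d z] by blast
    qed
    have BXo: "?BX \<in> Obj (SimpThetaSp n)" using Hom_Obj[OF BX(3)] by (simp add: C_def)
    \<comment> \<open>An arrow with constant first coordinate moves the second coordinate to a vertex that does not
      depend on the other two coordinates of the arrow; by \<open>K1\<close> that vertex decides about
      membership in \<open>U\<close>.\<close>
    have indep: "act n ?BX g' z \<in> U"
      if z: "z \<in> el ?BX c" and g: "g \<in> Hom (site n) d c" and g': "g' \<in> Hom (site n) d c"
        and e: "ncls g = ncls g'" and zU: "act n ?BX g z \<in> U" for c z g g'
    proof (cases "is_const (fst g)")
      case True
      have c: "c \<in> Obj (site n)" using category.Hom_Obj[OF category_site g] by simp
      obtain k \<theta> m k' \<theta>' m' a f b where g1: "g = (a, f, b)" "d = (k, \<theta>, m)" "c = (k', \<theta>', m')"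
        using g by (elim Hom_siteE)
      have \<theta>: "\<theta> \<in> Obj (theta n)" using d g1 by simp
      let ?x = "cmp (?p2 ?B ?X) c z"
      have x: "?x \<in> el ?X c" by (rule cin[OF BX(3) c z])
      define v where "v = act n ?X (cns 0 k' (dfun a 0), f, b) ?x"
      note ac = act_const[OF Xo[unfolded C_def] g[unfolded g1] True[unfolded g1 fst_conv] x[unfolded g1], folded g1(3), folded v_def]
      have v: "v \<in> el ?V d" using ac(2) vertices_Obj(2)[OF inf] by (simp add: g1)
      have "cmp ?\<iota> d v = act n ?X g ?x"
        using ac(1) vertices_incl_Hom(2)[OF inf \<theta> ac(2)] by (simp add: g1 del: Delta_simps)
      moreover have "act n ?X g ?x = act n ?X g' ?x" by (rule SegPre_ncls[OF Xs g g' e x])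
      moreover have "cmp (?p2 ?B ?X) d (act n ?BX r z) = act n ?X r ?x" if "r \<in> Hom (site n) d c" for r
        using cmp_nat[OF BX(3)[unfolded C_def] that z[unfolded C_def]] unfolding C_def by simp
      ultimately have "cmp (?p2 ?B ?X) d (act n ?BX g z) = cmp ?\<iota> d v"
        "cmp (?p2 ?B ?X) d (act n ?BX g' z) = cmp ?\<iota> d v" using g g' by simp_all
      then show ?thesis using K1[OF act_in[OF BXo g z] v] K1[OF act_in[OF BXo g' z] v] zU by simp
    next
      case False
      then have "g = g'" using e by (auto simp: ncls_def prod_eq_iff split: if_splits)
      then show ?thesis using zU by simp
    qed
    have "\<exists>t \<in> Hom (SimpThetaSp n) ?BX ?Q. \<forall>z \<in> el ?BX d. marks n d t z \<longleftrightarrow> z \<in> U"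
      by (rule cofree_map[OF inf d BXo]) (rule indep)
    then obtain wB where wB: "wB \<in> Hom C ?BX ?Q" and wBm: "\<And>z. z \<in> el ?BX d \<Longrightarrow> marks n d wB z \<longleftrightarrow> z \<in> U"
      unfolding C_def by blast
    have "Cmp C wV (?p2 ?B ?V) = Cmp C wB \<beta>"
    proof (rule cofree_eqI[OF inf d, of _ ?BV, folded C_def])
      show "Cmp C wV (?p2 ?B ?V) \<in> Hom C ?BV ?Q" by (rule Cmp_Hom[OF BV(3) wV])
      show "Cmp C wB \<beta> \<in> Hom C ?BV ?Q" by (rule Cmp_Hom[OF \<beta>(1) wB])
      fix z assume z: "z \<in> el ?BV d"
      note bz = cin[OF \<beta>(1) d z] and vz = cin[OF BV(3) d z]
      show "marks n d (Cmp C wV (?p2 ?B ?V)) z \<longleftrightarrow> marks n d (Cmp C wB \<beta>) z"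
        using mk[OF BV(3) z, of wV] mk[OF \<beta>(1) z, of wB] wBm[OF bz] K1[OF bz vz p2\<beta>[OF z]] by simp
    qed
    then obtain w where w: "w \<in> Hom C P' ?Q" "Cmp C w j' = wV" "Cmp C w q' = wB"
      using is_pushoutD(6)[OF po', unfolded cods, OF wV wB] by blast
    have 1: "Cmp C (Cmp C w h) j = wV" using Cmp_assoc[OF j hH w(1)] hj w(2) by (simp add: C_def)
    have "Cmp C (Cmp C w h) q = Cmp C w (Cmp C q' \<phi>)"
      using Cmp_assoc[OF q hH w(1)] hq by (simp add: C_def \<phi>_def)
    also have "\<dots> = Cmp C wB \<phi>" using Cmp_assoc[OF \<phi>(1) q' w(1)] w(3) by simp
    also have "\<dots> = uq"
    proof (rule cofree_eqI[OF inf d, of _ ?AX, folded C_def])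
      show "Cmp C wB \<phi> \<in> Hom C ?AX ?Q" by (rule Cmp_Hom[OF \<phi>(1) wB])
      show "uq \<in> Hom C ?AX ?Q" by (rule uq)
      fix z assume z: "z \<in> el ?AX d"
      show "marks n d (Cmp C wB \<phi>) z \<longleftrightarrow> marks n d uq z"
        using mk[OF \<phi>(1) z, of wB] wBm[OF cin[OF \<phi>(1) d z]] K2[OF z] by simp
    qed
    finally have 2: "Cmp C (Cmp C w h) q = uq" .
    have "\<exists>!g. g \<in> Hom C P ?Q \<and> Cmp C g j = wV \<and> Cmp C g q = uq"
      by (rule is_pushoutD(6)[OF po, unfolded cods, OF wV uq compat])
    moreover have "u \<in> Hom C P ?Q \<and> Cmp C u j = wV \<and> Cmp C u q = uq" using u by (simp add: wV_def uq_def)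
    moreover have "Cmp C w h \<in> Hom C P ?Q" by (rule Cmp_Hom[OF hH w(1)])
    ultimately have "Cmp C w h = u" using 1 2 by blast
    then show ?thesis using w(1) by blast
  qed
  note ext = this
  have P'o: "P' \<in> Obj (SegPre n)" using h by (simp add: Hom_SegPre)
  have ext': "\<exists>w \<in> Hom (SegPre n) P' ?Q. Cmp (SegPre n) w h = u" if u: "u \<in> Hom (SegPre n) P ?Q" for u
  proof -
    have "u \<in> Hom C P ?Q" using u by (simp add: Hom_SegPre C_def)
    then obtain w where w: "w \<in> Hom C P' ?Q" "Cmp C w h = u" using ext by blast
    show ?thesis
    proof (rule bexI)
      show "Cmp (SegPre n) w h = u" using w(2) by (simp only: SegPre_simps C_def)
      show "w \<in> Hom (SegPre n) P' ?Q" using w(1) P'o cofree_SegPre[OF inf d] by (simp add: Hom_SegPre C_def)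
    qed
  qed
  have hd: "h \<in> Arr (SegPre n)" "Dom (SegPre n) h = P" "Cod (SegPre n) h = P'" using Hom_Arr[OF h] by blast+
  show ?thesis unfolding extends_to_def mem_Collect_eq hd(2,3) using hd(1) ext' by blast
qed

text \<open>A map in the second part of \<open>I_f\<close> has an initial source, so any map out of its target will do,
  for instance the one that corresponds to the empty set.\<close>

lemma I_f_extends:
  assumes inf: "infinite (UNIV :: 'u set)" and d: "d \<in> Obj (site n)"
  shows "(I_f n :: 'u spcmap set) \<subseteq> extends_to (SegPre n) (cofree n d)"
proof
  fix h :: "'u spcmap" assume "h \<in> I_f n"
  then consider p f P j q P' j' q' where "h \<in> Arr (SegPre n)" "f \<in> gencof n"
        "is_bracket n p (nsrc f) P j q" "is_bracket n p (ntgt f) P' j' q'"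
        "nsrc h = P" "ntgt h = P'" "Cmp (SimpThetaSp n) h j = j'"
        "Cmp (SimpThetaSp n) h q = Cmp (SimpThetaSp n) q'
          (prod_ar (SimpThetaSp n) (cst_map n f) (Ide (SimpThetaSp n) (simplex n p)))"
    | "h \<in> Arr (SegPre n)" "is_initial (SimpThetaSp n) (nsrc h)"
    unfolding I_f_def by blast
  then show "h \<in> extends_to (SegPre n) (cofree n d)"
  proof cases
    case (1 p f P j q P' j' q')
    obtain m \<theta> where f: "f = gencof_map n m \<theta>" "\<theta> \<in> Obj (theta n)" using 1(2) unfolding gencof_def by blast
    have h: "h \<in> Hom (SegPre n) P P'" using 1 by (simp add: Hom_def SegPre_simps)
    show ?thesis
      by (rule bracket_extends[OF inf d gencof_Hom(1)[OF inf f(2), of m, folded f(1)] gencof_Hom(2)[OF inf f(2), of _ m, folded f(1)]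
        1(3,4) h 1(7,8)])
  next
    case 2
    have h: "h \<in> Hom (SegPre n) (nsrc h) (ntgt h)" using 2 by (simp add: Hom_def SegPre_simps)
    then have hS: "h \<in> Hom (SimpThetaSp n) (nsrc h) (ntgt h)" and P': "ntgt h \<in> Obj (SegPre n)" by (simp_all add: Hom_SegPre)
    have "\<exists>t \<in> Hom (SimpThetaSp n) (ntgt h) (cofree n d). \<forall>z \<in> el (ntgt h) d. marks n d t z \<longleftrightarrow> z \<in> {}"
      by (rule cofree_map[OF inf d spc_Hom(5)[OF hS]]) simp
    then obtain t where t: "t \<in> Hom (SimpThetaSp n) (ntgt h) (cofree n d)" by blast
    have tS: "t \<in> Hom (SegPre n) (ntgt h) (cofree n d)" using t P' cofree_SegPre[OF inf d] by (simp add: Hom_SegPre)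
    have th: "Cmp (SimpThetaSp n) t h \<in> Hom (SimpThetaSp n) (nsrc h) (cofree n d)"
      by (rule category.Cmp_Hom[OF SimpThetaSp_cat hS t])
    have "Cmp (SimpThetaSp n) t h = u" if "u \<in> Hom (SegPre n) (nsrc h) (cofree n d)" for u
    proof -
      have "u \<in> Hom (SimpThetaSp n) (nsrc h) (cofree n d)" using that by (simp add: Hom_SegPre)
      then show ?thesis using 2(2) th cofree_Simp[OF inf d] unfolding is_initial_def by blast
    qed
    then show ?thesis unfolding extends_to_def SegPre_simps using tS 2(1) by blast
  qed
qed

section \<open>The Quillen equivalence\<close>

theorem proposition7p1:
  fixes n :: nat
    and L :: "('u spc, 'u spcmap, 'u spc, 'u spcmap) func"
    and \<eta> :: "('u spc, 'u spcmap, 'u spc, 'u spcmap) ntr"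
  assumes "inaccessible TYPE('u)"
    and "n \<ge> 1"
    and "is_segal_replacement n L \<eta>"
  shows "is_Quillen_equivalence (SegPre n) (disc_f n L) (SegPre n) (disc_c n L)
           (fid (SegPre n)) (fid (SegPre n)) (\<lambda>X Y g. g)"
proof -
  interpret S: category "SegPre n :: ('u spc, 'u spcmap) cat" by (rule category_SegPre)
  note inf = inaccessible_infinite[OF assms(1)]
  have sub: "retracts_of (SegPre n) (transfinite_comps TYPE('u) (SegPre n) (pushouts_of (SegPre n) (I_f n)))
     \<subseteq> extends_to (SegPre n) (cofree n d :: 'u spc)" if "d \<in> Obj (site n)" for d
    by (intro S.retracts_extend S.transfinite_comps_extend S.pushouts_extend I_f_extends[OF inf that])
  have Cof: "Cof (disc_f n L) \<subseteq> Cof (disc_c n L)"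
  proof
    fix f assume "f \<in> Cof (disc_f n L)"
    then have "f \<in> extends_to (SegPre n) (cofree n d)" if "d \<in> Obj (site n)" for d
      using sub[OF that] by (auto simp: disc_f_def mk_model_def)
    then show "f \<in> Cof (disc_c n L)" using extends_mono[OF inf] by (simp add: disc_c_def mk_model_def)
  qed
  have WE: "WE (disc_f n L) = DK n L" "WE (disc_c n L) = DK n L" by (simp_all add: disc_f_def disc_c_def mk_model_def)
  have Arr: "f \<in> Arr (SegPre n)" if "f \<in> Cof (disc_c n L)" for f
    using that by (simp add: disc_c_def mk_model_def is_mono_def)
  have adj: "is_adjunction (SegPre n) (SegPre n) (fid (SegPre n)) (fid (SegPre n)) (\<lambda>X Y g. g :: 'u spcmap)"
    unfolding is_adjunction_def
  proof (intro conjI ballI is_functor_fid category_SegPre)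
    fix X Y :: "'u spc" assume "X \<in> Obj (SegPre n)" "Y \<in> Obj (SegPre n)"
    then show "bij_betw (\<lambda>g. g) (Hom (SegPre n) (fob (fid (SegPre n)) X) Y) (Hom (SegPre n) X (fob (fid (SegPre n)) Y))"
      by (simp add: fid_def bij_betw_def)
  next
    fix X X' Y Y' :: "'u spc" and u g v
    assume "X \<in> Obj (SegPre n)" "Y \<in> Obj (SegPre n)" and u: "u \<in> Hom (SegPre n) X' X"
      and "g \<in> Hom (SegPre n) (fob (fid (SegPre n)) X) Y" and v: "v \<in> Hom (SegPre n) Y Y'"
    then show "Cmp (SegPre n) v (Cmp (SegPre n) g (far (fid (SegPre n)) u)) =
       Cmp (SegPre n) (far (fid (SegPre n)) v) (Cmp (SegPre n) g u)"
      using Hom_Arr[OF u] Hom_Arr[OF v] by (simp add: fid_def)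
  qed
  show ?thesis unfolding is_Quillen_equivalence_def
    using adj Cof Arr WE by (auto simp: fid_def)
qed

end
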